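(* Let $L\ge2$, $N\ge1$ be integers and let $\alpha_k,\gamma_k$ ($1\le k\le L-1$), $\beta_i$ ($1\le i\le N$) be complex constants. For any twisted cycle $\Delta\in H_{L-1}(T,{\cal L}^\vee)$, the functions $$y_0=\int_\Delta U(t)\,\varphi_0\qquad\text{and}\qquad y_n^{(i)}=\int_\Delta U(t)\,\varphi_n^{(i)}\quad(1\le i\le N,\ 1\le n\le L-1)$$ of $x=(x_1,\dots,x_N)$ satisfy the linear Pfaffian system $$(x_i-1)\frac{\partial y_0}{\partial x_i}=\beta_i\Bigl(-y_0+\sum_{m=1}^{L-1}y_m^{(i)}\Bigr),$$ $$(x_i-x_j)\frac{\partial y_n^{(j)}}{\partial x_i}=\beta_i\bigl(y_n^{(i)}-y_n^{(j)}\bigr),$$ $$x_i\frac{\partial y_n^{(i)}}{\partial x_i}=-\alpha_ny_n^{(i)}+(\gamma_n-\alpha_n)\sum_{m=n+1}^{L-1}y_m^{(i)}+\frac{\gamma_n-\alpha_n}{x_i-1}\Bigl(-y_0+\sum_{m=1}^{L-1}y_m^{(i)}\Bigr)+\sum_{\substack{j=1\\ j\ne i}}^N\frac{\beta_jx_j}{x_i-x_j}\bigl(y_n^{(j)}-y_n^{(i)}\bigr),$$ for all $1\le i\le N$, $1\le n\le L-1$, and (in the second equation) all $1\le j\le N$ with $j\neq i$.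
   Context: Here $x=(x_1,\dots,x_N)$ ranges in $X=\{x\in{\mathbb C}^N\mid x_i\ne x_j\ (i\ne j),\ x_i\ne0,1\}$. Put $t_0=1$ and consider the multivalued function $$U(t)=t_{L-1}^{\alpha_{L-1}}\prod_{k=1}^{L-2}t_k^{\alpha_k-\gamma_{k+1}}\prod_{k=1}^{L-1}(t_{k-1}-t_k)^{\gamma_k-\alpha_k}\prod_{i=1}^N(1-x_it_{L-1})^{-\beta_i}$$ on $$T=\{t=(t_1,\dots,t_{L-1})\in{\mathbb C}^{L-1}\mid t_k\ne0,\ t_k\ne t_{k-1}\ (1\le k\le L-1),\ t_{L-1}\ne1/x_i\ (1\le i\le N)\}.$$ Let $\omega={\rm d}\log U(t)$ (exterior derivative in $t$) and $\nabla_\omega={\rm d}+\omega\wedge$. ${\cal L}$ is the rank-one local system on $T$ of local solutions of $\nabla_\omega h=0$ (so determined by $1/U(t)$), and ${\cal L}^\vee$ is its dual local system, whose local sections are constant multiples of branches of $U(t)$. Elements of $H_{L-1}(T,{\cal L}^\vee)$ (homology with coefficients in ${\cal L}^\vee$) are called twisted cycles; $\int_\Delta U\varphi$ is the integral of the $(L-1)$-form $\varphi$ over the underlying chain of $\Delta$, multiplied by the branches of $U$ attached to it. As $x$ varies, $T$ and $U$ vary and $\Delta$ is continued locally constantly (parallel transport) in $x$. The rational $(L-1)$-forms are $$\varphi_0=\frac{{\rm d}t_1\wedge\cdots\wedge{\rm d}t_{L-1}}{t_{L-1}\prod_{k=1}^{L-1}(t_{k-1}-t_k)},\qquad \varphi_n^{(i)}=\frac{{\rm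 d}t_1\wedge\cdots\wedge{\rm d}t_{L-1}}{t_{L-1}(1-x_it_{L-1})\prod_{1\le k\le L-1,\,k\ne n}(t_{k-1}-t_k)}\quad(1\le i\le N,\ 1\le n\le L-1).$$ *)

theory Defs
  imports "HOL-Analysis.Analysis" "HOL-Homology.Simplices"
begin

text \<open>
  The coordinates of \<open>x\<close> are indexed by a finite type \<open>'n\<close> (so \<open>N = CARD('n)\<close>).  A point
  \<open>t = (t_1, ..., t_(L-1))\<close> is a function on \<open>nat\<close> with \<open>t 0 = 1\<close> and \<open>t k = 0\<close> for \<open>k \<ge> L\<close>;
  only \<open>\<alpha> k\<close>, \<open>\<gamma> k\<close> with \<open>1 \<le> k \<le> L - 1\<close> are used.
\<close>

definition X_space :: "(complex ^ 'n) set" where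
  "X_space = {x. (\<forall>i j. i \<noteq> j \<longrightarrow> x $ i \<noteq> x $ j) \<and> (\<forall>i. x $ i \<noteq> 0 \<and> x $ i \<noteq> 1)}"

text \<open>The last condition is meaningful because \<open>x i \<noteq> 0\<close> on \<open>X_space\<close>.\<close>

definition T_space :: "nat \<Rightarrow> complex ^ 'n \<Rightarrow> (nat \<Rightarrow> complex) set" where
  "T_space L x = {t. t 0 = 1 \<and> (\<forall>k\<ge>L. t k = 0) \<and>
     (\<forall>k\<in>{1..L-1}. t k \<noteq> 0 \<and> t k \<noteq> t (k - 1)) \<and>
     (\<forall>i. t (L - 1) \<noteq> 1 / x $ i)}"


subsection \<open>Branches of \<open>U\<close> and the local system\<close>

text \<open>
  \<open>u\<close> is a continuous branch of the multivalued function \<open>U(t; x)\<close> along the map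
  \<open>s \<mapsto> (x s, t s)\<close> on \<open>S\<close>: the powers in \<open>U\<close> are formed with continuous logarithms
  \<open>A k\<close>, \<open>B k\<close>, \<open>C i\<close> of \<open>t_k\<close>, \<open>t_(k-1) - t_k\<close>, \<open>1 - x_i t_(L-1)\<close> along that map.
  With \<open>x\<close> constant this is a branch on a fixed fibre; with \<open>x\<close> varying it expresses the
  continuation of a branch in \<open>x\<close>.
\<close>

definition U_branch ::
  "nat \<Rightarrow> (nat \<Rightarrow> complex) \<Rightarrow> (nat \<Rightarrow> complex) \<Rightarrow> ('n::finite \<Rightarrow> complex) \<Rightarrow>
   's::topological_space set \<Rightarrow> ('s \<Rightarrow> complex ^ 'n) \<Rightarrow> ('s \<Rightarrow> nat \<Rightarrow> complex) \<Rightarrow>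
   ('s \<Rightarrow> complex) \<Rightarrow> bool" where
  "U_branch L \<alpha> \<gamma> \<beta> S x t u \<longleftrightarrow>
    (\<exists>A B C.
      (\<forall>k\<in>{1..L-1}. continuous_on S (A k) \<and> continuous_on S (B k) \<and>
         (\<forall>s\<in>S. exp (A k s) = t s k \<and> exp (B k s) = t s (k - 1) - t s k)) \<and>
      (\<forall>i. continuous_on S (C i) \<and> (\<forall>s\<in>S. exp (C i s) = 1 - x s $ i * t s (L - 1))) \<and>
      (\<forall>s\<in>S. u s =
         exp (\<alpha> (L - 1) * A (L - 1) s)
         * (\<Prod>k=1..L-2. exp ((\<alpha> k - \<gamma> (k + 1)) * A k s))
         * (\<Prod>k=1..L-1. exp ((\<gamma> k - \<alpha> k) * B k s))
         * (\<Prod>i\<in>UNIV. exp (- \<beta> i * C i s))))"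


subsection \<open>Smooth singular simplices\<close>

text \<open>
  \<open>f\<close> is \<open>C\<^sup>\<infinity>\<close> on the closed simplex: it extends to a \<open>C\<^sup>\<infinity>\<close> function on a neighbourhood in
  \<open>{s. \<forall>i>p. s i = 0}\<close>, a copy of \<open>(p+1)\<close>-dimensional real space.  \<open>D \<nu>\<close> is the partial derivative
  of the extension for the multi-index \<open>\<nu>\<close>.
\<close>

definition smooth_on_simplex :: "nat \<Rightarrow> ((nat \<Rightarrow> real) \<Rightarrow> complex) \<Rightarrow> bool" where
  "smooth_on_simplex p f \<longleftrightarrow>
    (\<exists>V D. open V \<and> standard_simplex p \<subseteq> V \<and>
      (\<forall>s\<in>standard_simplex p. D (\<lambda>_. 0) s = f s) \<and>
      (\<forall>\<nu> :: nat \<Rightarrow> nat.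
         continuous_on (V \<inter> {s. \<forall>i>p. s i = 0}) (D \<nu>) \<and>
         (\<forall>i\<le>p. \<forall>s \<in> V \<inter> {s. \<forall>i>p. s i = 0}.
            ((\<lambda>h. D \<nu> (s(i := h))) has_vector_derivative D (\<nu>(i := Suc (\<nu> i))) s) (at (s i)))))"

definition smooth_simplex ::
  "nat \<Rightarrow> (nat \<Rightarrow> complex) set \<Rightarrow> ((nat \<Rightarrow> real) \<Rightarrow> nat \<Rightarrow> complex) \<Rightarrow> bool" where
  "smooth_simplex p T \<sigma> \<longleftrightarrow>
    singular_simplex p (top_of_set T) \<sigma> \<and> (\<forall>k. smooth_on_simplex p (\<lambda>s. \<sigma> s k))"


subsection \<open>Homology with coefficients in the dual local system\<close>

text \<open>
  A \<open>p\<close>-chain with coefficients in the dual local system is a finitely supported function sending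
  each singular simplex \<open>\<sigma>\<close> to a section, along \<open>\<sigma>\<close>, of that local system, i.e. to a constant
  multiple of a branch of \<open>U\<close> along \<open>\<sigma>\<close>.  Sections are set to \<open>0\<close> off the standard simplex, so that
  chains are added pointwise.  Smooth simplices are used, as is needed for integrating forms over
  chains; they compute the same homology as continuous ones.
\<close>

type_synonym twisted_chain =
  "((nat \<Rightarrow> real) \<Rightarrow> nat \<Rightarrow> complex) \<Rightarrow> (nat \<Rightarrow> real) \<Rightarrow> complex"

definition chain_support :: "twisted_chain \<Rightarrow> ((nat \<Rightarrow> real) \<Rightarrow> nat \<Rightarrow> complex) set" where
  "chain_support c = {\<sigma>. c \<sigma> \<noteq> (\<lambda>_. 0)}"

definition twisted_section ::
  "nat \<Rightarrow> (nat \<Rightarrow> complex) \<Rightarrow> (nat \<Rightarrow> complex) \<Rightarrow> ('n::finite \<Rightarrow> complex) \<Rightarrow> complex ^ 'n \<Rightarrow>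
   nat \<Rightarrow> ((nat \<Rightarrow> real) \<Rightarrow> nat \<Rightarrow> complex) \<Rightarrow> ((nat \<Rightarrow> real) \<Rightarrow> complex) \<Rightarrow> bool" where
  "twisted_section L \<alpha> \<gamma> \<beta> x p \<sigma> v \<longleftrightarrow>
    (\<exists>a u. U_branch L \<alpha> \<gamma> \<beta> (standard_simplex p) (\<lambda>_. x) \<sigma> u \<and>
       v = (\<lambda>s. if s \<in> standard_simplex p then a * u s else 0))"

definition twisted_chains ::
  "nat \<Rightarrow> (nat \<Rightarrow> complex) \<Rightarrow> (nat \<Rightarrow> complex) \<Rightarrow> ('n::finite \<Rightarrow> complex) \<Rightarrow> complex ^ 'n \<Rightarrow>
   nat \<Rightarrow> twisted_chain set" where
  "twisted_chains L \<alpha> \<gamma> \<beta> x p = {c. finite (chain_support c) \<and>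
     (\<forall>\<sigma>\<in>chain_support c.
        smooth_simplex p (T_space L x) \<sigma> \<and> twisted_section L \<alpha> \<gamma> \<beta> x p \<sigma> (c \<sigma>))}"

text \<open>
  The coefficient of the boundary at a \<open>(p-1)\<close>-simplex \<open>\<tau>\<close> collects, with the usual signs, the
  restrictions of the coefficients of all \<open>p\<close>-simplices to those faces which are equal to \<open>\<tau>\<close>.
  This is used for \<open>p \<ge> 1\<close> only.
\<close>

definition twisted_boundary :: "nat \<Rightarrow> twisted_chain \<Rightarrow> twisted_chain" where
  "twisted_boundary p c = (\<lambda>\<tau> s.
     if s \<in> standard_simplex (p - 1)
     then \<Sum>\<sigma>\<in>chain_support c. \<Sum>k | k \<le> p \<and> singular_face p k \<sigma> = \<tau>.
            (-1) ^ k * c \<sigma> (simplical_face k s)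
     else 0)"

definition twisted_cycles ::
  "nat \<Rightarrow> (nat \<Rightarrow> complex) \<Rightarrow> (nat \<Rightarrow> complex) \<Rightarrow> ('n::finite \<Rightarrow> complex) \<Rightarrow> complex ^ 'n \<Rightarrow>
   nat \<Rightarrow> twisted_chain set" where
  "twisted_cycles L \<alpha> \<gamma> \<beta> x p =
    {c \<in> twisted_chains L \<alpha> \<gamma> \<beta> x p. twisted_boundary p c = (\<lambda>_ _. 0)}"

definition twisted_homologous ::
  "nat \<Rightarrow> (nat \<Rightarrow> complex) \<Rightarrow> (nat \<Rightarrow> complex) \<Rightarrow> ('n::finite \<Rightarrow> complex) \<Rightarrow> complex ^ 'n \<Rightarrow>
   nat \<Rightarrow> (twisted_chain \<times> twisted_chain) set" where
  "twisted_homologous L \<alpha> \<gamma> \<beta> x p =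
    {(c, c'). c \<in> twisted_cycles L \<alpha> \<gamma> \<beta> x p \<and> c' \<in> twisted_cycles L \<alpha> \<gamma> \<beta> x p \<and>
       (\<exists>b\<in>twisted_chains L \<alpha> \<gamma> \<beta> x (Suc p).
          twisted_boundary (Suc p) b = (\<lambda>\<sigma> s. c \<sigma> s - c' \<sigma> s))}"

definition twisted_homology ::
  "nat \<Rightarrow> (nat \<Rightarrow> complex) \<Rightarrow> (nat \<Rightarrow> complex) \<Rightarrow> ('n::finite \<Rightarrow> complex) \<Rightarrow> complex ^ 'n \<Rightarrow>
   nat \<Rightarrow> twisted_chain set set" where
  "twisted_homology L \<alpha> \<gamma> \<beta> x p =
    twisted_cycles L \<alpha> \<gamma> \<beta> x p // twisted_homologous L \<alpha> \<gamma> \<beta> x p"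

text \<open>
  A family of classes \<open>\<Delta> x\<close> (for \<open>x\<close> in \<open>W\<close>) in the top homology groups \<open>H_(L-1)\<close> of the fibres is
  locally constant if near every point of \<open>W\<close> it is represented by a chain whose simplices
  \<open>\<sigma> \<in> F\<close> do not depend on \<open>x\<close> and whose coefficients \<open>a \<sigma> * u \<sigma>\<close> are obtained by continuing the
  branches of \<open>U\<close> jointly in \<open>x\<close> and the simplex parameter.  Every class on a fibre extends to such
  a family on a small ball, because a compact simplex in \<open>T_space L x0\<close> lies in \<open>T_space L x\<close> for all
  \<open>x\<close> near \<open>x0\<close>.
\<close>

definition locally_constant_family ::
  "nat \<Rightarrow> (nat \<Rightarrow> complex) \<Rightarrow> (nat \<Rightarrow> complex) \<Rightarrow> ('n::finite \<Rightarrow> complex) \<Rightarrow>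
   (complex ^ 'n) set \<Rightarrow> (complex ^ 'n \<Rightarrow> twisted_chain set) \<Rightarrow> bool" where
  "locally_constant_family L \<alpha> \<gamma> \<beta> W \<Delta> \<longleftrightarrow>
    (\<forall>x\<in>W. \<Delta> x \<in> twisted_homology L \<alpha> \<gamma> \<beta> x (L - 1)) \<and>
    (\<forall>x0\<in>W. \<exists>V F a u. open V \<and> x0 \<in> V \<and> V \<subseteq> W \<and> finite F \<and>
       (\<forall>\<sigma>\<in>F. (\<forall>x\<in>V. smooth_simplex (L - 1) (T_space L x) \<sigma>) \<and>
          U_branch L \<alpha> \<gamma> \<beta> (V \<times> standard_simplex (L - 1)) fst (\<lambda>(x, s). \<sigma> s) (u \<sigma>)) \<and>
       (\<forall>x\<in>V. (\<lambda>\<sigma> s. if \<sigma> \<in> F \<and> s \<in> standard_simplex (L - 1) then a \<sigma> * u \<sigma> (x, s) else 0)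
          \<in> \<Delta> x))"


subsection \<open>Integration over twisted chains\<close>

text \<open>
  The interior of the simplex in the coordinates \<open>s 1, ..., s p\<close> (the remaining barycentric
  coordinate being \<open>s 0 = 1 - s 1 - ... - s p\<close>), with its standard orientation.
\<close>

definition open_simplex :: "nat \<Rightarrow> (nat \<Rightarrow> real) set" where
  "open_simplex p = {s \<in> {1..p} \<rightarrow>\<^sub>E UNIV. (\<forall>i\<in>{1..p}. 0 < s i) \<and> (\<Sum>i=1..p. s i) < 1}"

definition barycentric :: "nat \<Rightarrow> (nat \<Rightarrow> real) \<Rightarrow> nat \<Rightarrow> real" where
  "barycentric p s = (\<lambda>i. if i = 0 then 1 - (\<Sum>j=1..p. s j) else if i \<le> p then s i else 0)"

text \<open>The Jacobian determinant (Leibniz formula) of \<open>(t_1, ..., t_p)\<close> along \<open>\<sigma>\<close>.\<close>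

definition simplex_jacobian ::
  "nat \<Rightarrow> ((nat \<Rightarrow> real) \<Rightarrow> nat \<Rightarrow> complex) \<Rightarrow> (nat \<Rightarrow> real) \<Rightarrow> complex" where
  "simplex_jacobian p \<sigma> s =
    (\<Sum>\<pi> | \<pi> permutes {1..p}. of_int (sign \<pi>) *
       (\<Prod>i=1..p. vector_derivative (\<lambda>h. \<sigma> (barycentric p (s(i := h))) (\<pi> i)) (at (s i))))"

text \<open>
  The integral of the \<open>p\<close>-form \<open>\<phi>(t) dt_1 \<and> ... \<and> dt_p\<close>, given by its coefficient \<open>\<phi>\<close>, over the
  underlying chain of \<open>c\<close>, multiplied by the branches of \<open>U\<close> that are the coefficients of \<open>c\<close>.
\<close>

definition twisted_integral ::
  "nat \<Rightarrow> ((nat \<Rightarrow> complex) \<Rightarrow> complex) \<Rightarrow> twisted_chain \<Rightarrow> complex" where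
  "twisted_integral p \<phi> c =
    (\<Sum>\<sigma>\<in>chain_support c.
       LINT s:open_simplex p | (\<Pi>\<^sub>M i\<in>{1..p}. lborel).
         c \<sigma> (barycentric p s) * \<phi> (\<sigma> (barycentric p s)) * simplex_jacobian p \<sigma> s)"

text \<open>Coefficients of the forms \<open>\<phi>_0\<close> and \<open>\<phi>_n^(i)\<close> with respect to \<open>dt_1 \<and> ... \<and> dt_(L-1)\<close>.\<close>

definition phi0 :: "nat \<Rightarrow> (nat \<Rightarrow> complex) \<Rightarrow> complex" where
  "phi0 L t = 1 / (t (L - 1) * (\<Prod>k=1..L-1. t (k - 1) - t k))"

definition phi :: "nat \<Rightarrow> complex ^ 'n \<Rightarrow> nat \<Rightarrow> 'n \<Rightarrow> (nat \<Rightarrow> complex) \<Rightarrow> complex" where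
  "phi L x n i t =
    1 / (t (L - 1) * (1 - x $ i * t (L - 1)) * (\<Prod>k\<in>{1..L-1} - {n}. t (k - 1) - t k))"


subsection \<open>Partial derivatives in \<open>x\<close>\<close>

definition coord_line :: "(complex ^ 'n \<Rightarrow> complex) \<Rightarrow> 'n \<Rightarrow> complex ^ 'n \<Rightarrow> complex \<Rightarrow> complex" where
  "coord_line f i x = (\<lambda>z. f (\<chi> j. if j = i then z else x $ j))"

definition has_partial :: "(complex ^ 'n \<Rightarrow> complex) \<Rightarrow> 'n \<Rightarrow> complex ^ 'n \<Rightarrow> bool" where
  "has_partial f i x \<longleftrightarrow> coord_line f i x field_differentiable at (x $ i)"

definition partial :: "'n \<Rightarrow> (complex ^ 'n \<Rightarrow> complex) \<Rightarrow> complex ^ 'n \<Rightarrow> complex" where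
  "partial i f x = deriv (coord_line f i x) (x $ i)"

end

(* Differentiating under the integral sign gives the first two equations at once, because there the
   integrands agree pointwise.  For the third, put E_n = sum_{m >= n} t_m d/dt_m.  The Lie derivative
   of the form U phi_n^(i) along E_n is exact, hence integrates to 0 over a twisted cycle, and it equals
     (alpha_n - (gamma_n - alpha_n) t_n / (t_(n-1) - t_n) + sum_j beta_j x_j t_(L-1) / (1 - x_j t_(L-1))
        + x_i t_(L-1) / (1 - x_i t_(L-1))) U phi_n^(i),
   which is the third equation after partial fractions.  That integrals of exact forms vanish and that
   integrals depend only on the homology class both follow from Stokes' theorem for one smooth simplex:
   with d(g dF_1 ... dF_(p-1)) = det(dg, dF_1, ..., dF_(p-1)), the cofactors of the Jacobian are
   divergence free, so the integral reduces to the fundamental theorem of calculus in each coordinate. *)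
theory Submission
  imports Defs
begin

subsection \<open>Integration over simplices\<close>

text \<open>E_n generates the dilation of t_n, ..., t_(L-1), under which each t_(k-1) - t_k with k >
  n is homogeneous; hence only t_(n-1) - t_n and the factors 1 - x_j t_(L-1) leave non-constant
  terms, and the constants add up to alpha_n. Each summand t_r d/dt_r is treated separately, the
  primitive being the form without dt_r. The obstacle in Stokes' theorem is the dependent
  barycentric coordinate s_0. A derivative in s_i integrates to a difference of face 0 and face i,
  but face 0 comes parametrised differently for each i. Transpositions of barycentric coordinates
  preserve the integral and reconcile these parametrisations; the p contributions then add up to one
  Jacobian. The representatives \<open>c x\<close> may vary arbitrarily with \<open>x\<close> inside
  their classes, so homology invariance must come before differentiation: it replaces them by chains
  with fixed simplices. All forms to be differentiated or shown exact are branches of one product of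
  powers up to integer shifts of the exponents, so the same derivative formulas serve them
  all.\<close>

abbreviation lborel_product :: "nat set \<Rightarrow> (nat \<Rightarrow> real) measure" where
  "lborel_product I \<equiv> Pi\<^sub>M I (\<lambda>_. lborel)"

definition corner_simplex :: "nat set \<Rightarrow> (nat \<Rightarrow> real) set" where
  "corner_simplex I = {s \<in> I \<rightarrow>\<^sub>E UNIV. (\<forall>i\<in>I. 0 < s i) \<and> (\<Sum>i\<in>I. s i) < 1}"

lemma open_simplex_corner: "open_simplex p = corner_simplex {1..p}"
  by (simp add: open_simplex_def corner_simplex_def)

lemma product_sigma_finite_lborel: "product_sigma_finite (\<lambda>_::nat. lborel :: real measure)"
  by unfold_locales

lemma corner_simplex_sets [measurable]:
  assumes "finite I"
  shows "corner_simplex I \<in> sets (lborel_product I)"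
proof -
  have eq: "corner_simplex I = {s \<in> space (lborel_product I). (\<forall>i\<in>I. 0 < s i) \<and> (\<Sum>i\<in>I. s i) < 1}"
    by (auto simp: corner_simplex_def space_PiM)
  show ?thesis
    unfolding eq using assms by measurable
qed

lemma emeasure_corner_simplex:
  assumes "finite I"
  shows "emeasure (lborel_product I) (corner_simplex I) < \<infinity>"
proof -
  interpret product_sigma_finite "\<lambda>_::nat. lborel :: real measure"
    by (rule product_sigma_finite_lborel)
  have "s i \<le> 1" if "s \<in> corner_simplex I" "i \<in> I" for s i
  proof -
    have "s i \<le> (\<Sum>i\<in>I. s i)"
      using that assms by (intro member_le_sum) (auto simp: corner_simplex_def less_imp_le)
    then show ?thesis using that by (auto simp: corner_simplex_def)
  qed
  then have "corner_simplex I \<subseteq> (\<Pi>\<^sub>E i\<in>I. {0..1})"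
    by (auto simp: corner_simplex_def PiE_iff less_imp_le extensional_def)
  then have "emeasure (lborel_product I) (corner_simplex I) \<le> emeasure (lborel_product I) (\<Pi>\<^sub>E i\<in>I. {0..1})"
    using assms by (intro emeasure_mono sets_PiM_I_finite) auto
  also have "\<dots> < \<infinity>"
    using assms by (subst emeasure_PiM) auto
  finally show ?thesis .
qed

lemma barycentric_sum: "(\<Sum>i\<le>p. barycentric p s i) = 1"
proof -
  have "{..p} = insert 0 {1..p}" by auto
  then have "(\<Sum>i\<le>p. barycentric p s i) = barycentric p s 0 + (\<Sum>i=1..p. barycentric p s i)"
    by simp
  also have "(\<Sum>i=1..p. barycentric p s i) = (\<Sum>i=1..p. s i)"
    by (intro sum.cong) (auto simp: barycentric_def)
  finally show ?thesis by (simp add: barycentric_def)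
qed

lemma standard_simplexI:
  assumes "\<And>i. 0 \<le> s i" "\<And>i. i > p \<Longrightarrow> s i = 0" "(\<Sum>i\<le>p. s i) = 1"
  shows "s \<in> standard_simplex p"
proof -
  have "s i \<le> 1" for i
  proof (cases "i \<le> p")
    case True
    then have "s i \<le> (\<Sum>i\<le>p. s i)" using assms(1) by (intro member_le_sum) auto
    then show ?thesis using assms by simp
  next
    case False
    then show ?thesis using assms(2)[of i] by simp
  qed
  then show ?thesis using assms by (auto simp: standard_simplex_def)
qed

lemma barycentric_in_standard_simplex:
  assumes "\<And>i. i \<in> {1..p} \<Longrightarrow> 0 \<le> s i" "(\<Sum>i=1..p. s i) \<le> 1"
  shows "barycentric p s \<in> standard_simplex p"
proof (rule standard_simplexI)
  show "(\<Sum>i\<le>p. barycentric p s i) = 1" by (rule barycentric_sum)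
qed (use assms in \<open>auto simp: barycentric_def\<close>)

lemma barycentric_open_simplex:
  "s \<in> open_simplex p \<Longrightarrow> barycentric p s \<in> standard_simplex p"
  by (rule barycentric_in_standard_simplex) (auto simp: open_simplex_def less_imp_le)

lemma compact_standard_simplex: "compact (standard_simplex p)"
  using compactin_standard_simplex[of p] by (simp add: euclidean_product_topology)

lemma barycentric_measurable [measurable]:
  "barycentric p \<in> borel_measurable (lborel_product {1..p})"
proof (rule measurable_coordinatewise_then_product)
  fix i
  show "(\<lambda>s. barycentric p s i) \<in> borel_measurable (lborel_product {1..p})"
  proof (cases "i = 0")
    case True
    then show ?thesis unfolding barycentric_def by simp
  next
    case False
    then show ?thesis
    proof (cases "i \<le> p")
      case True
      then have [measurable]: "i \<in> {1..p}" using False by auto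
      show ?thesis unfolding barycentric_def using False True by simp
    qed (simp add: barycentric_def)
  qed
qed

text \<open>\<open>k\<close> is only known on the compact simplex, where it is bounded; its
  extension by 0 is Borel, and the corner simplex has finite measure. The map \<open>w\<close> is
  left general because the face integrals evaluate \<open>k\<close> along other maps than
  \<open>barycentric\<close>.\<close>

lemma set_integrable_corner_compose:
  fixes k :: "(nat \<Rightarrow> real) \<Rightarrow> complex"
  assumes k: "continuous_on (standard_simplex p) k" and "finite I"
    and w: "w \<in> borel_measurable (lborel_product I)"
    and in_simplex: "\<And>s. s \<in> corner_simplex I \<Longrightarrow> w s \<in> standard_simplex p"
  shows "set_integrable (lborel_product I) (corner_simplex I) (\<lambda>s. k (w s))"
proof -
  define k' where "k' = (\<lambda>s. indicator (standard_simplex p) s *\<^sub>R k s)"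
  have "standard_simplex p \<in> sets borel"
    by (intro borel_closed compact_imp_closed compact_standard_simplex)
  then have k': "k' \<in> borel_measurable borel"
    unfolding k'_def using k by (rule borel_measurable_continuous_on_indicator)
  obtain B where B: "\<And>s. s \<in> standard_simplex p \<Longrightarrow> norm (k s) \<le> B"
    using compact_imp_bounded[OF compact_continuous_image[OF k compact_standard_simplex]]
    by (auto simp: bounded_iff)
  have [measurable]: "corner_simplex I \<in> sets (lborel_product I)"
    using assms(2) by simp
  have "integrable (lborel_product I) (\<lambda>s. indicator (corner_simplex I) s *\<^sub>R k' (w s))"
  proof (rule Bochner_Integration.integrable_bound)
    show "integrable (lborel_product I) (\<lambda>s. indicator (corner_simplex I) s *\<^sub>R B)"
      using emeasure_corner_simplex[OF assms(2)] by auto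
    show "AE s in lborel_product I. norm (indicator (corner_simplex I) s *\<^sub>R k' (w s))
        \<le> norm (indicator (corner_simplex I) s *\<^sub>R B)"
      using B by (intro AE_I2) (auto simp: indicator_def k'_def in_simplex
          intro: order_trans[OF _ abs_ge_self])
    show "(\<lambda>s. indicator (corner_simplex I) s *\<^sub>R k' (w s)) \<in> borel_measurable (lborel_product I)"
      using measurable_compose[OF w k'] by measurable
  qed
  also have "(\<lambda>s. indicator (corner_simplex I) s *\<^sub>R k' (w s)) =
      (\<lambda>s. indicator (corner_simplex I) s *\<^sub>R k (w s))"
    by (auto simp: indicator_def k'_def in_simplex)
  finally show ?thesis unfolding set_integrable_def .
qed

lemma set_integrable_barycentric:
  fixes k :: "(nat \<Rightarrow> real) \<Rightarrow> complex"
  assumes "continuous_on (standard_simplex p) k"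
  shows "set_integrable (lborel_product {1..p}) (open_simplex p) (\<lambda>s. k (barycentric p s))"
  unfolding open_simplex_corner
  by (rule set_integrable_corner_compose[OF assms _ barycentric_measurable])
     (auto simp: barycentric_open_simplex open_simplex_corner)

section \<open>Iterated integrals and changes of variables on corner simplices\<close>

lemma corner_simplex_upd:
  assumes "finite I" "i \<notin> I" "x \<in> I \<rightarrow>\<^sub>E UNIV"
  shows "x(i := y) \<in> corner_simplex (insert i I) \<longleftrightarrow>
    x \<in> corner_simplex I \<and> 0 < y \<and> y < 1 - (\<Sum>j\<in>I. x j)"
proof -
  have "x(i := y) \<in> insert i I \<rightarrow>\<^sub>E UNIV"
    using assms(3) by (intro PiE_fun_upd UNIV_I)
  moreover have "(\<Sum>j\<in>insert i I. (x(i := y)) j) = y + (\<Sum>j\<in>I. x j)"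
  proof -
    have "(\<Sum>j\<in>I. (x(i := y)) j) = (\<Sum>j\<in>I. x j)"
      using assms by (intro sum.cong) auto
    then show ?thesis using assms by simp
  qed
  moreover have "(\<forall>j\<in>insert i I. 0 < (x(i := y)) j) \<longleftrightarrow> 0 < y \<and> (\<forall>j\<in>I. 0 < x j)"
    using assms by auto
  ultimately show ?thesis
    using assms(3) unfolding corner_simplex_def mem_Collect_eq by argo
qed

text \<open>Fubini with coordinate \<open>i\<close> innermost: over a point \<open>x\<close> of the
  smaller simplex the fibre is the interval from 0 to 1 minus the sum of \<open>x\<close>. This
  exposes one coordinate to the fundamental theorem of calculus.\<close>

lemma set_integral_corner_insert:
  fixes f :: "(nat \<Rightarrow> real) \<Rightarrow> complex"
  assumes "finite I" "i \<notin> I"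
    and "set_integrable (lborel_product (insert i I)) (corner_simplex (insert i I)) f"
  shows "(LINT s:corner_simplex (insert i I)|lborel_product (insert i I). f s) =
    (LINT x:corner_simplex I|lborel_product I.
       LINT y:{0<..<1 - (\<Sum>j\<in>I. x j)}|lborel. f (x(i := y)))"
proof -
  interpret product_sigma_finite "\<lambda>_::nat. lborel :: real measure"
    by (rule product_sigma_finite_lborel)
  have inner: "(LINT y|lborel. indicator (corner_simplex (insert i I)) (x(i := y)) *\<^sub>R f (x(i := y))) =
      indicator (corner_simplex I) x *\<^sub>R
        (LINT y|lborel. indicator {0<..<1 - (\<Sum>j\<in>I. x j)} y *\<^sub>R f (x(i := y)))"
    if "x \<in> I \<rightarrow>\<^sub>E UNIV" for x
  proof -
    have "indicator (corner_simplex (insert i I)) (x(i := y)) *\<^sub>R f (x(i := y)) =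
        indicator (corner_simplex I) x *\<^sub>R indicator {0<..<1 - (\<Sum>j\<in>I. x j)} y *\<^sub>R f (x(i := y))" for y
      using corner_simplex_upd[OF assms(1,2) that, of y] by (simp add: indicator_def)
    then show ?thesis
      by (simp only: Bochner_Integration.integral_scaleR_right)
  qed
  show ?thesis
    unfolding set_lebesgue_integral_def
    using product_integral_insert[OF assms(1,2) assms(3)[unfolded set_integrable_def]]
    by (simp only:) (intro Bochner_Integration.integral_cong refl inner, simp add: space_PiM)
qed

lemma set_integral_lborel_reflect:
  fixes f :: "real \<Rightarrow> complex"
  shows "(LINT y:{0<..<r}|lborel. f (r - y)) = (LINT y:{0<..<r}|lborel. f y)"
  unfolding set_lebesgue_integral_def
  by (subst (2) lborel_integral_real_affine[of "-1" _ r])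
     (auto simp: indicator_def intro!: Bochner_Integration.integral_cong)

text \<open>Differentiability is assumed only inside the interval, since the ends of a fibre of the
  simplex lie on faces, where no derivative is available.\<close>

lemma interval_FTC_interior:
  fixes f f' :: "real \<Rightarrow> complex"
  assumes "0 \<le> r" "continuous_on {0..r} f" "continuous_on {0..r} f'"
    and "\<And>y. y \<in> {0<..<r} \<Longrightarrow> (f has_vector_derivative f' y) (at y)"
  shows "(LINT y:{0<..<r}|lborel. f' y) = f r - f 0"
proof -
  have "(LINT y:{0<..<r}|lborel. f' y) = (LINT y:{0..r}|lborel. f' y)"
    using interval_integral_Icc[of 0 r f'] interval_integral_Ioo[of 0 r f'] assms(1)
    by (simp add: zero_ereal_def)
  also have "\<dots> = integral {0..r} f'"
    by (intro set_borel_integral_eq_integral borel_integrable_atLeastAtMost' assms)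
  also have "\<dots> = f r - f 0"
    using fundamental_theorem_of_calculus_interior[OF assms(1,2,4)] by (rule integral_unique)
  finally show ?thesis .
qed

text \<open>A box pulls back to a box with the sides renamed, and boxes determine the product
  measure. Renaming is needed because freezing coordinate \<open>i\<close> leaves the index set
  \<open>{1..p} - {i}\<close>, whereas a face is integrated over \<open>{1..p-1}\<close>.\<close>

lemma lborel_product_reindex:
  assumes "finite I" "bij_betw \<epsilon> I J"
  shows "distr (lborel_product J) (lborel_product I) (\<lambda>x. \<lambda>i\<in>I. x (\<epsilon> i)) = lborel_product I"
proof -
  interpret product_sigma_finite "\<lambda>_::nat. lborel :: real measure"
    by (rule product_sigma_finite_lborel)
  have J: "finite J" using assms bij_betw_finite by blast
  have m: "(\<lambda>x. \<lambda>i\<in>I. x (\<epsilon> i)) \<in> lborel_product J \<rightarrow>\<^sub>M lborel_product I"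
    using assms(2) by (intro measurable_restrict measurable_component_singleton) (auto simp: bij_betw_def)
  show ?thesis
  proof (rule PiM_eqI)
    fix A :: "nat \<Rightarrow> real set" assume A: "\<And>i. i \<in> I \<Longrightarrow> A i \<in> sets lborel"
    define A' where "A' = (\<lambda>j. A (the_inv_into I \<epsilon> j))"
    have A'e: "A' (\<epsilon> i) = A i" if "i \<in> I" for i
      using that assms(2) by (simp add: A'_def bij_betw_def the_inv_into_f_f)
    have pre: "(\<lambda>x. \<lambda>i\<in>I. x (\<epsilon> i)) -` (Pi\<^sub>E I A) \<inter> space (lborel_product J) = Pi\<^sub>E J A'"
      using assms(2) A'e by (auto simp: space_PiM PiE_iff bij_betw_def)
    have "emeasure (distr (lborel_product J) (lborel_product I) (\<lambda>x. \<lambda>i\<in>I. x (\<epsilon> i))) (Pi\<^sub>E I A)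
        = emeasure (lborel_product J) (Pi\<^sub>E J A')"
      using assms A m by (subst emeasure_distr) (auto simp: pre intro!: sets_PiM_I_finite)
    also have "\<dots> = (\<Prod>j\<in>J. emeasure lborel (A' j))"
      using assms(2) J A A'e by (intro emeasure_PiM) (auto simp: bij_betw_def)
    also have "\<dots> = (\<Prod>i\<in>I. emeasure lborel (A i))"
      using assms(2) A'e by (subst prod.reindex_bij_betw[symmetric, OF assms(2)]) auto
    finally show "emeasure (distr (lborel_product J) (lborel_product I) (\<lambda>x. \<lambda>i\<in>I. x (\<epsilon> i))) (Pi\<^sub>E I A)
        = (\<Prod>i\<in>I. emeasure lborel (A i))" .
  qed (use assms in auto)
qed

lemma set_integral_corner_reindex:
  fixes f :: "(nat \<Rightarrow> real) \<Rightarrow> complex"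
  assumes "finite I" "bij_betw \<epsilon> I J"
    and f: "set_integrable (lborel_product I) (corner_simplex I) f"
  shows "(LINT x:corner_simplex I|lborel_product I. f x) =
    (LINT t:corner_simplex J|lborel_product J. f (\<lambda>i\<in>I. t (\<epsilon> i)))"
proof -
  have m: "(\<lambda>x. \<lambda>i\<in>I. x (\<epsilon> i)) \<in> lborel_product J \<rightarrow>\<^sub>M lborel_product I"
    using assms(2) by (intro measurable_restrict measurable_component_singleton) (auto simp: bij_betw_def)
  have iff: "(\<lambda>i\<in>I. t (\<epsilon> i)) \<in> corner_simplex I \<longleftrightarrow> t \<in> corner_simplex J" if "t \<in> J \<rightarrow>\<^sub>E UNIV" for t
  proof -
    have "(\<Sum>i\<in>I. t (\<epsilon> i)) = (\<Sum>j\<in>J. t j)"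
      by (rule sum.reindex_bij_betw) fact
    then show ?thesis
      using that assms(2) by (auto simp: corner_simplex_def bij_betw_def)
  qed
  have "(LINT x:corner_simplex I|lborel_product I. f x) =
     (LINT x|distr (lborel_product J) (lborel_product I) (\<lambda>x. \<lambda>i\<in>I. x (\<epsilon> i)). indicator (corner_simplex I) x *\<^sub>R f x)"
    unfolding lborel_product_reindex[OF assms(1,2)] set_lebesgue_integral_def ..
  also have "\<dots> = (LINT t|lborel_product J. indicator (corner_simplex I) (\<lambda>i\<in>I. t (\<epsilon> i)) *\<^sub>R f (\<lambda>i\<in>I. t (\<epsilon> i)))"
    using f by (intro integral_distr m) (auto simp: set_integrable_def)
  also have "\<dots> = (LINT t:corner_simplex J|lborel_product J. f (\<lambda>i\<in>I. t (\<epsilon> i)))"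
    unfolding set_lebesgue_integral_def
    by (intro Bochner_Integration.integral_cong refl) (auto simp: indicator_def iff space_PiM)
  finally show ?thesis .
qed

section \<open>Integrals of functions of the barycentric coordinates\<close>

definition simplex_integral :: "nat \<Rightarrow> ((nat \<Rightarrow> real) \<Rightarrow> complex) \<Rightarrow> complex" where
  "simplex_integral p k = (LINT s:open_simplex p|lborel_product {1..p}. k (barycentric p s))"

lemma simplex_integral_cong:
  assumes "\<And>s. s \<in> open_simplex p \<Longrightarrow> k (barycentric p s) = k' (barycentric p s)"
  shows "simplex_integral p k = simplex_integral p k'"
  unfolding simplex_integral_def
  using assms by (intro set_lebesgue_integral_cong) (auto simp: open_simplex_corner)

lemma simplex_integral_add:
  assumes "continuous_on (standard_simplex p) f" "continuous_on (standard_simplex p) g"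
  shows "simplex_integral p (\<lambda>s. f s + g s) = simplex_integral p f + simplex_integral p g"
  unfolding simplex_integral_def by (intro set_integral_add set_integrable_barycentric assms)

lemma simplex_integral_diff:
  assumes "continuous_on (standard_simplex p) f" "continuous_on (standard_simplex p) g"
  shows "simplex_integral p (\<lambda>s. f s - g s) = simplex_integral p f - simplex_integral p g"
  unfolding simplex_integral_def by (intro set_integral_diff set_integrable_barycentric assms)

lemma simplex_integral_cmult: "simplex_integral p (\<lambda>s. a * f s) = a * simplex_integral p f"
  unfolding simplex_integral_def by simp

lemma simplex_integral_0 [simp]: "simplex_integral p (\<lambda>s. 0) = 0"
  unfolding simplex_integral_def by simp

lemma simplex_integral_sum:
  assumes "\<And>i. i \<in> I \<Longrightarrow> continuous_on (standard_simplex p) (f i)"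
  shows "simplex_integral p (\<lambda>s. \<Sum>i\<in>I. f i s) = (\<Sum>i\<in>I. simplex_integral p (f i))"
  using assms
proof (induction I rule: infinite_finite_induct)
  case (insert i I)
  then show ?case
    by (simp add: simplex_integral_add continuous_on_sum)
qed auto

text \<open>Exchanging the barycentric coordinate \<open>0\<close> with the coordinate \<open>i\<close> is the reflection
  \<open>s i \<mapsto> (1 - (\<Sum>j \<noteq> i. s j)) - s i\<close>.\<close>

lemma simplex_integral_transpose:
  assumes k: "continuous_on (standard_simplex p) k" and i: "i \<in> {1..p}"
  shows "simplex_integral p (\<lambda>b. k (b \<circ> Transposition.transpose 0 i)) = simplex_integral p k"
proof -
  let ?I = "{1..p} - {i}"
  have I: "insert i ?I = {1..p}" "finite ?I" "i \<notin> ?I" using i by auto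
  have tr: "b \<circ> Transposition.transpose 0 i \<in> standard_simplex p" if "b \<in> standard_simplex p" for b
  proof (rule standard_simplexI)
    have "(\<Sum>j\<le>p. (b \<circ> Transposition.transpose 0 i) j) = (\<Sum>j\<le>p. b j)"
      unfolding o_def using i
      by (intro sum.reindex_bij_betw permutes_imp_bij permutes_swap_id) auto
    then show "(\<Sum>j\<le>p. (b \<circ> Transposition.transpose 0 i) j) = 1"
      using that by (simp add: standard_simplex_def)
  qed (use that i in \<open>auto simp: standard_simplex_def Transposition.transpose_def\<close>)
  have k': "continuous_on (standard_simplex p) (\<lambda>b. k (b \<circ> Transposition.transpose 0 i))"
    unfolding o_def
    by (rule continuous_on_compose2[OF k])
       (use tr in \<open>auto intro!: continuous_on_coordinatewise_then_product simp: o_def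
          intro: continuous_on_subset[OF continuous_on_product_coordinates]\<close>)
  have *: "barycentric p (x(i := y)) \<circ> Transposition.transpose 0 i =
      barycentric p (x(i := (1 - (\<Sum>j\<in>?I. x j)) - y))" for x y
  proof -
    have s: "(\<Sum>j=1..p. (x(i := y)) j) = y + (\<Sum>j\<in>?I. x j)" for y
    proof -
      have "(\<Sum>j=1..p. (x(i := y)) j) = y + (\<Sum>j\<in>?I. (x(i := y)) j)"
        using I by (subst I(1)[symmetric], subst sum.insert) auto
      also have "(\<Sum>j\<in>?I. (x(i := y)) j) = (\<Sum>j\<in>?I. x j)" by (intro sum.cong) auto
      finally show ?thesis .
    qed
    show ?thesis
      unfolding barycentric_def s using i
      by (intro ext) (auto simp: Transposition.transpose_def)
  qed
  have eq: "simplex_integral p k = (LINT x:corner_simplex ?I|lborel_product ?I.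
       LINT y:{0<..<1 - (\<Sum>j\<in>?I. x j)}|lborel. k (barycentric p (x(i := y))))"
    if k: "continuous_on (standard_simplex p) k" for k
    using set_integral_corner_insert[OF I(2,3), unfolded I(1)] set_integrable_barycentric[OF k]
    unfolding simplex_integral_def open_simplex_corner by blast
  show ?thesis
    unfolding eq[OF k] eq[OF k'] *
    by (subst set_integral_lborel_reflect[where f="\<lambda>y. k (barycentric p (_(i := y)))"]) (rule refl)
qed

text \<open>The derivative is required to exist on the open simplex only, and \<open>f'\<close> extends it continuously
  to the closed one.  Moving \<open>s i\<close> means moving the barycentric coordinate \<open>0\<close> oppositely.\<close>

definition simplex_deriv :: "nat \<Rightarrow> nat \<Rightarrow> ((nat \<Rightarrow> real) \<Rightarrow> complex) \<Rightarrow> ((nat \<Rightarrow> real) \<Rightarrow> complex) \<Rightarrow> bool" where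
  "simplex_deriv p i f f' \<longleftrightarrow>
     continuous_on (standard_simplex p) f \<and> continuous_on (standard_simplex p) f' \<and>
     (\<forall>s\<in>open_simplex p. ((\<lambda>h. f (barycentric p (s(i := h)))) has_vector_derivative
        f' (barycentric p s)) (at (s i)))"

lemma simplical_face_continuous: "continuous_on A (simplical_face k :: (nat \<Rightarrow> real) \<Rightarrow> nat \<Rightarrow> real)"
proof (rule continuous_on_coordinatewise_then_product)
  fix i
  show "continuous_on A (\<lambda>x::nat \<Rightarrow> real. simplical_face k x i)"
    unfolding simplical_face_def
    by (cases "i < k"; cases "i = k") (auto intro: continuous_on_subset[OF continuous_on_product_coordinates])
qed

lemma continuous_on_simplical_face:
  assumes "continuous_on (standard_simplex p) f" "1 \<le> p" "k \<le> p"
  shows "continuous_on (standard_simplex (p - 1)) (\<lambda>s. f (simplical_face k s))"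
  by (rule continuous_on_compose2[OF assms(1) simplical_face_continuous])
     (use simplical_face_in_standard_simplex[OF assms(2,3)] in auto)

text \<open>The face where coordinate \<open>0\<close> vanishes, as parametrised by solving for \<open>s i\<close>.\<close>

definition shuffle_face :: "nat \<Rightarrow> (nat \<Rightarrow> real) \<Rightarrow> nat \<Rightarrow> real" where
  "shuffle_face i b = (\<lambda>m. if m = 0 then 0 else if m < i then b m
     else if m = i then b 0 else b (m - 1))"

lemma shuffle_face_in_standard_simplex:
  assumes b: "b \<in> standard_simplex (p - 1)" and i: "i \<in> {1..p}"
  shows "shuffle_face i b \<in> standard_simplex p"
proof (rule standard_simplexI)
  show "0 \<le> shuffle_face i b m" for m
    using b by (auto simp: shuffle_face_def standard_simplex_def)
  show "shuffle_face i b m = 0" if "m > p" for m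
    using that b i by (auto simp: shuffle_face_def standard_simplex_def)
  have disj1: "{Suc 0..<i} \<inter> {Suc i..p} = {}" and disj2: "{Suc 0..<i} \<inter> {i..p - Suc 0} = {}"
    by auto
  have f0: "shuffle_face i b 0 = 0" "shuffle_face i b i = b 0" using i by (auto simp: shuffle_face_def)
  have "{..p} = insert 0 (insert i ({1..<i} \<union> {i+1..p}))" using i by auto
  then have "(\<Sum>m\<le>p. shuffle_face i b m) =
      b 0 + ((\<Sum>m\<in>{1..<i}. shuffle_face i b m) + (\<Sum>m\<in>{i+1..p}. shuffle_face i b m))"
    using i by (simp add: sum.union_disjoint[OF _ _ disj1] f0)
  also have "(\<Sum>m\<in>{1..<i}. shuffle_face i b m) = (\<Sum>m\<in>{1..<i}. b m)"
    by (intro sum.cong) (auto simp: shuffle_face_def)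
  also have "(\<Sum>m\<in>{i+1..p}. shuffle_face i b m) = (\<Sum>m\<in>{i..p-1}. b m)"
    by (rule sum.reindex_bij_witness[where i="\<lambda>m. m + 1" and j="\<lambda>m. m - 1"])
       (use i in \<open>auto simp: shuffle_face_def\<close>)
  also have "b 0 + ((\<Sum>m\<in>{1..<i}. b m) + (\<Sum>m\<in>{i..p-1}. b m)) = (\<Sum>m\<le>p-1. b m)"
  proof -
    have "{..p-1} = insert 0 ({1..<i} \<union> {i..p-1})" using i by auto
    then show ?thesis using i by (simp add: sum.union_disjoint[OF _ _ disj2])
  qed
  finally show "(\<Sum>m\<le>p. shuffle_face i b m) = 1" using b by (simp add: standard_simplex_def)
qed

lemma continuous_on_shuffle_face:
  assumes "continuous_on (standard_simplex p) k" "i \<in> {1..p}"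
  shows "continuous_on (standard_simplex (p - 1)) (\<lambda>b. k (shuffle_face i b))"
proof (rule continuous_on_compose2[OF assms(1)])
  show "continuous_on (standard_simplex (p - 1)) (shuffle_face i)"
  proof (rule continuous_on_coordinatewise_then_product)
    fix m show "continuous_on (standard_simplex (p - 1)) (\<lambda>b. shuffle_face i b m)"
      unfolding shuffle_face_def
      by (cases "m = 0"; cases "m < i"; cases "m = i")
         (auto intro: continuous_on_subset[OF continuous_on_product_coordinates])
  qed
qed (use shuffle_face_in_standard_simplex assms(2) in auto)

text \<open>\<open>shuffle_face 1\<close> is face 0, and \<open>shuffle_face (Suc i)\<close> is
  \<open>shuffle_face i\<close> after exchanging the barycentric coordinates 0 and \<open>i\<close>,
  which does not change the integral.\<close>

lemma simplex_integral_shuffle: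
  fixes k :: "(nat \<Rightarrow> real) \<Rightarrow> complex"
  assumes k: "continuous_on (standard_simplex p) k" and i: "i \<in> {1..p}"
  shows "simplex_integral (p - 1) (\<lambda>b. k (shuffle_face i b)) =
         simplex_integral (p - 1) (\<lambda>b. k (simplical_face 0 b))"
  using i
proof (induction i)
  case (Suc i)
  show ?case
  proof (cases "i = 0")
    case True
    have "shuffle_face 1 = simplical_face 0"
      by (auto simp: shuffle_face_def simplical_face_def fun_eq_iff)
    then show ?thesis using True by simp
  next
    case False
    then have i: "i \<in> {1..p}" "i \<in> {1..p-1}" using Suc.prems by auto
    have "shuffle_face (Suc i) b = shuffle_face i (b \<circ> Transposition.transpose 0 i)" for b
      using False by (auto simp: shuffle_face_def fun_eq_iff Transposition.transpose_def)
    then have "simplex_integral (p - 1) (\<lambda>b. k (shuffle_face (Suc i) b)) =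
      simplex_integral (p - 1) (\<lambda>b. (\<lambda>b. k (shuffle_face i b)) (b \<circ> Transposition.transpose 0 i))"
      by simp
    also have "\<dots> = simplex_integral (p - 1) (\<lambda>b. k (shuffle_face i b))"
      by (intro simplex_integral_transpose continuous_on_shuffle_face k i)
    finally show ?thesis using Suc.IH[OF i(1)] by simp
  qed
qed simp

text \<open>Fubini with coordinate \<open>i\<close> innermost and the fundamental theorem of
  calculus on each fibre. The fibre starts on face \<open>i\<close> and ends where the barycentric
  coordinate 0 vanishes; that end gives \<open>shuffle_face i\<close>, which
  \<open>simplex_integral_shuffle\<close> exchanges for face 0.\<close>

theorem simplex_integral_deriv:
  assumes h: "simplex_deriv p i h h'" and i: "i \<in> {1..p}"
  shows "simplex_integral p h' = simplex_integral (p - 1) (\<lambda>s. h (simplical_face 0 s))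
           - simplex_integral (p - 1) (\<lambda>s. h (simplical_face i s))"
proof -
  let ?I = "{1..p} - {i}"
  have I: "insert i ?I = {1..p}" "finite ?I" "i \<notin> ?I" using i by auto
  have hc: "continuous_on (standard_simplex p) h" and h'c: "continuous_on (standard_simplex p) h'"
    and hd: "\<And>s. s \<in> open_simplex p \<Longrightarrow> ((\<lambda>z. h (barycentric p (s(i := z)))) has_vector_derivative
        h' (barycentric p s)) (at (s i))"
    using h by (auto simp: simplex_deriv_def)
  \<comment> \<open>\<open>r x\<close> is the length of the fibre over \<open>x\<close>, and
    \<open>\<epsilon>\<close> closes the gap left by the index \<open>i\<close>, identifying the
    base with a simplex of dimension \<open>p - 1\<close>.\<close>
  define r where "r x = 1 - (\<Sum>j\<in>?I. x j)" for x :: "nat \<Rightarrow> real"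
  define \<epsilon> where "\<epsilon> j = (if j < i then j else j - 1)" for j :: nat
  have \<epsilon>: "bij_betw \<epsilon> ?I {1..p-1}"
    by (rule bij_betw_byWitness[where f'="\<lambda>j. if j < i then j else j + 1"]) (use i in \<open>auto simp: \<epsilon>_def\<close>)
  have sum_upd: "(\<Sum>j=1..p. (x(i := y)) j) = y + (\<Sum>j\<in>?I. x j)" for x :: "nat \<Rightarrow> real" and y
  proof -
    have "(\<Sum>j=1..p. (x(i := y)) j) = y + (\<Sum>j\<in>?I. (x(i := y)) j)"
      using I by (subst I(1)[symmetric], subst sum.insert) auto
    also have "(\<Sum>j\<in>?I. (x(i := y)) j) = (\<Sum>j\<in>?I. x j)" by (intro sum.cong) auto
    finally show ?thesis .
  qed
  have in_simplex: "barycentric p (x(i := y)) \<in> standard_simplex p"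
    if "x \<in> corner_simplex ?I" "y \<in> {0..r x}" for x y
    using that by (intro barycentric_in_standard_simplex, unfold sum_upd)
      (auto simp: corner_simplex_def r_def less_imp_le)
  have bary_cont: "continuous_on A (\<lambda>y. barycentric p (x(i := y)))" for A x
  proof (rule continuous_on_coordinatewise_then_product)
    fix m show "continuous_on A (\<lambda>y. barycentric p (x(i := y)) m)"
      unfolding barycentric_def sum_upd
      by (cases "m = 0"; cases "m \<le> p"; cases "m = i") (auto intro!: continuous_intros)
  qed
  have "simplex_integral p h' = (LINT x:corner_simplex ?I|lborel_product ?I.
       LINT y:{0<..<r x}|lborel. h' (barycentric p (x(i := y))))"
    using set_integral_corner_insert[OF I(2,3), unfolded I(1)] set_integrable_barycentric[OF h'c]
    unfolding simplex_integral_def open_simplex_corner r_def by blast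
  also have "\<dots> = (LINT x:corner_simplex ?I|lborel_product ?I.
       h (barycentric p (x(i := r x))) - h (barycentric p (x(i := 0))))"
  proof (rule set_lebesgue_integral_cong)
    show "\<forall>x. x \<in> corner_simplex ?I \<longrightarrow> (LINT y:{0<..<r x}|lborel. h' (barycentric p (x(i := y)))) =
       h (barycentric p (x(i := r x))) - h (barycentric p (x(i := 0)))"
    proof (intro allI impI interval_FTC_interior)
      fix x assume x: "x \<in> corner_simplex ?I"
      then show "0 \<le> r x" by (simp add: corner_simplex_def r_def)
      show "continuous_on {0..r x} (\<lambda>y. h (barycentric p (x(i := y))))"
        by (rule continuous_on_compose2[OF hc bary_cont]) (use in_simplex[OF x] in auto)
      show "continuous_on {0..r x} (\<lambda>y. h' (barycentric p (x(i := y))))"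
        by (rule continuous_on_compose2[OF h'c bary_cont]) (use in_simplex[OF x] in auto)
      fix y assume y: "y \<in> {0<..<r x}"
      have "x(i := y) \<in> open_simplex p"
        using corner_simplex_upd[OF I(2,3), of x y, unfolded I(1)] x y
        by (simp add: open_simplex_corner corner_simplex_def r_def)
      from hd[OF this] show "((\<lambda>y. h (barycentric p (x(i := y)))) has_vector_derivative
          h' (barycentric p (x(i := y)))) (at y)"
        by simp
    qed
  qed (use I in auto)
  also have "\<dots> = (LINT t:corner_simplex {1..p-1}|lborel_product {1..p-1}.
       h (barycentric p ((\<lambda>j\<in>?I. t (\<epsilon> j))(i := r (\<lambda>j\<in>?I. t (\<epsilon> j))))) -
       h (barycentric p ((\<lambda>j\<in>?I. t (\<epsilon> j))(i := 0))))"
  proof (rule set_integral_corner_reindex[OF I(2) \<epsilon>])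
    show "set_integrable (lborel_product ?I) (corner_simplex ?I)
      (\<lambda>x. h (barycentric p (x(i := r x))) - h (barycentric p (x(i := 0))))"
    proof -
      have comp [measurable]: "(\<lambda>x. x j) \<in> borel_measurable (lborel_product ?I)" if "j \<in> ?I" for j
        using measurable_component_singleton[OF that, of "\<lambda>_. lborel"] by simp
      have rm [measurable]: "r \<in> borel_measurable (lborel_product ?I)"
        unfolding r_def by measurable
      \<comment> \<open>The general height \<open>q\<close> covers both ends of the fibre:
        \<open>r\<close> for face 0 and the constant 0 for face \<open>i\<close>.\<close>
      have int: "set_integrable (lborel_product ?I) (corner_simplex ?I) (\<lambda>x. h (barycentric p (x(i := q x))))"
        if q: "q \<in> borel_measurable (lborel_product ?I)" "\<And>x. x \<in> corner_simplex ?I \<Longrightarrow> q x \<in> {0..r x}" for q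
      proof (rule set_integrable_corner_compose[OF hc I(2)])
        show "(\<lambda>x. barycentric p (x(i := q x))) \<in> borel_measurable (lborel_product ?I)"
        proof (rule measurable_coordinatewise_then_product)
          fix m show "(\<lambda>x. barycentric p (x(i := q x)) m) \<in> borel_measurable (lborel_product ?I)"
            unfolding barycentric_def sum_upd using q(1) comp[of m] i
            by (cases "m = 0"; cases "m \<le> p"; cases "m = i")
               (auto simp del: One_nat_def intro!: borel_measurable_diff borel_measurable_add borel_measurable_sum comp)
        qed
      qed (use in_simplex q(2) in blast)
      have "0 \<le> r x" if "x \<in> corner_simplex ?I" for x
        using that by (simp add: corner_simplex_def r_def)
      then show ?thesis
        by (intro set_integral_diff int rm) auto
    qed
  qed
  also have "\<dots> = simplex_integral (p - 1) (\<lambda>b. h (shuffle_face i b) - h (simplical_face i b))"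
    unfolding simplex_integral_def open_simplex_corner[symmetric]
  proof (rule set_lebesgue_integral_cong)
    show "\<forall>t. t \<in> open_simplex (p - 1) \<longrightarrow>
       h (barycentric p ((\<lambda>j\<in>?I. t (\<epsilon> j))(i := r (\<lambda>j\<in>?I. t (\<epsilon> j))))) -
       h (barycentric p ((\<lambda>j\<in>?I. t (\<epsilon> j))(i := 0))) =
       h (shuffle_face i (barycentric (p - 1) t)) -
       h (simplical_face i (barycentric (p - 1) t))"
    proof (intro allI impI)
      fix t :: "nat \<Rightarrow> real"
      have s: "(\<Sum>j\<in>?I. (\<lambda>j\<in>?I. t (\<epsilon> j)) j) = (\<Sum>j=1..p-1. t j)"
        using sum.reindex_bij_betw[OF \<epsilon>, of t] by simp
      \<comment> \<open>After renaming, \<open>r\<close> becomes 1 minus the sum of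
        \<open>t\<close>, which is the barycentric coordinate 0 of the smaller simplex; so that
        coordinate lands in place \<open>i\<close>.\<close>
      have 1: "barycentric p ((\<lambda>j\<in>?I. t (\<epsilon> j))(i := r (\<lambda>j\<in>?I. t (\<epsilon> j)))) =
         (shuffle_face i (barycentric (p - 1) t))"
        unfolding barycentric_def sum_upd s r_def shuffle_face_def using i
        by (intro ext) (auto simp: \<epsilon>_def)
      have 2: "barycentric p ((\<lambda>j\<in>?I. t (\<epsilon> j))(i := 0)) = simplical_face i (barycentric (p - 1) t)"
        unfolding barycentric_def sum_upd s simplical_face_def using i
        by (intro ext) (auto simp: \<epsilon>_def)
      show "h (barycentric p ((\<lambda>j\<in>?I. t (\<epsilon> j))(i := r (\<lambda>j\<in>?I. t (\<epsilon> j))))) -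
       h (barycentric p ((\<lambda>j\<in>?I. t (\<epsilon> j))(i := 0))) =
       h (shuffle_face i (barycentric (p - 1) t)) -
       h (simplical_face i (barycentric (p - 1) t))"
        unfolding 1 2 ..
    qed
  qed (simp add: open_simplex_corner)
  also have "\<dots> = simplex_integral (p - 1) (\<lambda>b. h (shuffle_face i b)) - simplex_integral (p - 1) (\<lambda>b. h (simplical_face i b))"
    by (intro simplex_integral_diff continuous_on_shuffle_face continuous_on_simplical_face hc i)
       (use i in auto)
  also have "simplex_integral (p - 1) (\<lambda>b. h (shuffle_face i b)) = simplex_integral (p - 1) (\<lambda>s. h (simplical_face 0 s))"
    by (rule simplex_integral_shuffle[OF hc i])
  finally show ?thesis .
qed

subsection \<open>Leibniz determinants\<close>

text \<open>Indexed by natural numbers, so that minors of order \<open>n - 1\<close> have the same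
  type as the matrix; the formula is that of \<open>simplex_jacobian\<close>. Rows are directions of
  differentiation, columns are the differentiated functions.\<close>

definition leibniz_det :: "nat \<Rightarrow> (nat \<Rightarrow> nat \<Rightarrow> complex) \<Rightarrow> complex" where
  "leibniz_det n A = (\<Sum>\<pi> | \<pi> permutes {1..n}. of_int (sign \<pi>) * (\<Prod>i=1..n. A i (\<pi> i)))"

lemma leibniz_det_cong:
  assumes "\<And>i j. i \<in> {1..n} \<Longrightarrow> j \<in> {1..n} \<Longrightarrow> A i j = B i j"
  shows "leibniz_det n A = leibniz_det n B"
  unfolding leibniz_det_def
proof (intro sum.cong refl arg_cong2[of _ _ _ _ "(*)"] prod.cong)
  fix \<pi> i assume "\<pi> \<in> {\<pi>. \<pi> permutes {1..n}}" "i \<in> {1..n}"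
  then show "A i (\<pi> i) = B i (\<pi> i)"
    by (intro assms) (use permutes_in_image[of \<pi> "{1..n}" i] in auto)
qed

lemma leibniz_det_permute_columns:
  assumes "\<rho> permutes {1..n}"
  shows "leibniz_det n (\<lambda>i j. A i (\<rho> j)) = of_int (sign \<rho>) * leibniz_det n A"
proof -
  have "leibniz_det n A = (\<Sum>\<pi> | \<pi> permutes {1..n}. of_int (sign (\<rho> \<circ> \<pi>)) * (\<Prod>i=1..n. A i ((\<rho> \<circ> \<pi>) i)))"
    unfolding leibniz_det_def
    by (rule sum.reindex_bij_witness[where i="\<lambda>\<pi>. \<rho> \<circ> \<pi>" and j="\<lambda>\<pi>. inv_into UNIV \<rho> \<circ> \<pi>"])
       (use assms in \<open>auto simp: permutes_compose permutes_inv o_assoc permutes_inv_o\<close>)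
  also have "\<dots> = (\<Sum>\<pi> | \<pi> permutes {1..n}. of_int (sign \<rho>) * (of_int (sign \<pi>) * (\<Prod>i=1..n. A i (\<rho> (\<pi> i)))))"
    by (intro sum.cong refl)
       (use assms in \<open>auto simp: sign_compose permutes_imp_permutation[of "{1..n}"]\<close>)
  also have "\<dots> = of_int (sign \<rho>) * leibniz_det n (\<lambda>i j. A i (\<rho> j))"
    by (simp add: leibniz_det_def sum_distrib_left)
  finally have "of_int (sign \<rho>) * leibniz_det n A =
      (of_int (sign \<rho>) * of_int (sign \<rho>)) * leibniz_det n (\<lambda>i j. A i (\<rho> j))"
    by simp
  also have "of_int (sign \<rho>) * of_int (sign \<rho>) = (1 :: complex)"
    by (simp add: sign_def)
  finally show ?thesis by simp
qed

lemma leibniz_det_permute_rows: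
  assumes "\<rho> permutes {1..n}"
  shows "leibniz_det n (\<lambda>i j. A (\<rho> i) j) = of_int (sign \<rho>) * leibniz_det n A"
proof -
  have "leibniz_det n (\<lambda>i j. A (\<rho> i) j) =
      (\<Sum>\<pi> | \<pi> permutes {1..n}. of_int (sign (\<pi> \<circ> \<rho>)) * (\<Prod>i=1..n. A (\<rho> i) ((\<pi> \<circ> \<rho>) i)))"
    unfolding leibniz_det_def
    by (rule sum_permutations_compose_right[OF assms])
  also have "\<dots> = (\<Sum>\<pi> | \<pi> permutes {1..n}. of_int (sign \<rho>) * (of_int (sign \<pi>) * (\<Prod>i=1..n. A i (\<pi> i))))"
  proof (intro sum.cong refl)
    fix \<pi> assume \<pi>: "\<pi> \<in> {\<pi>. \<pi> permutes {1..n}}"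
    have "(\<Prod>i=1..n. A (\<rho> i) ((\<pi> \<circ> \<rho>) i)) = (\<Prod>i=1..n. A i (\<pi> i))"
      unfolding o_def
      by (rule prod.reindex_bij_betw[OF permutes_imp_bij[OF assms], of "\<lambda>i. A i (\<pi> i)"])
    moreover have "sign (\<pi> \<circ> \<rho>) = sign \<pi> * sign \<rho>"
      using \<pi> assms by (intro sign_compose) (auto intro: permutes_imp_permutation[of "{1..n}"])
    ultimately show "of_int (sign (\<pi> \<circ> \<rho>)) * (\<Prod>i=1..n. A (\<rho> i) ((\<pi> \<circ> \<rho>) i)) =
      of_int (sign \<rho>) * (of_int (sign \<pi>) * (\<Prod>i=1..n. A i (\<pi> i)))"
      by simp
  qed
  finally show ?thesis by (simp add: leibniz_det_def sum_distrib_left)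
qed

lemma leibniz_det_equal_columns:
  assumes "k \<in> {1..n}" "l \<in> {1..n}" "k \<noteq> l" "\<And>i. i \<in> {1..n} \<Longrightarrow> A i k = A i l"
  shows "leibniz_det n A = 0"
proof -
  have "leibniz_det n A = leibniz_det n (\<lambda>i j. A i (Transposition.transpose k l j))"
    using assms by (intro leibniz_det_cong) (auto simp: Transposition.transpose_def)
  also have "\<dots> = - leibniz_det n A"
    using assms(1-3) by (subst leibniz_det_permute_columns) (auto intro: permutes_swap_id simp: sign_swap_id)
  finally show ?thesis by simp
qed

lemma leibniz_det_equal_rows:
  assumes "k \<in> {1..n}" "l \<in> {1..n}" "k \<noteq> l" "\<And>j. j \<in> {1..n} \<Longrightarrow> A k j = A l j"
  shows "leibniz_det n A = 0"
proof -
  have "leibniz_det n A = leibniz_det n (\<lambda>i j. A (Transposition.transpose k l i) j)"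
    using assms by (intro leibniz_det_cong) (auto simp: Transposition.transpose_def)
  also have "\<dots> = - leibniz_det n A"
    using assms(1-3) by (subst leibniz_det_permute_rows) (auto intro: permutes_swap_id simp: sign_swap_id)
  finally show ?thesis by simp
qed

lemma leibniz_det_row_diff:
  assumes "k \<in> {1..n}"
  shows "leibniz_det n (A(k := \<lambda>j. u j - v j)) = leibniz_det n (A(k := u)) - leibniz_det n (A(k := v))"
  unfolding leibniz_det_def sum_subtractf[symmetric]
proof (intro sum.cong refl)
  fix \<pi>
  have *: "(\<Prod>i=1..n. (A(k := w)) i (\<pi> i)) = w (\<pi> k) * (\<Prod>i\<in>{1..n}-{k}. A i (\<pi> i))" for w
    using assms by (subst prod.remove[of _ k]) (auto intro!: prod.cong)
  show "of_int (sign \<pi>) * (\<Prod>i=1..n. (A(k := \<lambda>j. u j - v j)) i (\<pi> i)) =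
      of_int (sign \<pi>) * (\<Prod>i=1..n. (A(k := u)) i (\<pi> i)) - of_int (sign \<pi>) * (\<Prod>i=1..n. (A(k := v)) i (\<pi> i))"
    unfolding * by (simp add: algebra_simps)
qed

text \<open>The rows are changed one at a time. By linearity each change costs a determinant in
  which row 1 occurs twice, which is 0.\<close>

lemma leibniz_det_sub_first_row:
  assumes "finite S" "S \<subseteq> {2..n}"
  shows "leibniz_det n (\<lambda>i j. if i \<in> S then A i j - A 1 j else A i j) = leibniz_det n A"
  using assms
proof (induction S)
  case (insert k S)
  define B where "B = (\<lambda>i j. if i \<in> S then A i j - A 1 j else A i j)"
  have k: "k \<in> {1..n}" "1 \<in> {1..n}" "k \<noteq> 1" "1 \<notin> S" using insert by auto
  have "(\<lambda>i j. if i \<in> insert k S then A i j - A 1 j else A i j) = B(k := \<lambda>j. A k j - A 1 j)"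
    by (auto simp: B_def fun_eq_iff)
  then have "leibniz_det n (\<lambda>i j. if i \<in> insert k S then A i j - A 1 j else A i j) =
      leibniz_det n (B(k := A k)) - leibniz_det n (B(k := A 1))"
    by (simp only: leibniz_det_row_diff[OF k(1)])
  also have "leibniz_det n (B(k := A 1)) = 0"
    using k by (intro leibniz_det_equal_rows[of k _ 1]) (auto simp: B_def)
  also have "B(k := A k) = B" using insert by (auto simp: B_def fun_eq_iff)
  also have "leibniz_det n B = leibniz_det n A" using insert unfolding B_def by auto
  finally show ?case by simp
qed simp

section \<open>Cofactors of the first column\<close>

definition first_cycle :: "nat \<Rightarrow> nat \<Rightarrow> nat" where
  "first_cycle i l = (if l = 1 then i else if 2 \<le> l \<and> l \<le> i then l - 1 else l)"

text \<open>The reordering i, 1, ..., i-1, i+1, ... arises from the one for i-1 by a single adjacent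
  transposition, hence the sign. It accounts both for the sign of a cofactor and for moving dt_r to
  the front of dt_1 ... dt_p.\<close>

lemma first_cycle:
  assumes "1 \<le> i"
  shows "first_cycle i permutes {1..i} \<and> sign (first_cycle i) = (-1) ^ (i - 1)"
  using assms
proof (induction i rule: nat_induct_at_least)
  case base
  have "first_cycle 1 = id" by (auto simp: first_cycle_def fun_eq_iff)
  then show ?case using permutes_id by (simp add: id_def[symmetric])
next
  case (Suc i)
  have eq: "first_cycle (Suc i) = Transposition.transpose i (Suc i) \<circ> first_cycle i"
    using Suc.hyps by (auto simp: first_cycle_def fun_eq_iff Transposition.transpose_def)
  have p: "first_cycle i permutes {1..Suc i}"
    using Suc.IH by (auto intro: permutes_subset)
  have t: "Transposition.transpose i (Suc i) permutes {1..Suc i}"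
    using Suc.hyps by (intro permutes_swap_id) auto
  have "sign (first_cycle (Suc i)) = - sign (first_cycle i)"
    unfolding eq using p t
    by (subst sign_compose) (auto intro: permutes_imp_permutation[of "{1..Suc i}"] simp: sign_swap_id)
  moreover have "(-1 :: int) ^ (Suc i - 1) = - ((-1) ^ (i - 1))"
    using Suc.hyps by (cases i) auto
  ultimately show ?case using Suc.IH permutes_compose[OF p t] by (simp only: eq)
qed

text \<open>Enumerates the indices other than \<open>i\<close>. The same map tells where coordinate
  \<open>l\<close> goes under \<open>simplical_face i\<close>, so deleting a row of a Jacobian and
  passing to a face use one renumbering.\<close>

definition skip :: "nat \<Rightarrow> nat \<Rightarrow> nat" where
  "skip i l = (if l < i then l else Suc l)"

lemma bij_betw_skip:
  assumes "i \<in> {1..n}"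
  shows "bij_betw (skip i) {1..n-1} ({1..n} - {i})"
  by (rule bij_betw_byWitness[where f'="\<lambda>j. if j < i then j else j - 1"]) (use assms in \<open>auto simp: skip_def\<close>)

lemma first_cycle_skip: "first_cycle i (Suc l) = skip i l" if "1 \<le> l" "1 \<le> i"
  using that by (auto simp: first_cycle_def skip_def)

text \<open>The cofactor of entry \<open>(i, 1)\<close>. Column 1 is singled out because in Stokes'
  theorem it holds the derivatives of the coefficient, and the other columns those of the coordinate
  functions.\<close>

definition cofactor :: "nat \<Rightarrow> nat \<Rightarrow> (nat \<Rightarrow> nat \<Rightarrow> complex) \<Rightarrow> complex" where
  "cofactor n i A = (-1) ^ (i - 1) * leibniz_det (n - 1) (\<lambda>l j. A (skip i l) (Suc j))"

text \<open>A permutation of \<open>{1..n-1}\<close>, shifted by \<open>Suc\<close> so as to fix 1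
  and precomposed with the inverse of \<open>first_cycle i\<close>, is a general permutation of
  \<open>{1..n}\<close> sending \<open>i\<close> to 1; the sign of the cycle is the sign of the
  cofactor. The Leibniz form is the one to be differentiated term by term.\<close>

lemma cofactor_leibniz:
  assumes i: "i \<in> {1..n}"
  shows "cofactor n i A =
    (\<Sum>\<pi> | \<pi> permutes {1..n} \<and> \<pi> i = 1. of_int (sign \<pi>) * (\<Prod>l\<in>{1..n}-{i}. A l (\<pi> l)))"
proof -
  define c where "c = first_cycle i"
  have c: "c permutes {1..n}" "sign c = (-1) ^ (i - 1)"
    using first_cycle[of i] i unfolding c_def by (auto intro: permutes_subset)
  have ci: "c 1 = i" by (simp add: c_def first_cycle_def)
  define ext where "ext \<rho> = map_permutation {1..n-1} Suc \<rho>" for \<rho>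
  have Suc_bij: "bij_betw Suc {1..n-1} {2..n}"
    by (rule bij_betw_byWitness[where f'="\<lambda>j. j - 1"]) auto
  have ext_p: "ext \<rho> permutes {2..n}" if "\<rho> permutes {1..n-1}" for \<rho>
    unfolding ext_def by (rule map_permutation_permutes[OF Suc_bij that])
  have ext_p1: "ext \<rho> permutes {1..n}" if "\<rho> permutes {1..n-1}" for \<rho>
    using permutes_subset[OF ext_p[OF that]] by auto
  have ext_app: "ext \<rho> (Suc l) = Suc (\<rho> l)" if "l \<in> {1..n-1}" for \<rho> l
    unfolding ext_def by (rule map_permutation_apply) (use that in auto)
  have ext1: "ext \<rho> 1 = 1" if "\<rho> permutes {1..n-1}" for \<rho>
    using permutes_not_in[OF ext_p[OF that], of 1] by simp
  have sign_ext: "sign (ext \<rho>) = sign \<rho>" if "\<rho> permutes {1..n-1}" for \<rho>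
    unfolding ext_def by (rule sign_map_permutation) (use that in auto)
  have inv_c: "inv_into UNIV c permutes {1..n}" by (rule permutes_inv[OF c(1)])
  have bij: "bij_betw (\<lambda>\<rho>. ext \<rho> \<circ> inv_into UNIV c) {\<rho>. \<rho> permutes {1..n-1}} {\<pi>. \<pi> permutes {1..n} \<and> \<pi> i = 1}"
  proof (rule bij_betw_byWitness[where f'="\<lambda>\<pi>. map_permutation {2..n} (\<lambda>j. j - 1) (\<pi> \<circ> c)"])
    show "\<forall>\<rho>\<in>{\<rho>. \<rho> permutes {1..n-1}}. map_permutation {2..n} (\<lambda>j. j - 1) (ext \<rho> \<circ> inv_into UNIV c \<circ> c) = \<rho>"
    proof
      fix \<rho> assume "\<rho> \<in> {\<rho>. \<rho> permutes {1..n-1}}"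
      moreover have "ext \<rho> \<circ> inv_into UNIV c \<circ> c = ext \<rho>"
        using permutes_inv_o(2)[OF c(1)] by (simp add: o_assoc[symmetric])
      ultimately show "map_permutation {2..n} (\<lambda>j. j - 1) (ext \<rho> \<circ> inv_into UNIV c \<circ> c) = \<rho>"
        unfolding ext_def using map_permutation_compose_inv[OF Suc_bij, of \<rho> "\<lambda>j. j - 1"] by simp
    qed
    \<comment> \<open>\<open>c\<close> sends 1 to \<open>i\<close>, so the condition
      \<open>\<pi> i = 1\<close> says that the composition fixes 1.\<close>
    have pc: "\<pi> \<circ> c permutes {2..n}" if "\<pi> permutes {1..n}" "\<pi> i = 1" for \<pi>
    proof -
      have "\<pi> \<circ> c permutes {1..n}" by (rule permutes_compose[OF c(1) that(1)])
      then show ?thesis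
      proof (rule permutes_superset)
        fix l assume "l \<in> {1..n} - {2..n}"
        then have "l = 1" by auto
        then show "(\<pi> \<circ> c) l = l" using that ci by simp
      qed
    qed
    have pred_bij: "bij_betw (\<lambda>j. j - 1) {2..n} {1..n-1}"
      by (rule bij_betw_byWitness[where f'=Suc]) auto
    show "\<forall>\<pi>\<in>{\<pi>. \<pi> permutes {1..n} \<and> \<pi> i = 1}. ext (map_permutation {2..n} (\<lambda>j. j - 1) (\<pi> \<circ> c)) \<circ> inv_into UNIV c = \<pi>"
    proof
      fix \<pi> assume \<pi>: "\<pi> \<in> {\<pi>. \<pi> permutes {1..n} \<and> \<pi> i = 1}"
      then have "ext (map_permutation {2..n} (\<lambda>j. j - 1) (\<pi> \<circ> c)) = \<pi> \<circ> c"
        unfolding ext_def using pc[of \<pi>]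
        by (intro map_permutation_compose_inv[OF pred_bij]) auto
      then show "ext (map_permutation {2..n} (\<lambda>j. j - 1) (\<pi> \<circ> c)) \<circ> inv_into UNIV c = \<pi>"
        using permutes_inv_o(1)[OF c(1)] by (simp add: o_assoc[symmetric])
    qed
    show "(\<lambda>\<rho>. ext \<rho> \<circ> inv_into UNIV c) ` {\<rho>. \<rho> permutes {1..n-1}} \<subseteq> {\<pi>. \<pi> permutes {1..n} \<and> \<pi> i = 1}"
    proof clarify
      fix \<rho> assume \<rho>: "\<rho> permutes {1..n-1}"
      have "inv_into UNIV c i = 1" using permutes_inverses(2)[OF c(1), of 1] ci by simp
      then show "ext \<rho> \<circ> inv_into UNIV c permutes {1..n} \<and> (ext \<rho> \<circ> inv_into UNIV c) i = 1"
        using permutes_compose[OF inv_c ext_p1[OF \<rho>]] ext1[OF \<rho>] by simp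
    qed
    show "(\<lambda>\<pi>. map_permutation {2..n} (\<lambda>j. j - 1) (\<pi> \<circ> c)) ` {\<pi>. \<pi> permutes {1..n} \<and> \<pi> i = 1}
        \<subseteq> {\<rho>. \<rho> permutes {1..n-1}}"
      using map_permutation_permutes[OF pred_bij pc] by auto
  qed
  have "(\<Sum>\<pi> | \<pi> permutes {1..n} \<and> \<pi> i = 1. of_int (sign \<pi>) * (\<Prod>l\<in>{1..n}-{i}. A l (\<pi> l))) =
    (\<Sum>\<rho> | \<rho> permutes {1..n-1}. of_int (sign (ext \<rho> \<circ> inv_into UNIV c)) * (\<Prod>l\<in>{1..n}-{i}. A l ((ext \<rho> \<circ> inv_into UNIV c) l)))"
    by (rule sum.reindex_bij_betw[OF bij, symmetric])
  also have "\<dots> = (\<Sum>\<rho> | \<rho> permutes {1..n-1}. (-1) ^ (i - 1) *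
      (of_int (sign \<rho>) * (\<Prod>l=1..n-1. A (skip i l) (Suc (\<rho> l)))))"
  proof (intro sum.cong refl)
    fix \<rho> assume "\<rho> \<in> {\<rho>. \<rho> permutes {1..n-1}}"
    then have \<rho>: "\<rho> permutes {1..n-1}" by simp
    have "sign (ext \<rho> \<circ> inv_into UNIV c) = sign (ext \<rho>) * sign (inv_into UNIV c)"
      using ext_p1[OF \<rho>] inv_c by (intro sign_compose) (auto intro: permutes_imp_permutation[of "{1..n}"])
    also have "sign (inv_into UNIV c) = sign c"
      using c(1) by (intro sign_inverse) (auto intro: permutes_imp_permutation[of "{1..n}"])
    finally have s: "sign (ext \<rho> \<circ> inv_into UNIV c) = sign \<rho> * (-1) ^ (i - 1)"
      by (simp only: sign_ext[OF \<rho>] c(2))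
    have "(\<Prod>l\<in>{1..n}-{i}. A l ((ext \<rho> \<circ> inv_into UNIV c) l)) = (\<Prod>l=1..n-1. A (skip i l) ((ext \<rho> \<circ> inv_into UNIV c) (skip i l)))"
      by (rule prod.reindex_bij_betw[OF bij_betw_skip[OF i], symmetric])
    also have "\<dots> = (\<Prod>l=1..n-1. A (skip i l) (Suc (\<rho> l)))"
    proof (intro prod.cong refl)
      fix l assume l: "l \<in> {1..n-1}"
      have "skip i l = c (Suc l)" using first_cycle_skip[of l i] l i by (simp add: c_def)
      then have "inv_into UNIV c (skip i l) = Suc l" using permutes_inverses(2)[OF c(1)] by simp
      then show "A (skip i l) ((ext \<rho> \<circ> inv_into UNIV c) (skip i l)) = A (skip i l) (Suc (\<rho> l))"
        using ext_app[OF l] by simp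
    qed
    finally show "of_int (sign (ext \<rho> \<circ> inv_into UNIV c)) * (\<Prod>l\<in>{1..n}-{i}. A l ((ext \<rho> \<circ> inv_into UNIV c) l)) =
      (-1) ^ (i - 1) * (of_int (sign \<rho>) * (\<Prod>l=1..n-1. A (skip i l) (Suc (\<rho> l))))"
      by (simp only: s) simp
  qed
  also have "\<dots> = cofactor n i A"
    by (simp add: cofactor_def leibniz_det_def sum_distrib_left)
  finally show ?thesis ..
qed

text \<open>Permutations are grouped by the row in which they pick the entry of column 1.\<close>

lemma leibniz_det_expand_leibniz:
  assumes "1 \<le> n"
  shows "leibniz_det n A = (\<Sum>i=1..n. A i 1 *
    (\<Sum>\<pi> | \<pi> permutes {1..n} \<and> \<pi> i = 1. of_int (sign \<pi>) * (\<Prod>l\<in>{1..n}-{i}. A l (\<pi> l))))"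
proof -
  have fin: "finite {\<pi>. \<pi> permutes {1..n}}" by (rule finite_permutations) simp
  have "leibniz_det n A = (\<Sum>i=1..n. \<Sum>\<pi> | \<pi> permutes {1..n} \<and> inv_into UNIV \<pi> 1 = i. of_int (sign \<pi>) * (\<Prod>i=1..n. A i (\<pi> i)))"
    unfolding leibniz_det_def
  proof (subst sum.group[symmetric, where g="\<lambda>\<pi>. inv_into UNIV \<pi> 1" and T="{1..n}"])
    show "(\<lambda>\<pi>. inv_into UNIV \<pi> 1) ` {\<pi>. \<pi> permutes {1..n}} \<subseteq> {1..n}"
      using assms permutes_in_image[OF permutes_inv, of _ "{1..n}" 1] by force
  qed (use fin in auto)
  also have "\<dots> = (\<Sum>i=1..n. A i 1 * (\<Sum>\<pi> | \<pi> permutes {1..n} \<and> \<pi> i = 1.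
      of_int (sign \<pi>) * (\<Prod>l\<in>{1..n}-{i}. A l (\<pi> l))))"
  proof (intro sum.cong refl)
    fix i assume i: "i \<in> {1..n}"
    have "{\<pi>. \<pi> permutes {1..n} \<and> inv_into UNIV \<pi> 1 = i} = {\<pi>. \<pi> permutes {1..n} \<and> \<pi> i = 1}"
      using permutes_inverses by metis
    then have "(\<Sum>\<pi> | \<pi> permutes {1..n} \<and> inv_into UNIV \<pi> 1 = i. of_int (sign \<pi>) * (\<Prod>i=1..n. A i (\<pi> i))) =
       (\<Sum>\<pi> | \<pi> permutes {1..n} \<and> \<pi> i = 1. of_int (sign \<pi>) * (\<Prod>i=1..n. A i (\<pi> i)))"
      by simp
    also have "\<dots> = (\<Sum>\<pi> | \<pi> permutes {1..n} \<and> \<pi> i = 1.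
      A i 1 * (of_int (sign \<pi>) * (\<Prod>l\<in>{1..n}-{i}. A l (\<pi> l))))"
      by (intro sum.cong refl) (use i in \<open>auto simp: prod.remove[of _ i]\<close>)
    finally show "(\<Sum>\<pi> | \<pi> permutes {1..n} \<and> inv_into UNIV \<pi> 1 = i. of_int (sign \<pi>) * (\<Prod>i=1..n. A i (\<pi> i))) =
      A i 1 * (\<Sum>\<pi> | \<pi> permutes {1..n} \<and> \<pi> i = 1. of_int (sign \<pi>) * (\<Prod>l\<in>{1..n}-{i}. A l (\<pi> l)))"
      by (simp add: sum_distrib_left)
  qed
  finally show ?thesis .
qed

lemma leibniz_det_expand:
  assumes "1 \<le> n"
  shows "leibniz_det n A = (\<Sum>i=1..n. A i 1 * cofactor n i A)"
  unfolding leibniz_det_expand_leibniz[OF assms]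
  by (intro sum.cong refl) (simp add: cofactor_leibniz)

lemma cofactor_cong:
  assumes "i \<in> {1..n}" "\<And>l j. l \<in> {1..n} \<Longrightarrow> j \<in> {2..n} \<Longrightarrow> A l j = B l j"
  shows "cofactor n i A = cofactor n i B"
  unfolding cofactor_def
  using assms by (intro arg_cong2[of _ _ _ _ "(*)"] refl leibniz_det_cong) (auto simp: skip_def)

text \<open>Both sides are expanded along column 1, on which the cofactors do not depend. The
  application is the chain rule: the derivatives of a coefficient are combinations of those of the
  coordinates t_m.\<close>

lemma leibniz_det_linear_first_column:
  assumes "1 \<le> n" "\<And>i. i \<in> {1..n} \<Longrightarrow> A i 1 = (\<Sum>m\<in>M. c m * G i m)"
  shows "leibniz_det n A = (\<Sum>m\<in>M. c m * leibniz_det n (\<lambda>i j. if j = 1 then G i m else A i j))"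
proof -
  have "leibniz_det n A = (\<Sum>i=1..n. (\<Sum>m\<in>M. c m * G i m) * cofactor n i A)"
    unfolding leibniz_det_expand[OF assms(1)] using assms(2) by (intro sum.cong) auto
  also have "\<dots> = (\<Sum>m\<in>M. \<Sum>i=1..n. c m * (G i m * cofactor n i A))"
    by (subst sum.swap) (simp add: sum_distrib_right mult.assoc)
  also have "\<dots> = (\<Sum>m\<in>M. c m * (\<Sum>i=1..n. G i m * cofactor n i (\<lambda>i j. if j = 1 then G i m else A i j)))"
    by (intro sum.cong refl, subst sum_distrib_left, intro sum.cong refl)
       (auto intro!: arg_cong2[of _ _ _ _ "(*)"] cofactor_cong)
  also have "\<dots> = (\<Sum>m\<in>M. c m * leibniz_det n (\<lambda>i j. if j = 1 then G i m else A i j))"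
    by (simp add: leibniz_det_expand[OF assms(1)])
  finally show ?thesis .
qed

text \<open>The sum is the determinant with every entry of column 1 replaced by 1; subtracting row 1
  from the others leaves a single non-zero entry there. The result is the shape of the Jacobian on
  face 0, where moving coordinate l+1 moves coordinate 1 oppositely.\<close>

lemma sum_cofactors:
  assumes "1 \<le> n"
  shows "(\<Sum>i=1..n. cofactor n i A) = leibniz_det (n - 1) (\<lambda>l j. A (Suc l) (Suc j) - A 1 (Suc j))"
proof -
  define A' where "A' i j = (if j = 1 then 1 else A i j)" for i j
  define B where "B = (\<lambda>i j. if i \<in> {2..n} then A' i j - A' 1 j else A' i j)"
  have "(\<Sum>i=1..n. cofactor n i A) = leibniz_det n A'"
    unfolding leibniz_det_expand[OF assms]
    by (intro sum.cong refl) (auto simp: A'_def intro!: cofactor_cong)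
  also have "\<dots> = leibniz_det n B"
    unfolding B_def by (subst leibniz_det_sub_first_row) auto
  also have "\<dots> = (\<Sum>i=1..n. if i = 1 then cofactor n 1 B else 0)"
    unfolding leibniz_det_expand[OF assms] by (intro sum.cong refl) (auto simp: B_def A'_def)
  also have "\<dots> = cofactor n 1 B" using assms by simp
  also have "\<dots> = leibniz_det (n - 1) (\<lambda>l j. A (Suc l) (Suc j) - A 1 (Suc j))"
    unfolding cofactor_def by (simp, intro leibniz_det_cong) (auto simp: B_def A'_def skip_def)
  finally show ?thesis .
qed

subsection \<open>Derivatives on simplices and Stokes' theorem\<close>

definition simplex_extension :: "nat \<Rightarrow> (nat \<Rightarrow> real) set \<Rightarrow> ((nat \<Rightarrow> nat) \<Rightarrow> (nat \<Rightarrow> real) \<Rightarrow> complex) \<Rightarrow> bool" where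
  "simplex_extension p V D \<longleftrightarrow> open V \<and> standard_simplex p \<subseteq> V \<and>
     (\<forall>\<nu> :: nat \<Rightarrow> nat.
         continuous_on (V \<inter> {s. \<forall>i>p. s i = 0}) (D \<nu>) \<and>
         (\<forall>i\<le>p. \<forall>s \<in> V \<inter> {s. \<forall>i>p. s i = 0}.
            ((\<lambda>h. D \<nu> (s(i := h))) has_vector_derivative D (\<nu>(i := Suc (\<nu> i))) s) (at (s i))))"

lemma has_vector_derivative_eventually_eq:
  assumes "(f has_vector_derivative f') (at x)" "eventually (\<lambda>y. f y = g y) (nhds x)"
  shows "(g has_vector_derivative f') (at x)"
proof -
  have "eventually (\<lambda>y. y \<in> UNIV \<longrightarrow> f y = g y) (nhds x)" "f x = g x"
    using assms(2) eventually_nhds_x_imp_x[OF assms(2)] by auto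
  from has_vector_derivative_cong_ev[OF this] assms(1) show ?thesis by blast
qed

text \<open>Only partial derivatives of the extension are given; continuity of one of them makes
  \<open>D \<nu>\<close> differentiable in the coordinates \<open>i\<close> and \<open>j\<close>
  jointly. The claim is then the chain rule in the direction (1, -1), which keeps the sum of the
  coordinates fixed.\<close>

lemma simplex_extension_line:
  assumes ext: "simplex_extension p V D" and s: "s \<in> standard_simplex p"
    and ij: "i \<le> p" "j \<le> p" "i \<noteq> j"
  shows "((\<lambda>h. D \<nu> (s(i := s i + (h - h0), j := s j - (h - h0)))) has_vector_derivative
    D (\<nu>(i := Suc (\<nu> i))) s - D (\<nu>(j := Suc (\<nu> j))) s) (at h0)"
proof -
  define H where "H = {s :: nat \<Rightarrow> real. \<forall>i>p. s i = 0}"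
  have V: "open V" and sV: "s \<in> V" and sH: "s \<in> H"
    and cont: "\<And>\<nu>. continuous_on (V \<inter> H) (D \<nu>)"
    and der: "\<And>\<nu> i s. i \<le> p \<Longrightarrow> s \<in> V \<inter> H \<Longrightarrow>
      ((\<lambda>h. D \<nu> (s(i := h))) has_vector_derivative D (\<nu>(i := Suc (\<nu> i))) s) (at (s i))"
    using ext s by (auto simp: simplex_extension_def H_def standard_simplex_def)
  define w where "w = (\<lambda>(x::real, y::real). s(i := x, j := y))"
  have w_cont: "continuous_on A w" for A
  proof (rule continuous_on_coordinatewise_then_product)
    fix m show "continuous_on A (\<lambda>z. w z m)"
      unfolding w_def by (cases "m = i"; cases "m = j") (auto simp: case_prod_unfold intro!: continuous_intros)
  qed
  have "open (w -` V)" using w_cont[of UNIV] V by (simp add: open_vimage)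
  moreover have "(s i, s j) \<in> w -` V" using sV by (simp add: w_def)
  ultimately obtain X Y where XY: "open X" "open Y" "s i \<in> X" "s j \<in> Y" "X \<times> Y \<subseteq> w -` V"
    using open_prod_elim by (metis SigmaE2)
  \<comment> \<open>The second factor is shrunk to a ball because
    \<open>has_derivative_partialsI\<close> requires it to be convex.\<close>
  obtain \<epsilon> where \<epsilon>: "\<epsilon> > 0" "ball (s j) \<epsilon> \<subseteq> Y"
    using XY openE by metis
  define Y' where "Y' = ball (s j) \<epsilon>"
  have wVH: "w (x, y) \<in> V \<inter> H" if "x \<in> X" "y \<in> Y'" for x y
  proof -
    have "w (x, y) \<in> V" using that XY \<epsilon> unfolding Y'_def by blast
    moreover have "w (x, y) \<in> H" using sH ij by (auto simp: w_def H_def)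
    ultimately show ?thesis by simp
  qed
  define Dj where "Dj = D (\<nu>(j := Suc (\<nu> j)))"
  define Di where "Di = D (\<nu>(i := Suc (\<nu> i)))"
  have D0: "((\<lambda>(x, y). D \<nu> (w (x, y))) has_derivative
      (\<lambda>(tx, ty). tx *\<^sub>R Di s + blinfun_scaleR_left (Dj (w (s i, s j))) ty)) (at (s i, s j) within X \<times> Y')"
  proof (rule has_derivative_partialsI)
    have "((\<lambda>x. D \<nu> (s(i := x))) has_vector_derivative Di s) (at (s i))"
      using der[of i s \<nu>] sV sH ij by (simp add: Di_def)
    moreover have "(\<lambda>x. D \<nu> (w (x, s j))) = (\<lambda>x. D \<nu> (s(i := x)))"
      using ij by (auto simp: w_def fun_eq_iff intro!: arg_cong[of _ _ "D \<nu>"])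
    ultimately show "((\<lambda>x. D \<nu> (w (x, s j))) has_derivative (\<lambda>tx. tx *\<^sub>R Di s)) (at (s i) within X)"
      unfolding has_vector_derivative_def by (simp add: has_derivative_at_withinI)
  next
    fix x y assume xy: "x \<in> X" "y \<in> Y'"
    have "((\<lambda>h. D \<nu> ((w (x, y))(j := h))) has_vector_derivative Dj (w (x, y))) (at y)"
      using der[of j "w (x, y)" \<nu>] wVH[OF xy] ij by (simp add: Dj_def w_def)
    moreover have "(w (x, y))(j := h) = w (x, h)" for h by (simp add: w_def)
    ultimately show "((\<lambda>y. D \<nu> (w (x, y))) has_derivative blinfun_apply (blinfun_scaleR_left (Dj (w (x, y)))))
        (at y within Y')"
      unfolding has_vector_derivative_def by (simp add: has_derivative_at_withinI blinfun_scaleR_left.rep_eq)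
  next
    have "continuous_on (X \<times> Y') (\<lambda>z. blinfun_scaleR_left (Dj (w z)))"
      unfolding Dj_def
      by (intro bounded_linear.continuous_on[OF bounded_linear_blinfun_scaleR_left]
          continuous_on_compose2[OF cont w_cont] subsetI) (elim imageE SigmaE, simp only: wVH)
    then show "continuous (at (s i, s j) within X \<times> Y') (\<lambda>(x, y). blinfun_scaleR_left (Dj (w (x, y))))"
      using XY \<epsilon> by (simp add: continuous_on_eq_continuous_within Y'_def case_prod_unfold)
  qed (use \<epsilon> in \<open>auto simp: Y'_def\<close>)
  have at_XY: "at (s i, s j) within X \<times> Y' = at (s i, s j)"
    using XY \<epsilon> by (intro at_within_open open_Times) (auto simp: Y'_def)
  have ws: "w (s i, s j) = s" by (simp add: w_def)
  have D: "((\<lambda>(x, y). D \<nu> (w (x, y))) has_derivative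
      (\<lambda>(tx, ty). tx *\<^sub>R Di s + ty *\<^sub>R Dj s)) (at (s i, s j))"
    using D0 unfolding at_XY ws blinfun_scaleR_left.rep_eq .
  have "((\<lambda>h. (s i + (h - h0), s j - (h - h0))) has_derivative (\<lambda>h. (h, - h))) (at h0)"
    by (auto intro!: derivative_eq_intros)
  then have "((\<lambda>h. (\<lambda>(x, y). D \<nu> (w (x, y))) (s i + (h - h0), s j - (h - h0))) has_derivative
      (\<lambda>h. (\<lambda>(tx, ty). tx *\<^sub>R Di s + ty *\<^sub>R Dj s) (h, - h))) (at h0)"
    by (rule has_derivative_compose) (simp only: diff_self add_0_right diff_0_right D)
  then show ?thesis
    unfolding has_vector_derivative_def Di_def[symmetric] Dj_def[symmetric]
    by (simp add: w_def scaleR_diff_right)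
qed

lemma eventually_open_simplex_upd:
  assumes "s \<in> open_simplex p" "i \<in> {1..p}"
  shows "eventually (\<lambda>h. s(i := h) \<in> open_simplex p) (nhds (s i))"
proof -
  let ?I = "{1..p} - {i}"
  have I: "insert i ?I = {1..p}" "finite ?I" "i \<notin> ?I" using assms by auto
  define x where "x = restrict s ?I"
  have x: "x \<in> ?I \<rightarrow>\<^sub>E UNIV" by (simp add: x_def)
  have sx: "s(i := h) = x(i := h)" for h
    using assms by (auto simp: x_def fun_eq_iff open_simplex_def PiE_iff extensional_def)
  note iff = corner_simplex_upd[OF I(2,3) x, unfolded I(1), folded open_simplex_corner sx]
  have "s i \<in> {0<..<1 - (\<Sum>j\<in>?I. x j)}" and c: "x \<in> corner_simplex ?I"
    using assms(1) iff[of "s i"] by auto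
  then have "eventually (\<lambda>h. h \<in> {0<..<1 - (\<Sum>j\<in>?I. x j)}) (nhds (s i))"
    by (intro eventually_nhds_in_open) auto
  then show ?thesis by eventually_elim (use c in \<open>simp add: iff\<close>)
qed

lemma barycentric_upd:
  assumes "i \<in> {1..p}"
  shows "barycentric p (s(i := h)) = (barycentric p s)(i := barycentric p s i + (h - s i), 0 := barycentric p s 0 - (h - s i))"
proof -
  have "(\<Sum>j=1..p. (s(i := h)) j) = (\<Sum>j=1..p. s j) + (h - s i)"
  proof -
    have "(\<Sum>j=1..p. u j) = u i + (\<Sum>j\<in>{1..p} - {i}. u j)" for u :: "nat \<Rightarrow> real"
      using assms by (intro sum.remove) auto
    from this[of s] this[of "s(i := h)"] show ?thesis
      by simp
  qed
  then show ?thesis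
    using assms by (auto simp: barycentric_def fun_eq_iff)
qed

lemma simplical_face_upd:
  "simplical_face k (x(l := y)) = (simplical_face k x)(skip k l := y)"
  by (auto simp: simplical_face_def skip_def fun_eq_iff)

lemma simplical_face_skip [simp]: "simplical_face k x (skip k l) = x l"
  by (auto simp: simplical_face_def skip_def)

text \<open>The last two clauses are the derivatives along the faces: on face \<open>0\<close>, which is parametrised by
  \<open>s 2, ..., s p\<close>, the dependent coordinate is \<open>s 1\<close>.\<close>

definition simplex_derivs ::
  "nat \<Rightarrow> ((nat \<Rightarrow> real) \<Rightarrow> complex) \<Rightarrow> (nat \<Rightarrow> (nat \<Rightarrow> real) \<Rightarrow> complex) \<Rightarrow>
   (nat \<Rightarrow> nat \<Rightarrow> (nat \<Rightarrow> real) \<Rightarrow> complex) \<Rightarrow> bool" where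
  "simplex_derivs p f f1 f2 \<longleftrightarrow>
    (\<forall>i\<in>{1..p}. simplex_deriv p i f (f1 i)) \<and>
    (\<forall>i\<in>{1..p}. \<forall>l\<in>{1..p}. simplex_deriv p l (f1 i) (f2 i l)) \<and>
    (\<forall>i l. f2 i l = f2 l i) \<and>
    (\<forall>k\<in>{1..p}. \<forall>l\<in>{1..p-1}. simplex_deriv (p - 1) l
       (\<lambda>s. f (simplical_face k s)) (\<lambda>s. f1 (skip k l) (simplical_face k s))) \<and>
    (\<forall>l\<in>{1..p-1}. simplex_deriv (p - 1) l
       (\<lambda>s. f (simplical_face 0 s)) (\<lambda>s. f1 (Suc l) (simplical_face 0 s) - f1 1 (simplical_face 0 s)))"

text \<open>With coordinate 0 dependent, differentiating in \<open>s i\<close> means taking the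
  difference of the partial derivatives \<open>i\<close> and 0 of the extension. Symmetry of the
  second derivatives holds by construction, because \<open>D\<close> is indexed by multi-indices and
  not by sequences of differentiations.\<close>

lemma smooth_on_simplex_derivs:
  assumes "smooth_on_simplex p f"
  shows "\<exists>f1 f2. simplex_derivs p f f1 f2"
proof -
  obtain V D where ext: "simplex_extension p V D" and D0: "\<And>s. s \<in> standard_simplex p \<Longrightarrow> D (\<lambda>_. 0) s = f s"
    using assms unfolding smooth_on_simplex_def simplex_extension_def by blast
  define up where "up \<nu> i = \<nu>(i := Suc (\<nu> i))" for \<nu> :: "nat \<Rightarrow> nat" and i
  define z where "z = (\<lambda>_::nat. 0::nat)"
  have up_commute: "up (up \<nu> i) l = up (up \<nu> l) i" for \<nu> i l
    by (auto simp: up_def fun_eq_iff)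
  have cont: "continuous_on (standard_simplex p) (D \<nu>)" for \<nu>
    using ext by (auto simp: simplex_extension_def standard_simplex_def intro: continuous_on_subset)
  have cont_f: "continuous_on (standard_simplex p) f"
    using cont[of z] D0 by (simp add: z_def cong: continuous_on_cong)
  define f1 where "f1 i s = D (up z i) s - D (up z 0) s" for i s
  define f2 where "f2 i l s = (D (up (up z i) l) s - D (up (up z i) 0) s) - (D (up (up z 0) l) s - D (up (up z 0) 0) s)" for i l s
  have line: "((\<lambda>h. D \<nu> (barycentric p (s(l := h)))) has_vector_derivative
      (D (up \<nu> l) (barycentric p s) - D (up \<nu> 0) (barycentric p s))) (at (s l))"
    if "l \<in> {1..p}" "s \<in> open_simplex p" for l s \<nu>
    unfolding barycentric_upd[OF that(1)] up_def
    by (rule simplex_extension_line[OF ext barycentric_open_simplex]) (use that in auto)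
  have ev: "eventually (\<lambda>h. barycentric p (s(l := h)) \<in> standard_simplex p) (nhds (s l))"
    if "l \<in> {1..p}" "s \<in> open_simplex p" for l s p
    using eventually_open_simplex_upd[OF that(2,1)] by eventually_elim (rule barycentric_open_simplex)
  \<comment> \<open>On face \<open>k\<close> the dependent coordinate of the smaller simplex sits in
    place \<open>skip k 0\<close>: this is 0 for \<open>k > 0\<close>, but 1 for
    \<open>k = 0\<close>.\<close>
  have face: "((\<lambda>h. f (simplical_face k (barycentric (p - 1) (s(l := h))))) has_vector_derivative
      (D (up z (skip k l)) (simplical_face k (barycentric (p - 1) s)) - D (up z (skip k 0)) (simplical_face k (barycentric (p - 1) s)))) (at (s l))"
    if l: "l \<in> {1..p-1}" and k: "k \<le> p" and s: "s \<in> open_simplex (p - 1)" for l s k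
  proof -
    have p: "1 \<le> p" using l by auto
    have in_p: "simplical_face k b \<in> standard_simplex p" if "b \<in> standard_simplex (p - 1)" for b :: "nat \<Rightarrow> real"
      using simplical_face_in_standard_simplex[OF p k] that by simp
    have "((\<lambda>h. D z (simplical_face k (barycentric (p - 1) (s(l := h))))) has_vector_derivative
      (D (up z (skip k l)) (simplical_face k (barycentric (p - 1) s)) - D (up z (skip k 0)) (simplical_face k (barycentric (p - 1) s)))) (at (s l))"
    proof -
      have "simplical_face k (barycentric (p - 1) (s(l := h))) =
        (simplical_face k (barycentric (p - 1) s))(skip k l := simplical_face k (barycentric (p - 1) s) (skip k l) + (h - s l),
           skip k 0 := simplical_face k (barycentric (p - 1) s) (skip k 0) - (h - s l))" for h
        unfolding barycentric_upd[OF l] simplical_face_upd by simp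
      then show ?thesis
        unfolding up_def
        by (simp only:) (rule simplex_extension_line[OF ext in_p[OF barycentric_open_simplex[OF s]]], use l in \<open>auto simp: skip_def\<close>)
    qed
    moreover have "eventually (\<lambda>h. D z (simplical_face k (barycentric (p - 1) (s(l := h)))) =
        f (simplical_face k (barycentric (p - 1) (s(l := h))))) (nhds (s l))"
      using ev[OF l s] by eventually_elim (use in_p D0 in \<open>auto simp: z_def\<close>)
    ultimately show ?thesis
      by (rule has_vector_derivative_eventually_eq)
  qed
  have "simplex_derivs p f f1 f2"
    unfolding simplex_derivs_def
  proof (intro conjI ballI allI)
    show "simplex_deriv p i f (f1 i)" if i: "i \<in> {1..p}" for i
      unfolding simplex_deriv_def
    proof (intro conjI ballI cont_f)
      show "continuous_on (standard_simplex p) (f1 i)" unfolding f1_def by (intro continuous_on_diff cont)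
      fix s assume s: "s \<in> open_simplex p"
      have "eventually (\<lambda>h. D z (barycentric p (s(i := h))) = f (barycentric p (s(i := h)))) (nhds (s i))"
        using ev[OF i s] by eventually_elim (simp add: z_def D0)
      from has_vector_derivative_eventually_eq[OF line[OF i s] this]
      show "((\<lambda>h. f (barycentric p (s(i := h)))) has_vector_derivative f1 i (barycentric p s)) (at (s i))"
        unfolding f1_def .
    qed
    show "simplex_deriv p l (f1 i) (f2 i l)" if "i \<in> {1..p}" "l \<in> {1..p}" for i l
      unfolding simplex_deriv_def f1_def f2_def
      by (intro conjI ballI continuous_on_diff cont has_vector_derivative_diff line that)
    show "f2 i l = f2 l i" for i l
      unfolding f2_def up_commute[of z l i] up_commute[of z l 0] up_commute[of z i 0]
      by (simp add: fun_eq_iff)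
    show "simplex_deriv (p - 1) l (\<lambda>s. f (simplical_face k s)) (\<lambda>s. f1 (skip k l) (simplical_face k s))"
      if k: "k \<in> {1..p}" and l: "l \<in> {1..p-1}" for k l
      unfolding simplex_deriv_def
    proof (intro conjI ballI)
      show "continuous_on (standard_simplex (p - 1)) (\<lambda>s. f (simplical_face k s))"
        by (rule continuous_on_simplical_face[OF cont_f]) (use k in auto)
      show "continuous_on (standard_simplex (p - 1)) (\<lambda>s. f1 (skip k l) (simplical_face k s))"
        unfolding f1_def
        by (intro continuous_on_diff continuous_on_simplical_face[OF cont]) (use k in auto)
      fix s assume s: "s \<in> open_simplex (p - 1)"
      show "((\<lambda>h. f (simplical_face k (barycentric (p - 1) (s(l := h))))) has_vector_derivative
          f1 (skip k l) (simplical_face k (barycentric (p - 1) s))) (at (s l))"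
        using face[OF l _ s, of k] k by (auto simp: f1_def skip_def)
    qed
    show "simplex_deriv (p - 1) l (\<lambda>s. f (simplical_face 0 s)) (\<lambda>s. f1 (Suc l) (simplical_face 0 s) - f1 1 (simplical_face 0 s))"
      if l: "l \<in> {1..p-1}" for l
      unfolding simplex_deriv_def
    proof (intro conjI ballI)
      show "continuous_on (standard_simplex (p - 1)) (\<lambda>s. f (simplical_face 0 s))"
        by (rule continuous_on_simplical_face[OF cont_f]) (use l in auto)
      show "continuous_on (standard_simplex (p - 1)) (\<lambda>s. f1 (Suc l) (simplical_face 0 s) - f1 1 (simplical_face 0 s))"
        unfolding f1_def
        by (intro continuous_on_diff continuous_on_simplical_face[OF cont]) (use l in auto)
      fix s assume s: "s \<in> open_simplex (p - 1)"
      show "((\<lambda>h. f (simplical_face 0 (barycentric (p - 1) (s(l := h))))) has_vector_derivative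
          f1 (Suc l) (simplical_face 0 (barycentric (p - 1) s)) - f1 1 (simplical_face 0 (barycentric (p - 1) s))) (at (s l))"
        using face[OF l _ s, of 0] by (simp add: f1_def skip_def)
    qed
  qed
  then show ?thesis by blast
qed

section \<open>Calculus rules on simplices\<close>

lemma simplex_deriv_mult:
  assumes "simplex_deriv p i f f'" "simplex_deriv p i g g'"
  shows "simplex_deriv p i (\<lambda>s. f s * g s) (\<lambda>s. f s * g' s + f' s * g s)"
  using assms unfolding simplex_deriv_def
  by (auto intro!: continuous_on_mult continuous_on_add has_vector_derivative_mult)
     (use has_vector_derivative_mult in fastforce)

lemma simplex_deriv_cmult:
  assumes "simplex_deriv p i f f'"
  shows "simplex_deriv p i (\<lambda>s. a * f s) (\<lambda>s. a * f' s)"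
  using assms unfolding simplex_deriv_def
  by (auto intro!: continuous_on_mult has_vector_derivative_mult_right)

lemma simplex_deriv_sum:
  assumes "\<And>j. j \<in> J \<Longrightarrow> simplex_deriv p i (f j) (f' j)"
  shows "simplex_deriv p i (\<lambda>s. \<Sum>j\<in>J. f j s) (\<lambda>s. \<Sum>j\<in>J. f' j s)"
  using assms unfolding simplex_deriv_def
  by (auto intro!: continuous_on_sum has_vector_derivative_sum)

lemma has_vector_derivative_prod:
  fixes f :: "'i \<Rightarrow> real \<Rightarrow> complex"
  assumes "\<And>i. i \<in> I \<Longrightarrow> (f i has_vector_derivative f' i) (at x)"
  shows "((\<lambda>x. \<Prod>i\<in>I. f i x) has_vector_derivative (\<Sum>i\<in>I. f' i * (\<Prod>j\<in>I - {i}. f j x))) (at x)"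
proof -
  have "((\<lambda>x. \<Prod>i\<in>I. f i x) has_derivative (\<lambda>y. \<Sum>i\<in>I. (y *\<^sub>R f' i) * (\<Prod>j\<in>I - {i}. f j x))) (at x)"
    using assms unfolding has_vector_derivative_def by (rule has_derivative_prod)
  then show ?thesis
    unfolding has_vector_derivative_def by (simp add: scaleR_sum_right)
qed

lemma simplex_deriv_prod:
  assumes "\<And>j. j \<in> J \<Longrightarrow> simplex_deriv p i (f j) (f' j)"
  shows "simplex_deriv p i (\<lambda>s. \<Prod>j\<in>J. f j s) (\<lambda>s. \<Sum>j\<in>J. f' j s * (\<Prod>l\<in>J-{j}. f l s))"
  unfolding simplex_deriv_def
proof (intro conjI ballI)
  show "continuous_on (standard_simplex p) (\<lambda>s. \<Prod>j\<in>J. f j s)"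
    using assms by (intro continuous_on_prod) (auto simp: simplex_deriv_def)
  show "continuous_on (standard_simplex p) (\<lambda>s. \<Sum>j\<in>J. f' j s * (\<Prod>l\<in>J-{j}. f l s))"
    using assms by (intro continuous_on_sum continuous_on_mult continuous_on_prod) (auto simp: simplex_deriv_def)
  fix s assume "s \<in> open_simplex p"
  then have "((\<lambda>h. f j (barycentric p (s(i := h)))) has_vector_derivative f' j (barycentric p s)) (at (s i))"
    if "j \<in> J" for j
    using assms[OF that] by (auto simp: simplex_deriv_def)
  from has_vector_derivative_prod[of J, OF this]
  show "((\<lambda>h. \<Prod>j\<in>J. f j (barycentric p (s(i := h)))) has_vector_derivative
      (\<Sum>j\<in>J. f' j (barycentric p s) * (\<Prod>l\<in>J-{j}. f l (barycentric p s)))) (at (s i))"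
    by simp
qed

text \<open>The cofactors of a Jacobian matrix are divergence free: exchanging the two differentiated
  directions pairs off the terms.\<close>

lemma sum_cofactor_derivs_eq_0:
  fixes f1 :: "nat \<Rightarrow> nat \<Rightarrow> complex" and f2 :: "nat \<Rightarrow> nat \<Rightarrow> nat \<Rightarrow> complex"
  assumes sym: "\<And>j i l. f2 j i l = f2 j l i"
  shows "(\<Sum>i=1..n. \<Sum>\<pi> | \<pi> permutes {1..n} \<and> \<pi> i = 1. of_int (sign \<pi>) *
     (\<Sum>m\<in>{1..n}-{i}. f2 (\<pi> m) m i * (\<Prod>l\<in>{1..n}-{i}-{m}. f1 (\<pi> l) l))) = 0"
proof -
  define T where "T = (\<lambda>(i, \<pi>, m). of_int (sign \<pi>) * (f2 (\<pi> m) m i * (\<Prod>l\<in>{1..n}-{i}-{m}. f1 (\<pi> l) l)))"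
  define S where "S = (SIGMA i:{1..n}. (SIGMA \<pi>:{\<pi>. \<pi> permutes {1..n} \<and> \<pi> i = 1}. {1..n}-{i}))"
  have fin: "finite {\<pi>. \<pi> permutes {1..n} \<and> \<pi> i = 1}" for i
    by (rule finite_subset[OF _ finite_permutations[of "{1..n}"]]) auto
  \<comment> \<open>Precomposing \<open>\<pi>\<close> with the transposition of \<open>i\<close> and
    \<open>m\<close> turns the condition \<open>\<pi> i = 1\<close> into the same condition at
    \<open>m\<close>, keeps \<open>\<pi> m\<close> as the index of the twice differentiated
    function, and reverses the sign.\<close>
  let ?\<phi> = "\<lambda>(i::nat, \<pi>::nat \<Rightarrow> nat, m::nat). (m, \<pi> \<circ> Transposition.transpose i m, i)"
  have eq: "(\<Sum>i=1..n. \<Sum>\<pi> | \<pi> permutes {1..n} \<and> \<pi> i = 1. of_int (sign \<pi>) *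
     (\<Sum>m\<in>{1..n}-{i}. f2 (\<pi> m) m i * (\<Prod>l\<in>{1..n}-{i}-{m}. f1 (\<pi> l) l))) = sum T S"
    unfolding S_def T_def using fin
    by (simp add: sum.Sigma[symmetric] sum_distrib_left)
  have "sum T S = (\<Sum>z\<in>S. - T z)"
  proof -
    have "?\<phi> (?\<phi> z) = z \<and> ?\<phi> z \<in> S \<and> - T (?\<phi> z) = T z" if z: "z \<in> S" for z
    proof -
    from z obtain i \<pi> m where zz: "z = (i, \<pi>, m)" and i: "i \<in> {1..n}" and m': "m \<in> {1..n} - {i}"
      and \<pi>: "\<pi> permutes {1..n}" "\<pi> i = 1"
      unfolding S_def by blast
    then have m: "m \<in> {1..n}" "m \<noteq> i" by auto
    have t: "Transposition.transpose i m permutes {1..n}"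
      using i m by (intro permutes_swap_id) auto
    have 1: "?\<phi> (?\<phi> z) = z"
      by (auto simp: zz fun_eq_iff transpose_commute[of m i])
    have 2: "?\<phi> z \<in> S"
      using permutes_compose[OF t \<pi>(1)] \<pi>(2) i m by (simp add: zz S_def)
    have s: "sign (\<pi> \<circ> Transposition.transpose i m) = - sign \<pi>"
      using m t \<pi>(1) by (subst sign_compose) (auto simp: sign_swap_id intro: permutes_imp_permutation[of "{1..n}"])
    have "(\<Prod>l\<in>{1..n}-{m}-{i}. f1 ((\<pi> \<circ> Transposition.transpose i m) l) l) = (\<Prod>l\<in>{1..n}-{i}-{m}. f1 (\<pi> l) l)"
      by (intro prod.cong) auto
    then have "- T (?\<phi> z) = T z"
      using s sym[of "\<pi> m" i m] by (simp add: zz T_def)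
    with 1 2 show ?thesis by blast
    qed
    then show ?thesis
      by (intro sum.reindex_bij_witness[where i="?\<phi>" and j="?\<phi>"]) blast+
  qed
  then show ?thesis unfolding eq by (simp add: sum_negf)
qed

lemma simplex_jacobian_leibniz_det:
  "simplex_jacobian p \<sigma> s =
     leibniz_det p (\<lambda>i j. vector_derivative (\<lambda>h. \<sigma> (barycentric p (s(i := h))) j) (at (s i)))"
  by (simp add: simplex_jacobian_def leibniz_det_def)

lemma vector_derivative_simplex_deriv:
  assumes "simplex_deriv p i f f'" "s \<in> open_simplex p"
  shows "vector_derivative (\<lambda>h. f (barycentric p (s(i := h)))) (at (s i)) = f' (barycentric p s)"
  using assms by (intro vector_derivative_at) (auto simp: simplex_deriv_def)

lemma simplex_jacobian_eq:
  assumes "\<And>i j. i \<in> {1..p} \<Longrightarrow> j \<in> {1..p} \<Longrightarrow> simplex_deriv p i (\<lambda>u. \<sigma> u j) (f1 j i)" "s \<in> open_simplex p"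
  shows "simplex_jacobian p \<sigma> s = leibniz_det p (\<lambda>i j. f1 j i (barycentric p s))"
  unfolding simplex_jacobian_leibniz_det
  using vector_derivative_simplex_deriv[OF assms(1) assms(2)] by (intro leibniz_det_cong) blast

text \<open>Around a point of the open simplex only values on the closed simplex enter the
  derivatives. This matters because \<open>singular_face\<close> agrees with the composed map on the
  standard simplex only.\<close>

lemma simplex_jacobian_cong:
  assumes "\<And>u j. u \<in> standard_simplex p \<Longrightarrow> j \<in> {1..p} \<Longrightarrow> \<sigma> u j = \<tau> u j" "s \<in> open_simplex p"
  shows "simplex_jacobian p \<sigma> s = simplex_jacobian p \<tau> s"
  unfolding simplex_jacobian_leibniz_det
proof (rule leibniz_det_cong)
  fix i j assume ij: "i \<in> {1..p}" "j \<in> {1..p}"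
  have "eventually (\<lambda>h. barycentric p (s(i := h)) \<in> standard_simplex p) (nhds (s i))"
    using eventually_open_simplex_upd[OF assms(2) ij(1)] by eventually_elim (rule barycentric_open_simplex)
  then have "eventually (\<lambda>h. \<sigma> (barycentric p (s(i := h))) j = \<tau> (barycentric p (s(i := h))) j) (nhds (s i))"
    by eventually_elim (use assms(1) ij in auto)
  then show "vector_derivative (\<lambda>h. \<sigma> (barycentric p (s(i := h))) j) (at (s i)) =
      vector_derivative (\<lambda>h. \<tau> (barycentric p (s(i := h))) j) (at (s i))"
    by (intro vector_derivative_cong_eq) auto
qed

lemma continuous_on_leibniz_det:
  assumes "\<And>i j. i \<in> {1..n} \<Longrightarrow> j \<in> {1..n} \<Longrightarrow> continuous_on S (A i j)"
  shows "continuous_on S (\<lambda>s. leibniz_det n (\<lambda>i j. A i j s))"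
  unfolding leibniz_det_def
proof (intro continuous_on_sum continuous_on_mult continuous_on_const continuous_on_prod assms)
  fix \<pi> i assume "\<pi> \<in> {\<pi>. \<pi> permutes {1..n}}" "i \<in> {1..n}"
  then show "\<pi> i \<in> {1..n}" using permutes_in_image[of \<pi> "{1..n}" i] by simp
qed

abbreviation pullback_integral ::
  "nat \<Rightarrow> ((nat \<Rightarrow> real) \<Rightarrow> complex) \<Rightarrow> ((nat \<Rightarrow> real) \<Rightarrow> nat \<Rightarrow> complex) \<Rightarrow> complex" where
  "pullback_integral n v \<tau> \<equiv> (LINT s:open_simplex n|lborel_product {1..n}.
     v (barycentric n s) * simplex_jacobian n \<tau> s)"

abbreviation jacobian_integral :: "nat \<Rightarrow> ((nat \<Rightarrow> real) \<Rightarrow> nat \<Rightarrow> complex) \<Rightarrow> complex" where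
  "jacobian_integral n \<tau> \<equiv> (LINT s:open_simplex n|lborel_product {1..n}. simplex_jacobian n \<tau> s)"

text \<open>The form is g dF_1 ... dF_(p-1) with F_j the coordinate \<open>q j\<close>; a general
  \<open>q\<close> serves both the full list of coordinates and a list with one omitted. The left
  integrand is the divergence of the field \<open>g * C i\<close>, and
  \<open>simplex_integral_deriv\<close> applies to each of its terms.\<close>

theorem stokes_simplex:
  fixes \<sigma> :: "(nat \<Rightarrow> real) \<Rightarrow> nat \<Rightarrow> complex"
  assumes p: "1 \<le> p" and \<sigma>: "\<And>j. j \<in> {1..p-1} \<Longrightarrow> smooth_on_simplex p (\<lambda>s. \<sigma> s (q j))"
    and g: "\<And>i. i \<in> {1..p} \<Longrightarrow> simplex_deriv p i g (g' i)"
  shows "jacobian_integral p (\<lambda>u j. if j = 1 then g u else \<sigma> u (q (j - 1))) =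
    (\<Sum>k\<le>p. (-1) ^ k * pullback_integral (p - 1)
      (\<lambda>u. g (simplical_face k u)) (\<lambda>u j. \<sigma> (simplical_face k u) (q j)))"
proof -
  have "\<exists>f. simplex_derivs p (\<lambda>s. \<sigma> s (q (j - 1))) (fst f) (snd f)" if "j \<in> {2..p}" for j
  proof -
    have "j - 1 \<in> {1..p-1}" using that by auto
    from smooth_on_simplex_derivs[OF \<sigma>[OF this]] show ?thesis by simp
  qed
  then have "\<forall>j\<in>{2..p}. \<exists>f. simplex_derivs p (\<lambda>s. \<sigma> s (q (j - 1))) (fst f) (snd f)" by (intro ballI)
  from bchoice[OF this] obtain ff where
    ff: "\<forall>j\<in>{2..p}. simplex_derivs p (\<lambda>s. \<sigma> s (q (j - 1))) (fst (ff j)) (snd (ff j))" ..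
  define f1 f2 where "f1 j = fst (ff j)" and "f2 j = snd (ff j)" for j
  note Q = ff[rule_format, folded f1_def f2_def, unfolded simplex_derivs_def]
  have f: "simplex_deriv p i (\<lambda>s. \<sigma> s (q (j - 1))) (f1 j i)" if "j \<in> {2..p}" "i \<in> {1..p}" for j i
    using Q[OF that(1)] that(2) by blast
  have f1: "simplex_deriv p l (f1 j i) (f2 j i l)" if "j \<in> {2..p}" "i \<in> {1..p}" "l \<in> {1..p}" for j i l
    using Q[OF that(1)] that(2,3) by blast
  have f2: "f2 j i l = f2 j l i" if "j \<in> {2..p}" for j i l
    using Q[OF that(1)] by blast
  have face: "simplex_deriv (p - 1) l (\<lambda>s. \<sigma> (simplical_face k s) (q (j - 1))) (\<lambda>s. f1 j (skip k l) (simplical_face k s))"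
    if "j \<in> {2..p}" "k \<in> {1..p}" "l \<in> {1..p-1}" for j k l
    using Q[OF that(1)] that(2,3) by blast
  have face0: "simplex_deriv (p - 1) l (\<lambda>s. \<sigma> (simplical_face 0 s) (q (j - 1)))
      (\<lambda>s. f1 j (Suc l) (simplical_face 0 s) - f1 j 1 (simplical_face 0 s))"
    if "j \<in> {2..p}" "l \<in> {1..p-1}" for j l
    using Q[OF that(1)] that(2) by blast
  \<comment> \<open>The cancellation lemma asks for symmetry at every function index, while
    \<open>f2 j\<close> is meaningful only for \<open>j\<close> in \<open>{2..p}\<close>; elsewhere
    it is replaced by 0.\<close>
  define f2' where "f2' j i l s = (if j \<in> {2..p} then f2 j i l s else 0)" for j i l s
  define A where "A s i j = (if j = 1 then g' i s else f1 j i s)" for s i j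
  \<comment> \<open>\<open>C i\<close> is the cofactor of column 1 in Leibniz form and
    \<open>C' i\<close> its derivative in direction \<open>i\<close>. Only columns 2, ..., p enter,
    so second derivatives are taken of the smooth coordinates alone and never of
    \<open>g\<close>.\<close>
  define C where "C i s = (\<Sum>\<pi> | \<pi> permutes {1..p} \<and> \<pi> i = 1. of_int (sign \<pi>) * (\<Prod>l\<in>{1..p}-{i}. f1 (\<pi> l) l s))" for i s
  define C' where "C' i s = (\<Sum>\<pi> | \<pi> permutes {1..p} \<and> \<pi> i = 1. of_int (sign \<pi>) *
     (\<Sum>m\<in>{1..p}-{i}. f2' (\<pi> m) m i s * (\<Prod>l\<in>{1..p}-{i}-{m}. f1 (\<pi> l) l s)))" for i s
  have \<pi>l: "\<pi> l \<in> {2..p}" if "\<pi> permutes {1..p}" "\<pi> i = 1" "l \<in> {1..p} - {i}" for \<pi> i l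
  proof -
    have "\<pi> l \<in> {1..p}" using permutes_in_image[OF that(1), of l] that(3) by simp
    moreover have "\<pi> l \<noteq> 1" using permutes_inj[OF that(1)] that(2,3) by (metis DiffE injD singletonI)
    ultimately show ?thesis by auto
  qed
  have C: "simplex_deriv p i (C i) (C' i)" if i: "i \<in> {1..p}" for i
    unfolding C_def C'_def
  proof (intro simplex_deriv_sum simplex_deriv_cmult simplex_deriv_prod)
    fix \<pi> l assume "\<pi> \<in> {\<pi>. \<pi> permutes {1..p} \<and> \<pi> i = 1}" "l \<in> {1..p} - {i}"
    with \<pi>l[of \<pi> i l] have "\<pi> l \<in> {2..p}" "l \<in> {1..p}" by auto
    then show "simplex_deriv p i (f1 (\<pi> l) l) (\<lambda>s. f2' (\<pi> l) l i s)"
      using f1 i unfolding f2'_def by simp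
  qed
  have C_cof: "C i s = cofactor p i (A s)" if "i \<in> {1..p}" for i s
    unfolding cofactor_leibniz[OF that] C_def
  proof (intro sum.cong refl arg_cong2[of _ _ _ _ "(*)"] prod.cong)
    fix \<pi> l assume "\<pi> \<in> {\<pi>. \<pi> permutes {1..p} \<and> \<pi> i = 1}" "l \<in> {1..p} - {i}"
    with \<pi>l[of \<pi> i l] have "\<pi> l \<noteq> 1" by auto
    then show "f1 (\<pi> l) l s = A s l (\<pi> l)" by (simp add: A_def)
  qed
  have C'0: "(\<Sum>i=1..p. C' i s) = 0" for s
    unfolding C'_def
    by (rule sum_cofactor_derivs_eq_0[of "\<lambda>j i l. f2' j i l s"]) (auto simp: f2'_def f2)
  have gc: "continuous_on (standard_simplex p) g" and g'c: "\<And>i. i \<in> {1..p} \<Longrightarrow> continuous_on (standard_simplex p) (g' i)"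
    using g p by (auto simp: simplex_deriv_def)
  have Cc: "continuous_on (standard_simplex p) (C i)" "continuous_on (standard_simplex p) (C' i)" if "i \<in> {1..p}" for i
    using C[OF that] by (auto simp: simplex_deriv_def)
  have gC: "simplex_deriv p i (\<lambda>s. g s * C i s) (\<lambda>s. g s * C' i s + g' i s * C i s)" if "i \<in> {1..p}" for i
    by (intro simplex_deriv_mult g C that)
  let ?J = "\<lambda>k. pullback_integral (p - 1)
      (\<lambda>u. g (simplical_face k u)) (\<lambda>u j. \<sigma> (simplical_face k u) (q j))"
  have meas: "open_simplex n \<in> sets (lborel_product {1..n})" for n by (simp add: open_simplex_corner)
  have "jacobian_integral p (\<lambda>u j. if j = 1 then g u else \<sigma> u (q (j - 1))) =
    simplex_integral p (\<lambda>s. leibniz_det p (A s))"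
    unfolding simplex_integral_def
  proof (intro set_lebesgue_integral_cong meas allI impI)
    fix s assume s: "s \<in> open_simplex p"
    have "simplex_jacobian p (\<lambda>u j. if j = 1 then g u else \<sigma> u (q (j - 1))) s =
      leibniz_det p (\<lambda>i j. (\<lambda>b. A b i j) (barycentric p s))"
    proof (rule simplex_jacobian_eq[OF _ s])
      fix i j assume "i \<in> {1..p}" "j \<in> {1..p}"
      then show "simplex_deriv p i (\<lambda>u. if j = 1 then g u else \<sigma> u (q (j - 1))) (\<lambda>b. A b i j)"
        using g[of i] f[of j i] by (cases "j = 1") (auto simp: A_def)
    qed
    then show "simplex_jacobian p (\<lambda>u j. if j = 1 then g u else \<sigma> u (q (j - 1))) s =
      leibniz_det p (A (barycentric p s))" by simp
  qed
  \<comment> \<open>The added terms \<open>g * C' i\<close> sum to 0 over \<open>i\<close> and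
    complete each \<open>g' i * C i\<close> to the derivative of the product
    \<open>g * C i\<close>.\<close>
  also have "\<dots> = simplex_integral p (\<lambda>s. \<Sum>i=1..p. g s * C' i s + g' i s * C i s)"
  proof (rule simplex_integral_cong)
    fix s
    let ?b = "barycentric p s"
    have "(\<Sum>i=1..p. g ?b * C' i ?b) = g ?b * (\<Sum>i=1..p. C' i ?b)" by (simp add: sum_distrib_left)
    also have "\<dots> = 0" by (simp only: C'0) simp
    finally have z: "(\<Sum>i=1..p. g ?b * C' i ?b) = 0" .
    have "leibniz_det p (A ?b) = (\<Sum>i=1..p. g' i ?b * C i ?b)"
      unfolding leibniz_det_expand[OF p] by (intro sum.cong refl) (simp add: C_cof, simp add: A_def)
    then show "leibniz_det p (A ?b) = (\<Sum>i=1..p. g ?b * C' i ?b + g' i ?b * C i ?b)"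
      unfolding sum.distrib z by simp
  qed
  also have "\<dots> = (\<Sum>i=1..p. simplex_integral p (\<lambda>s. g s * C' i s + g' i s * C i s))"
    by (intro simplex_integral_sum continuous_on_add continuous_on_mult gc g'c Cc)
  also have "\<dots> = (\<Sum>i=1..p. simplex_integral (p - 1) (\<lambda>s. g (simplical_face 0 s) * C i (simplical_face 0 s))
      - simplex_integral (p - 1) (\<lambda>s. g (simplical_face i s) * C i (simplical_face i s)))"
    by (intro sum.cong refl simplex_integral_deriv gC)
  also have "\<dots> = (\<Sum>i=1..p. simplex_integral (p - 1) (\<lambda>s. g (simplical_face 0 s) * C i (simplical_face 0 s)))
      - (\<Sum>i=1..p. simplex_integral (p - 1) (\<lambda>s. g (simplical_face i s) * C i (simplical_face i s)))"
    by (rule sum_subtractf)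
  also have "(\<Sum>i=1..p. simplex_integral (p - 1) (\<lambda>s. g (simplical_face 0 s) * C i (simplical_face 0 s))) =
      simplex_integral (p - 1) (\<lambda>s. \<Sum>i=1..p. g (simplical_face 0 s) * C i (simplical_face 0 s))"
    by (intro simplex_integral_sum[symmetric] continuous_on_mult continuous_on_simplical_face[OF gc]
        continuous_on_simplical_face[OF Cc(1)] p) auto
  \<comment> \<open>All \<open>p\<close> directions contribute to face 0, and
    \<open>sum_cofactors\<close> recognises their total as one Jacobian.\<close>
  also have "\<dots> = ?J 0"
    unfolding simplex_integral_def
  proof (intro set_lebesgue_integral_cong meas allI impI)
    fix s assume s: "s \<in> open_simplex (p - 1)"
    let ?b = "simplical_face 0 (barycentric (p - 1) s)"
    have "(\<Sum>i=1..p. C i ?b) = (\<Sum>i=1..p. cofactor p i (A ?b))"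
      by (intro sum.cong refl C_cof)
    also have "\<dots> = leibniz_det (p - 1) (\<lambda>l j. A ?b (Suc l) (Suc j) - A ?b 1 (Suc j))"
      by (rule sum_cofactors[OF p])
    also have "\<dots> = leibniz_det (p - 1) (\<lambda>l j. (\<lambda>b. f1 (Suc j) (Suc l) (simplical_face 0 b) - f1 (Suc j) 1 (simplical_face 0 b)) (barycentric (p - 1) s))"
      by (rule leibniz_det_cong) (simp add: A_def)
    also have "\<dots> = simplex_jacobian (p - 1) (\<lambda>u j. \<sigma> (simplical_face 0 u) (q j)) s"
    proof (rule simplex_jacobian_eq[OF _ s, symmetric])
      fix i j assume "i \<in> {1..p-1}" "j \<in> {1..p-1}"
      then show "simplex_deriv (p - 1) i (\<lambda>u. \<sigma> (simplical_face 0 u) (q j))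
         (\<lambda>b. f1 (Suc j) (Suc i) (simplical_face 0 b) - f1 (Suc j) 1 (simplical_face 0 b))"
        using face0[of "Suc j" i] by auto
    qed
    finally show "(\<Sum>i=1..p. g ?b * C i ?b) = g ?b * simplex_jacobian (p - 1) (\<lambda>u j. \<sigma> (simplical_face 0 u) (q j)) s"
      by (simp add: sum_distrib_left[symmetric])
  qed
  \<comment> \<open>Face \<open>i\<close> receives only the term of direction \<open>i\<close>. Its
    cofactor is the minor without row \<open>i\<close>, which is the Jacobian of that face up to the
    sign \<open>(-1) ^ (i - 1)\<close>.\<close>
  also have "(\<Sum>i=1..p. simplex_integral (p - 1) (\<lambda>s. g (simplical_face i s) * C i (simplical_face i s))) =
      (\<Sum>i=1..p. - ((-1) ^ i * ?J i))"
  proof (intro sum.cong refl)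
    fix i assume i: "i \<in> {1..p}"
    have "simplex_integral (p - 1) (\<lambda>s. g (simplical_face i s) * C i (simplical_face i s)) =
      (LINT s:open_simplex (p - 1)|lborel_product {1..p-1}. - ((-1) ^ i) * (
      g (simplical_face i (barycentric (p - 1) s)) *
      simplex_jacobian (p - 1) (\<lambda>u j. \<sigma> (simplical_face i u) (q j)) s))"
      unfolding simplex_integral_def
    proof (intro set_lebesgue_integral_cong meas allI impI)
      fix s assume s: "s \<in> open_simplex (p - 1)"
      let ?b = "simplical_face i (barycentric (p - 1) s)"
      have "C i ?b = (-1) ^ (i - 1) * leibniz_det (p - 1) (\<lambda>l j. A ?b (skip i l) (Suc j))"
        unfolding C_cof[OF i] cofactor_def ..
      also have "leibniz_det (p - 1) (\<lambda>l j. A ?b (skip i l) (Suc j)) =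
        leibniz_det (p - 1) (\<lambda>l j. (\<lambda>b. f1 (Suc j) (skip i l) (simplical_face i b)) (barycentric (p - 1) s))"
        by (rule leibniz_det_cong) (simp add: A_def)
      also have "\<dots> = simplex_jacobian (p - 1) (\<lambda>u j. \<sigma> (simplical_face i u) (q j)) s"
      proof (rule simplex_jacobian_eq[OF _ s, symmetric])
        fix l j assume "l \<in> {1..p-1}" "j \<in> {1..p-1}"
        then show "simplex_deriv (p - 1) l (\<lambda>u. \<sigma> (simplical_face i u) (q j))
           (\<lambda>b. f1 (Suc j) (skip i l) (simplical_face i b))"
          using face[of "Suc j" i l] i by auto
      qed
      also have "(-1) ^ (i - 1) = - ((-1 :: complex) ^ i)" using i by (cases i) auto
      finally show "g ?b * C i ?b = - ((-1) ^ i) * (g ?b * simplex_jacobian (p - 1) (\<lambda>u j. \<sigma> (simplical_face i u) (q j)) s)"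
        by simp
    qed
    also have "\<dots> = - ((-1) ^ i * ?J i)" by (subst set_integral_mult_right) simp
    finally show "simplex_integral (p - 1) (\<lambda>s. g (simplical_face i s) * C i (simplical_face i s)) = - ((-1) ^ i * ?J i)" .
  qed
  also have "?J 0 - (\<Sum>i=1..p. - ((-1) ^ i * ?J i)) = (\<Sum>k\<le>p. (-1) ^ k * ?J k)"
  proof -
    have "{..p} = insert 0 {1..p}" by auto
    then show ?thesis by (simp add: sum_negf)
  qed
  finally show ?thesis .
qed

subsection \<open>Branches of products of powers\<close>

text \<open>The principal logarithm of \<open>f y / f x\<close> is differentiable at
  \<open>y = x\<close>, where the quotient is 1, and \<open>A y - A x\<close> coincides with it once
  continuity forces its imaginary part below \<open>pi\<close>.\<close>

lemma has_derivative_continuous_log: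
  fixes f A :: "'a::real_normed_vector \<Rightarrow> complex"
  assumes f: "(f has_derivative f') (at x)" and A: "isCont A x"
    and eq: "eventually (\<lambda>y. exp (A y) = f y) (nhds x)"
  shows "(A has_derivative (\<lambda>h. f' h / f x)) (at x)"
proof -
  have fx: "exp (A x) = f x" using eventually_nhds_x_imp_x[OF eq] .
  then have fx0: "f x \<noteq> 0" by (metis exp_not_eq_zero)
  have "((\<lambda>y. Ln (f y / f x)) has_derivative (\<lambda>h. f' h / f x)) (at x)"
  proof -
    have 1: "((\<lambda>y. f y / f x) has_derivative (\<lambda>h. f' h / f x)) (at x)"
      using f by (auto intro!: derivative_eq_intros simp: fx0)
    have "(Ln has_field_derivative 1) (at (f x / f x))"
      using has_field_derivative_Ln[of 1] fx0 by simp
    then have "(Ln has_derivative (\<lambda>h. 1 * h)) (at (f x / f x))"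
      unfolding has_field_derivative_def .
    from has_derivative_compose[OF 1 this] show ?thesis by simp
  qed
  from has_derivative_add[OF has_derivative_const this]
  have "((\<lambda>y. A x + Ln (f y / f x)) has_derivative (\<lambda>h. f' h / f x)) (at x)"
    by simp
  moreover have "eventually (\<lambda>y. A x + Ln (f y / f x) = A y) (nhds x)"
  proof -
    have "(A \<longlongrightarrow> A x) (nhds x)"
      using A by (simp add: isCont_def tendsto_at_iff_tendsto_nhds)
    then have "eventually (\<lambda>y. dist (A y) (A x) < pi) (nhds x)"
      by (rule tendstoD) simp
    with eq show ?thesis
    proof eventually_elim
      case (elim y)
      have "\<bar>Im (A y - A x)\<bar> < pi"
        using elim(2) abs_Im_le_cmod[of "A y - A x"] by (simp add: dist_norm)
      then have "Ln (exp (A y - A x)) = A y - A x"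
        by (intro Ln_exp) auto
      then show ?case using elim(1) fx by (simp add: exp_diff)
    qed
  qed
  ultimately show ?thesis
    by (intro has_derivative_transform_eventually[of "\<lambda>y. A x + Ln (f y / f x)" _ x UNIV A])
      (simp_all add: eventually_nhds_conv_at fx0)
qed

lemma has_vector_derivative_continuous_log:
  fixes f A :: "real \<Rightarrow> complex"
  assumes "(f has_vector_derivative f') (at x)" "isCont A x"
    "eventually (\<lambda>y. exp (A y) = f y) (nhds x)"
  shows "(A has_vector_derivative f' / f x) (at x)"
  using has_derivative_continuous_log[OF assms(1)[unfolded has_vector_derivative_def] assms(2,3)]
  by (simp add: has_vector_derivative_def scaleR_conv_of_real)

lemma has_field_derivative_continuous_log:
  fixes f A :: "complex \<Rightarrow> complex"
  assumes "(f has_field_derivative f') (at x)" "isCont A x"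
    "eventually (\<lambda>y. exp (A y) = f y) (nhds x)"
  shows "(A has_field_derivative f' / f x) (at x)"
proof -
  have "(\<lambda>h. f' * h / f x) = (*) (f' / f x)" by auto
  then show ?thesis
    using has_derivative_continuous_log[OF assms(1)[unfolded has_field_derivative_def] assms(2,3)]
    by (simp only: has_field_derivative_def)
qed

text \<open>The logarithms inside \<open>U_branch\<close>, kept apart from the exponents: one choice
  serves \<open>U\<close> and all its products with rational forms. The parameter set
  \<open>S\<close> is a simplex or, for derivatives in \<open>x\<close>, a neighbourhood times a
  simplex.\<close>

definition branch_logs ::
  "nat \<Rightarrow> 's::topological_space set \<Rightarrow> ('s \<Rightarrow> complex ^ 'n::finite) \<Rightarrow> ('s \<Rightarrow> nat \<Rightarrow> complex) \<Rightarrow>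
   (nat \<Rightarrow> 's \<Rightarrow> complex) \<Rightarrow> (nat \<Rightarrow> 's \<Rightarrow> complex) \<Rightarrow> ('n \<Rightarrow> 's \<Rightarrow> complex) \<Rightarrow> bool" where
  "branch_logs p S x t A B C \<longleftrightarrow>
     (\<forall>k\<in>{1..p}. continuous_on S (A k) \<and> continuous_on S (B k) \<and>
        (\<forall>s\<in>S. exp (A k s) = t s k \<and> exp (B k s) = t s (k - 1) - t s k)) \<and>
     (\<forall>i. continuous_on S (C i) \<and> (\<forall>s\<in>S. exp (C i s) = 1 - x s $ i * t s p))"

text \<open>All powers are gathered in one exponential, so that multiplication adds exponents and
  differentiation only meets a linear combination of logarithms.\<close>

definition log_branch ::
  "nat \<Rightarrow> (nat \<Rightarrow> complex) \<Rightarrow> (nat \<Rightarrow> complex) \<Rightarrow> ('n::finite \<Rightarrow> complex) \<Rightarrow>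
   (nat \<Rightarrow> 's \<Rightarrow> complex) \<Rightarrow> (nat \<Rightarrow> 's \<Rightarrow> complex) \<Rightarrow> ('n \<Rightarrow> 's \<Rightarrow> complex) \<Rightarrow> 's \<Rightarrow> complex" where
  "log_branch p a b c A B C s =
     exp ((\<Sum>k=1..p. a k * A k s) + (\<Sum>k=1..p. b k * B k s) + (\<Sum>i\<in>UNIV. c i * C i s))"

text \<open>The coefficients of \<open>\<phi>_0\<close> and \<open>\<phi>_n^(i)\<close> are of this shape, so multiplying \<open>U\<close> by them only
  shifts the exponents of the branch.\<close>

definition monomial_form ::
  "nat \<Rightarrow> complex ^ 'n::finite \<Rightarrow> (nat \<Rightarrow> int) \<Rightarrow> (nat \<Rightarrow> int) \<Rightarrow> ('n \<Rightarrow> int) \<Rightarrow> (nat \<Rightarrow> complex) \<Rightarrow> complex" where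
  "monomial_form p x a b c t = (\<Prod>k=1..p. t k powi a k) * (\<Prod>k=1..p. (t (k - 1) - t k) powi b k) *
     (\<Prod>i\<in>UNIV. (1 - x $ i * t p) powi c i)"

definition U_exponent :: "nat \<Rightarrow> (nat \<Rightarrow> complex) \<Rightarrow> (nat \<Rightarrow> complex) \<Rightarrow> nat \<Rightarrow> complex" where
  "U_exponent p \<alpha> \<gamma> k = (if k = p then \<alpha> p else \<alpha> k - \<gamma> (k + 1))"

abbreviation U_log_branch ::
  "nat \<Rightarrow> (nat \<Rightarrow> complex) \<Rightarrow> (nat \<Rightarrow> complex) \<Rightarrow> ('n::finite \<Rightarrow> complex) \<Rightarrow>
   (nat \<Rightarrow> 's \<Rightarrow> complex) \<Rightarrow> (nat \<Rightarrow> 's \<Rightarrow> complex) \<Rightarrow> ('n \<Rightarrow> 's \<Rightarrow> complex) \<Rightarrow> 's \<Rightarrow> complex" where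
  "U_log_branch p \<alpha> \<gamma> \<beta> \<equiv>
     log_branch p (U_exponent p \<alpha> \<gamma>) (\<lambda>k. \<gamma> k - \<alpha> k) (\<lambda>i. - \<beta> i)"

lemma U_branch_logs:
  assumes "U_branch L \<alpha> \<gamma> \<beta> S x t u" "L \<ge> 2"
  shows "\<exists>A B C. branch_logs (L - 1) S x t A B C \<and>
    (\<forall>s\<in>S. u s = U_log_branch (L - 1) \<alpha> \<gamma> \<beta> A B C s)"
proof -
  obtain A B C where logs: "branch_logs (L - 1) S x t A B C"
    and u: "\<And>s. s \<in> S \<Longrightarrow> u s =
         exp (\<alpha> (L - 1) * A (L - 1) s)
         * (\<Prod>k=1..L-2. exp ((\<alpha> k - \<gamma> (k + 1)) * A k s))
         * (\<Prod>k=1..L-1. exp ((\<gamma> k - \<alpha> k) * B k s))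
         * (\<Prod>i\<in>UNIV. exp (- \<beta> i * C i s))"
    using assms(1) unfolding U_branch_def branch_logs_def by blast
  have ins: "{1..L-1} = insert (L - 1) {1..L-2}" "finite {1..L-2}" "L - 1 \<notin> {1..L-2}"
    using assms(2) by auto
  have 1: "(\<Sum>k=1..L-1. U_exponent (L - 1) \<alpha> \<gamma> k * A k s) =
      \<alpha> (L - 1) * A (L - 1) s + (\<Sum>k=1..L-2. U_exponent (L - 1) \<alpha> \<gamma> k * A k s)" for s
    unfolding ins(1) sum.insert[OF ins(2,3)] by (simp add: U_exponent_def)
  have 2: "(\<Sum>k=1..L-2. U_exponent (L - 1) \<alpha> \<gamma> k * A k s) = (\<Sum>k=1..L-2. (\<alpha> k - \<gamma> (k + 1)) * A k s)" for s
    by (intro sum.cong) (auto simp: U_exponent_def)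
  show ?thesis
  proof (intro exI conjI ballI, rule logs)
    fix s assume "s \<in> S"
    then show "u s = U_log_branch (L - 1) \<alpha> \<gamma> \<beta> A B C s"
      unfolding log_branch_def 1 2 by (simp add: u exp_add exp_sum)
  qed
qed

lemma log_branch_mult:
  "log_branch p a b c A B C s * log_branch p a' b' c' A B C s =
   log_branch p (\<lambda>k. a k + a' k) (\<lambda>k. b k + b' k) (\<lambda>i. c i + c' i) A B C s"
  by (simp add: log_branch_def mult_exp_exp sum.distrib distrib_right algebra_simps)

text \<open>Integer powers do not depend on the choice of a logarithm, so the rational function can
  be written with the very logarithms that define the branch of \<open>U\<close>.\<close>

lemma monomial_form_log_branch:
  assumes "branch_logs p S x t A B C" "s \<in> S"
  shows "monomial_form p (x s) a b c (t s) = log_branch p (\<lambda>k. of_int (a k)) (\<lambda>k. of_int (b k)) (\<lambda>i. of_int (c i)) A B C s"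
proof -
  have "t s k powi a k = exp (of_int (a k) * A k s)"
    "(t s (k - 1) - t s k) powi b k = exp (of_int (b k) * B k s)" if "k \<in> {1..p}" for k
    using assms that by (simp_all add: branch_logs_def exp_power_int[symmetric])
  moreover have "(1 - x s $ i * t s p) powi c i = exp (of_int (c i) * C i s)" for i
    using assms by (simp add: branch_logs_def exp_power_int[symmetric])
  ultimately show ?thesis
    by (simp add: monomial_form_def log_branch_def exp_add exp_sum)
qed

lemma continuous_on_log_branch:
  assumes "branch_logs p S x t A B C"
  shows "continuous_on S (log_branch p a b c A B C)"
  unfolding log_branch_def
  using assms by (intro continuous_on_exp continuous_on_add continuous_on_sum continuous_on_mult continuous_on_const)
    (auto simp: branch_logs_def)

text \<open>The coefficient of \<open>d t_m\<close> in the logarithmic derivative of a branch.\<close>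

definition dlog :: "nat \<Rightarrow> complex ^ 'n::finite \<Rightarrow> (nat \<Rightarrow> complex) \<Rightarrow> (nat \<Rightarrow> complex) \<Rightarrow> ('n \<Rightarrow> complex) \<Rightarrow>
   nat \<Rightarrow> (nat \<Rightarrow> complex) \<Rightarrow> complex" where
  "dlog p x a b c m t = a m / t m - b m / (t (m - 1) - t m) +
     (if m < p then b (m + 1) / (t m - t (m + 1)) else - (\<Sum>i\<in>UNIV. c i * x $ i / (1 - x $ i * t p)))"

abbreviation U_dlog ::
  "nat \<Rightarrow> (nat \<Rightarrow> complex) \<Rightarrow> (nat \<Rightarrow> complex) \<Rightarrow> ('n::finite \<Rightarrow> complex) \<Rightarrow> complex ^ 'n \<Rightarrow>
   (nat \<Rightarrow> int) \<Rightarrow> (nat \<Rightarrow> int) \<Rightarrow> ('n \<Rightarrow> int) \<Rightarrow> nat \<Rightarrow> (nat \<Rightarrow> complex) \<Rightarrow> complex" where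
  "U_dlog p \<alpha> \<gamma> \<beta> x a b d \<equiv> dlog p x (\<lambda>k. U_exponent p \<alpha> \<gamma> k + of_int (a k))
     (\<lambda>k. \<gamma> k - \<alpha> k + of_int (b k)) (\<lambda>i. - \<beta> i + of_int (d i))"

text \<open>The left side sorts the logarithmic derivative by the factors of the product, the right
  side by the differentials dt_m. Each dt_m with m < p occurs in two difference factors, hence the
  index shift; \<open>t' 0 = 0\<close> reflects t_0 = 1.\<close>

lemma dlog_sum:
  assumes "1 \<le> p" "t' 0 = 0"
  shows "(\<Sum>k=1..p. a k * (t' k / t k)) + (\<Sum>k=1..p. b k * ((t' (k - 1) - t' k) / (t (k - 1) - t k))) +
     (\<Sum>i\<in>UNIV. c i * ((- (x $ i) * t' p) / (1 - x $ i * t p))) = (\<Sum>m=1..p. dlog p x a b c m t * t' m)"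
proof -
  have "(\<Sum>k=1..p. b k * (t' (k - 1) / (t (k - 1) - t k))) = (\<Sum>k=1..p-1. b (k + 1) * (t' k / (t k - t (k + 1))))"
  proof -
    have "{1..p} = insert 1 {2..p}" using assms by auto
    then have "(\<Sum>k=1..p. b k * (t' (k - 1) / (t (k - 1) - t k))) = (\<Sum>k=2..p. b k * (t' (k - 1) / (t (k - 1) - t k)))"
      using assms(2) by simp
    also have "\<dots> = (\<Sum>k=1..p-1. b (k + 1) * (t' k / (t k - t (k + 1))))"
      by (rule sum.reindex_bij_witness[where i="\<lambda>k. k + 1" and j="\<lambda>k. k - 1"]) auto
    finally show ?thesis .
  qed
  also have "\<dots> = (\<Sum>m=1..p. (if m < p then b (m + 1) / (t m - t (m + 1)) else 0) * t' m)"
    by (rule sum.mono_neutral_cong_left) auto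
  finally have 1: "(\<Sum>k=1..p. b k * (t' (k - 1) / (t (k - 1) - t k))) =
    (\<Sum>m=1..p. (if m < p then b (m + 1) / (t m - t (m + 1)) else 0) * t' m)" .
  let ?c = "- (\<Sum>i\<in>UNIV. c i * x $ i / (1 - x $ i * t p))"
  have "(\<Sum>i\<in>UNIV. c i * ((- (x $ i) * t' p) / (1 - x $ i * t p))) = ?c * t' p"
    by (simp add: sum_distrib_right sum_negf[symmetric] mult.assoc)
  also have "\<dots> = (\<Sum>m=1..p. if m = p then ?c * t' m else 0)"
    using assms by (subst sum.delta) auto
  also have "\<dots> = (\<Sum>m=1..p. (if m < p then 0 else ?c) * t' m)"
    by (intro sum.cong) auto
  finally have 2: "(\<Sum>i\<in>UNIV. c i * ((- (x $ i) * t' p) / (1 - x $ i * t p))) = (\<Sum>m=1..p. (if m < p then 0 else ?c) * t' m)" .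
  have 3: "(\<Sum>k=1..p. b k * ((t' (k - 1) - t' k) / (t (k - 1) - t k))) =
      (\<Sum>k=1..p. b k * (t' (k - 1) / (t (k - 1) - t k))) - (\<Sum>k=1..p. b k * (t' k / (t (k - 1) - t k)))"
    by (simp add: diff_divide_distrib right_diff_distrib sum_subtractf)
  show ?thesis
    unfolding 3 1 2 sum_subtractf[symmetric] sum.distrib[symmetric]
    by (intro sum.cong refl) (simp add: dlog_def algebra_simps)
qed

lemma isCont_barycentric_upd:
  assumes f: "continuous_on (standard_simplex n) f" and s: "s \<in> open_simplex n" and i: "i \<in> {1..n}"
  shows "isCont (\<lambda>h. f (barycentric n (s(i := h)))) (s i)"
proof -
  have c: "continuous_on UNIV (\<lambda>h. barycentric n (s(i := h)))"
    unfolding barycentric_upd[OF i]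
  proof (rule continuous_on_coordinatewise_then_product)
    fix m show "continuous_on UNIV (\<lambda>h. ((barycentric n s)(i := barycentric n s i + (h - s i),
        0 := barycentric n s 0 - (h - s i))) m)"
      by (cases "m = 0"; cases "m = i") (auto intro!: continuous_intros)
  qed
  have "((\<lambda>h. barycentric n (s(i := h))) \<longlongrightarrow> barycentric n (s(i := s i))) (at (s i))"
    using c unfolding continuous_on_eq_continuous_at[OF open_UNIV] isCont_def by blast
  moreover have "eventually (\<lambda>h. barycentric n (s(i := h)) \<in> standard_simplex n) (at (s i))"
    using eventually_open_simplex_upd[OF s i] unfolding eventually_at_filter
    by eventually_elim (simp add: barycentric_open_simplex)
  ultimately show ?thesis
    unfolding isCont_def
    by (intro continuous_on_tendsto_compose[OF f]) (auto simp: barycentric_open_simplex s)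
qed

text \<open>A continuous logarithm has as derivative that of its argument divided by the argument;
  the exponent is differentiated termwise and \<open>dlog_sum\<close> sorts the result. The
  quotients stay continuous up to the boundary because every factor is an exponential and so never
  0.\<close>

lemma simplex_deriv_log_branch:
  fixes x :: "complex ^ 'n::finite"
  assumes p: "1 \<le> p" and logs: "branch_logs p (standard_simplex n) (\<lambda>_. x) \<sigma> A B C" and i: "i \<in> {1..n}"
    and \<sigma>: "\<And>m. m \<in> {1..p} \<Longrightarrow> simplex_deriv n i (\<lambda>s. \<sigma> s m) (f m)"
    and \<sigma>0: "\<And>s. s \<in> standard_simplex n \<Longrightarrow> \<sigma> s 0 = 1"
  shows "simplex_deriv n i (log_branch p a b c A B C)
    (\<lambda>s. log_branch p a b c A B C s * (\<Sum>m=1..p. dlog p x a b c m (\<sigma> s) * f m s))"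
proof -
  \<comment> \<open>Coordinate 0 is the constant 1 and is not covered by \<open>f\<close>; giving it
    derivative 0 lets the rule for t_(k-1) - t_k hold at k = 1 as well.\<close>
  define f' where "f' k s = (if k = 0 then 0 else f k s)" for k s
  have \<sigma>': "simplex_deriv n i (\<lambda>s. \<sigma> s k) (f' k)" if "k \<le> p" for k
  proof (cases "k = 0")
    case True
    have "((\<lambda>h. \<sigma> (barycentric n (s(i := h))) 0) has_vector_derivative 0) (at (s i))" if s: "s \<in> open_simplex n" for s
    proof (rule has_vector_derivative_eventually_eq)
      show "((\<lambda>h. 1) has_vector_derivative 0) (at (s i))" by simp
      show "eventually (\<lambda>h. 1 = \<sigma> (barycentric n (s(i := h))) 0) (nhds (s i))"
        using eventually_open_simplex_upd[OF s i] by eventually_elim (simp add: \<sigma>0 barycentric_open_simplex)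
    qed
    moreover have "continuous_on (standard_simplex n) (\<lambda>s. \<sigma> s 0)"
      using \<sigma>0 by (simp cong: continuous_on_cong)
    ultimately show ?thesis using True by (simp add: simplex_deriv_def f'_def)
  next
    case False
    then have "f' k = f k" by (simp add: f'_def fun_eq_iff)
    then show ?thesis using \<sigma>[of k] that False by simp
  qed
  have eA: "exp (A k s) = \<sigma> s k" "exp (B k s) = \<sigma> s (k - 1) - \<sigma> s k"
    and cA: "continuous_on (standard_simplex n) (A k)" "continuous_on (standard_simplex n) (B k)"
    if "k \<in> {1..p}" "s \<in> standard_simplex n" for k s
    using logs that unfolding branch_logs_def by blast+
  have eC: "exp (C j s) = 1 - x $ j * \<sigma> s p" and cC: "continuous_on (standard_simplex n) (C j)"
    if "s \<in> standard_simplex n" for j s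
    using logs that unfolding branch_logs_def by blast+
  have nz: "\<sigma> s k \<noteq> 0" "\<sigma> s (k - 1) - \<sigma> s k \<noteq> 0" if "k \<in> {1..p}" "s \<in> standard_simplex n" for k s
    using eA[OF that] by (metis exp_not_eq_zero)+
  have nzC: "1 - x $ j * \<sigma> s p \<noteq> 0" if "s \<in> standard_simplex n" for j s
    using eC[OF that] by (metis exp_not_eq_zero)
  have c\<sigma>: "continuous_on (standard_simplex n) (\<lambda>s. \<sigma> s k)" if "k \<le> p" for k
    using \<sigma>'[OF that] by (simp add: simplex_deriv_def)
  have cf: "continuous_on (standard_simplex n) (f k)" if "k \<in> {1..p}" for k
    using \<sigma>[OF that] by (simp add: simplex_deriv_def)
  show ?thesis
    unfolding simplex_deriv_def
  proof (intro conjI ballI)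
    show "continuous_on (standard_simplex n) (log_branch p a b c A B C)"
      by (rule continuous_on_log_branch[OF logs])
    have "continuous_on (standard_simplex n) (\<lambda>s. dlog p x a b c m (\<sigma> s))" if "m \<in> {1..p}" for m
    proof -
      have m: "m \<le> p" "m - 1 \<le> p" using that by auto
      have 1: "continuous_on (standard_simplex n) (\<lambda>s. a m / \<sigma> s m - b m / (\<sigma> s (m - 1) - \<sigma> s m))"
        by (intro continuous_on_diff continuous_on_divide continuous_on_const c\<sigma> m ballI nz that)
      have 2: "continuous_on (standard_simplex n) (\<lambda>s. b (m + 1) / (\<sigma> s m - \<sigma> s (m + 1)))" if "m < p"
        by (intro continuous_on_diff continuous_on_divide continuous_on_const c\<sigma> m ballI)
           (use nz[of "m + 1"] that in auto)
      have 3: "continuous_on (standard_simplex n) (\<lambda>s. - (\<Sum>j\<in>UNIV. c j * x $ j / (1 - x $ j * \<sigma> s p)))"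
        by (intro continuous_on_minus continuous_on_sum continuous_on_divide continuous_on_diff
            continuous_on_mult continuous_on_const c\<sigma> order_refl ballI nzC)
      show ?thesis
        unfolding dlog_def using 1 2 3 by (cases "m < p") (simp_all only: if_True if_False continuous_on_add)
    qed
    then show "continuous_on (standard_simplex n)
        (\<lambda>s. log_branch p a b c A B C s * (\<Sum>m=1..p. dlog p x a b c m (\<sigma> s) * f m s))"
      by (intro continuous_on_mult continuous_on_sum cf continuous_on_log_branch[OF logs])
    fix s assume s: "s \<in> open_simplex n"
    let ?b = "barycentric n s"
    have b: "?b \<in> standard_simplex n" by (rule barycentric_open_simplex[OF s])
    have ev: "eventually (\<lambda>h. barycentric n (s(i := h)) \<in> standard_simplex n) (nhds (s i))"
      using eventually_open_simplex_upd[OF s i] by eventually_elim (rule barycentric_open_simplex)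
    have d\<sigma>: "((\<lambda>h. \<sigma> (barycentric n (s(i := h))) k) has_vector_derivative f' k ?b) (at (s i))" if "k \<le> p" for k
      using \<sigma>'[OF that] s by (simp add: simplex_deriv_def)
    have dA: "((\<lambda>h. A k (barycentric n (s(i := h)))) has_vector_derivative f' k ?b / \<sigma> ?b k) (at (s i))"
      if k: "k \<in> {1..p}" for k
    proof -
      have "eventually (\<lambda>h. exp (A k (barycentric n (s(i := h)))) = \<sigma> (barycentric n (s(i := h))) k) (nhds (s i))"
        using ev by eventually_elim (rule eA(1)[OF k])
      from has_vector_derivative_continuous_log[OF d\<sigma> isCont_barycentric_upd[OF cA(1)[OF k b] s i] this]
      show ?thesis using k by simp
    qed
    have dB: "((\<lambda>h. B k (barycentric n (s(i := h)))) has_vector_derivative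
       (f' (k - 1) ?b - f' k ?b) / (\<sigma> ?b (k - 1) - \<sigma> ?b k)) (at (s i))"
      if k: "k \<in> {1..p}" for k
    proof -
      have ev': "eventually (\<lambda>h. exp (B k (barycentric n (s(i := h)))) =
          \<sigma> (barycentric n (s(i := h))) (k - 1) - \<sigma> (barycentric n (s(i := h))) k) (nhds (s i))"
        using ev by eventually_elim (rule eA(2)[OF k])
      have k1: "k - 1 \<le> p" "k \<le> p" using k by auto
      from has_vector_derivative_continuous_log[OF has_vector_derivative_diff[OF d\<sigma>[OF k1(1)] d\<sigma>[OF k1(2)]]
          isCont_barycentric_upd[OF cA(2)[OF k b] s i] ev']
      show ?thesis by simp
    qed
    have dC: "((\<lambda>h. C j (barycentric n (s(i := h)))) has_vector_derivative
       (- (x $ j) * f' p ?b) / (1 - x $ j * \<sigma> ?b p)) (at (s i))" for j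
    proof -
      have "eventually (\<lambda>h. exp (C j (barycentric n (s(i := h)))) =
          1 - x $ j * \<sigma> (barycentric n (s(i := h))) p) (nhds (s i))"
        using ev by eventually_elim (rule eC)
      from has_vector_derivative_continuous_log[OF has_vector_derivative_diff[OF has_vector_derivative_const
          has_vector_derivative_mult_right[OF d\<sigma>[OF order_refl]]] isCont_barycentric_upd[OF cC[OF b] s i] this]
      show ?thesis by simp
    qed
    let ?E = "\<lambda>h. (\<Sum>k=1..p. a k * A k (barycentric n (s(i := h)))) + (\<Sum>k=1..p. b k * B k (barycentric n (s(i := h)))) +
        (\<Sum>j\<in>UNIV. c j * C j (barycentric n (s(i := h))))"
    have "(?E has_vector_derivative (\<Sum>k=1..p. a k * (f' k ?b / \<sigma> ?b k)) +
        (\<Sum>k=1..p. b k * ((f' (k - 1) ?b - f' k ?b) / (\<sigma> ?b (k - 1) - \<sigma> ?b k))) +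
        (\<Sum>j\<in>UNIV. c j * ((- (x $ j) * f' p ?b) / (1 - x $ j * \<sigma> ?b p)))) (at (s i))"
      by (intro has_vector_derivative_add has_vector_derivative_sum has_vector_derivative_mult_right dA dB dC)
    also have "(\<Sum>k=1..p. a k * (f' k ?b / \<sigma> ?b k)) +
        (\<Sum>k=1..p. b k * ((f' (k - 1) ?b - f' k ?b) / (\<sigma> ?b (k - 1) - \<sigma> ?b k))) +
        (\<Sum>j\<in>UNIV. c j * ((- (x $ j) * f' p ?b) / (1 - x $ j * \<sigma> ?b p))) =
        (\<Sum>m=1..p. dlog p x a b c m (\<sigma> ?b) * f' m ?b)"
      by (rule dlog_sum[OF p, where t'="\<lambda>k. f' k ?b"]) (simp add: f'_def)
    also have "\<dots> = (\<Sum>m=1..p. dlog p x a b c m (\<sigma> ?b) * f m ?b)"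
      by (intro sum.cong) (auto simp: f'_def)
    finally have E: "(?E has_vector_derivative (\<Sum>m=1..p. dlog p x a b c m (\<sigma> ?b) * f m ?b)) (at (s i))" .
    have "((exp \<circ> ?E) has_vector_derivative (\<Sum>m=1..p. dlog p x a b c m (\<sigma> ?b) * f m ?b) * exp (?E (s i))) (at (s i))"
      by (rule field_vector_diff_chain_at[OF E]) (rule DERIV_exp)
    then show "((\<lambda>h. log_branch p a b c A B C (barycentric n (s(i := h)))) has_vector_derivative
       log_branch p a b c A B C ?b * (\<Sum>m=1..p. dlog p x a b c m (\<sigma> ?b) * f m ?b)) (at (s i))"
      by (simp add: log_branch_def o_def mult.commute)
  qed
qed

subsection \<open>Twisted chains\<close>

text \<open>Regularity that passes from a smooth simplex to its faces and suffices for the Jacobian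
  to extend continuously to the closed simplex, hence to be integrable against continuous
  sections.\<close>

definition C1_simplex :: "nat \<Rightarrow> ((nat \<Rightarrow> real) \<Rightarrow> nat \<Rightarrow> complex) \<Rightarrow> bool" where
  "C1_simplex n \<tau> \<longleftrightarrow> (\<forall>j\<in>{1..n}. \<forall>i\<in>{1..n}. \<exists>f. simplex_deriv n i (\<lambda>u. \<tau> u j) f)"

lemma smooth_on_simplex_C1:
  assumes "smooth_on_simplex n f" "i \<in> {1..n}"
  shows "\<exists>f'. simplex_deriv n i f f'"
  using smooth_on_simplex_derivs[OF assms(1)] assms(2) unfolding simplex_derivs_def by blast

lemma C1_simplex_smooth:
  assumes "\<And>k. smooth_on_simplex n (\<lambda>s. \<sigma> s k)"
  shows "C1_simplex n (\<lambda>u j. \<sigma> u (q j))"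
  unfolding C1_simplex_def using smooth_on_simplex_C1[OF assms] by blast

lemma C1_simplex_face:
  assumes "\<And>k. smooth_on_simplex n (\<lambda>s. \<sigma> s k)" "k \<le> n"
  shows "C1_simplex (n - 1) (\<lambda>u j. \<sigma> (simplical_face k u) (q j))"
  unfolding C1_simplex_def
proof (intro ballI)
  fix j i assume "j \<in> {1..n-1}" and i: "i \<in> {1..n-1}"
  obtain f1 f2 where f: "simplex_derivs n (\<lambda>s. \<sigma> s (q j)) f1 f2"
    using smooth_on_simplex_derivs[OF assms(1)] by blast
  show "\<exists>f. simplex_deriv (n - 1) i (\<lambda>u. \<sigma> (simplical_face k u) (q j)) f"
  proof (cases "k = 0")
    case True
    then show ?thesis using f i unfolding simplex_derivs_def by blast
  next
    case False
    then have "k \<in> {1..n}" using assms(2) by auto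
    then show ?thesis using f i unfolding simplex_derivs_def by blast
  qed
qed

lemma simplex_jacobian_continuous:
  assumes "C1_simplex n \<tau>"
  obtains J where "continuous_on (standard_simplex n) J"
    "\<And>s. s \<in> open_simplex n \<Longrightarrow> simplex_jacobian n \<tau> s = J (barycentric n s)"
proof -
  define f where "f j i = (SOME f. simplex_deriv n i (\<lambda>u. \<tau> u j) f)" for j i
  have f: "simplex_deriv n i (\<lambda>u. \<tau> u j) (f j i)" if "i \<in> {1..n}" "j \<in> {1..n}" for i j
  proof -
    have "\<exists>f. simplex_deriv n i (\<lambda>u. \<tau> u j) f"
      using assms that unfolding C1_simplex_def by blast
    then show ?thesis unfolding f_def by (rule someI_ex)
  qed
  show thesis
  proof (rule that[of "\<lambda>b. leibniz_det n (\<lambda>i j. f j i b)"])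
    have "continuous_on (standard_simplex n) (f j i)" if "i \<in> {1..n}" "j \<in> {1..n}" for i j
      using f[OF that] by (simp add: simplex_deriv_def)
    then show "continuous_on (standard_simplex n) (\<lambda>b. leibniz_det n (\<lambda>i j. f j i b))"
      by (rule continuous_on_leibniz_det[of n _ "\<lambda>i j. f j i"])
    show "simplex_jacobian n \<tau> s = leibniz_det n (\<lambda>i j. f j i (barycentric n s))"
      if "s \<in> open_simplex n" for s
      by (rule simplex_jacobian_eq[of n \<tau> f, OF _ that]) (rule f)
  qed
qed

lemma open_simplex_sets: "open_simplex n \<in> sets (lborel_product {1..n})"
  by (simp add: open_simplex_corner)

lemma set_integrable_jacobian:
  assumes "C1_simplex n \<tau>" "continuous_on (standard_simplex n) v"
  shows "set_integrable (lborel_product {1..n}) (open_simplex n)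
    (\<lambda>s. v (barycentric n s) * simplex_jacobian n \<tau> s)"
proof -
  obtain J where J: "continuous_on (standard_simplex n) J"
    "\<And>s. s \<in> open_simplex n \<Longrightarrow> simplex_jacobian n \<tau> s = J (barycentric n s)"
    using simplex_jacobian_continuous[OF assms(1)] by blast
  have "set_integrable (lborel_product {1..n}) (open_simplex n)
      (\<lambda>s. (\<lambda>b. v b * J b) (barycentric n s))"
    by (intro set_integrable_barycentric continuous_on_mult J assms)
  moreover have "indicator (open_simplex n) s *\<^sub>R (\<lambda>b. v b * J b) (barycentric n s) =
      indicator (open_simplex n) s *\<^sub>R (v (barycentric n s) * simplex_jacobian n \<tau> s)" for s
    by (cases "s \<in> open_simplex n") (simp_all add: J(2))
  ultimately show ?thesis
    unfolding set_integrable_def by (simp only:)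
qed

section \<open>Integrals over chains and Stokes' theorem for chains\<close>

lemma set_integral_sum:
  fixes f :: "'i \<Rightarrow> 'a \<Rightarrow> complex"
  assumes "\<And>i. i \<in> I \<Longrightarrow> set_integrable M S (f i)"
  shows "set_integrable M S (\<lambda>x. \<Sum>i\<in>I. f i x)"
    and "(LINT x:S|M. (\<Sum>i\<in>I. f i x)) = (\<Sum>i\<in>I. LINT x:S|M. f i x)"
proof -
  have int: "integrable M (\<lambda>x. indicator S x *\<^sub>R f i x)" if "i \<in> I" for i
    using assms[OF that] by (simp add: set_integrable_def)
  show "set_integrable M S (\<lambda>x. \<Sum>i\<in>I. f i x)"
    unfolding set_integrable_def scaleR_sum_right by (rule Bochner_Integration.integrable_sum) (rule int)
  show "(LINT x:S|M. (\<Sum>i\<in>I. f i x)) = (\<Sum>i\<in>I. LINT x:S|M. f i x)"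
    unfolding set_lebesgue_integral_def scaleR_sum_right by (rule Bochner_Integration.integral_sum) (rule int)
qed

text \<open>The integral of the form with coefficient \<open>\<psi>\<close> and differentials dt_(q
  1) ... dt_(q n), weighted by the section \<open>v\<close>. The identity \<open>q\<close> gives the
  summands of \<open>twisted_integral\<close>; \<open>skip r\<close> gives the forms without dt_r
  that live on the faces of a cycle.\<close>

definition form_integral ::
  "nat \<Rightarrow> ((nat \<Rightarrow> complex) \<Rightarrow> complex) \<Rightarrow> (nat \<Rightarrow> nat) \<Rightarrow> ((nat \<Rightarrow> real) \<Rightarrow> nat \<Rightarrow> complex) \<Rightarrow>
   ((nat \<Rightarrow> real) \<Rightarrow> complex) \<Rightarrow> complex" where
  "form_integral n \<psi> q \<tau> v = pullback_integral n (\<lambda>u. v u * \<psi> (\<tau> u)) (\<lambda>u j. \<tau> u (q j))"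

lemma twisted_integral_form_integral:
  "twisted_integral p \<psi> c = (\<Sum>\<sigma>\<in>chain_support c. form_integral p \<psi> (\<lambda>j. j) \<sigma> (c \<sigma>))"
  by (simp add: twisted_integral_def form_integral_def)

lemma form_integral_0 [simp]: "form_integral n \<psi> q \<tau> (\<lambda>_. 0) = 0"
  by (simp add: form_integral_def)

lemma twisted_integral_superset:
  assumes "finite G" "chain_support c \<subseteq> G"
  shows "twisted_integral p \<psi> c = (\<Sum>\<sigma>\<in>G. form_integral p \<psi> (\<lambda>j. j) \<sigma> (c \<sigma>))"
  unfolding twisted_integral_form_integral
  by (rule sum.mono_neutral_left[OF assms]) (auto simp: chain_support_def)

text \<open>The coefficient of the boundary at \<open>\<tau>\<close> lumps together all pairs
  \<open>(\<sigma>, k)\<close> whose face is \<open>\<tau>\<close>. Integration is linear in the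
  section, so summing over a finite \<open>G\<close> that contains all faces recovers the sum over
  all pairs.\<close>

lemma boundary_integral:
  assumes n: "1 \<le> n" and fin: "finite (chain_support c)"
    and smooth: "\<And>\<sigma> k. \<sigma> \<in> chain_support c \<Longrightarrow> smooth_on_simplex n (\<lambda>s. \<sigma> s k)"
    and cc: "\<And>\<sigma>. \<sigma> \<in> chain_support c \<Longrightarrow> continuous_on (standard_simplex n) (c \<sigma>)"
    and c\<psi>: "\<And>\<sigma>. \<sigma> \<in> chain_support c \<Longrightarrow> continuous_on (standard_simplex n) (\<lambda>s. \<psi> (\<sigma> s))"
    and G: "finite G" "(\<lambda>(\<sigma>, k). singular_face n k \<sigma>) ` (chain_support c \<times> {..n}) \<subseteq> G"
  shows "(\<Sum>\<tau>\<in>G. form_integral (n - 1) \<psi> q \<tau> (twisted_boundary n c \<tau>)) =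
    (\<Sum>\<sigma>\<in>chain_support c. \<Sum>k\<le>n. (-1) ^ k * pullback_integral (n - 1)
      (\<lambda>u. c \<sigma> (simplical_face k u) * \<psi> (\<sigma> (simplical_face k u))) (\<lambda>u j. \<sigma> (simplical_face k u) (q j)))"
proof -
  define X where "X \<sigma> k = (\<lambda>s. c \<sigma> (simplical_face k (barycentric (n - 1) s)) * \<psi> (\<sigma> (simplical_face k (barycentric (n - 1) s))) *
      simplex_jacobian (n - 1) (\<lambda>u j. \<sigma> (simplical_face k u) (q j)) s)" for \<sigma> k
  have int: "set_integrable (lborel_product {1..n-1}) (open_simplex (n - 1)) (X \<sigma> k)"
    if "\<sigma> \<in> chain_support c" "k \<le> n" for \<sigma> k
    unfolding X_def
    by (rule set_integrable_jacobian[OF C1_simplex_face[OF smooth[OF that(1)] that(2)],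
          of "\<lambda>b. c \<sigma> (simplical_face k b) * \<psi> (\<sigma> (simplical_face k b))"])
       (intro continuous_on_mult continuous_on_simplical_face[OF cc[OF that(1)] n that(2)]
          continuous_on_simplical_face[OF c\<psi>[OF that(1)] n that(2)])
  have "form_integral (n - 1) \<psi> q \<tau> (twisted_boundary n c \<tau>) =
     (\<Sum>\<sigma>\<in>chain_support c. \<Sum>k | k \<le> n \<and> singular_face n k \<sigma> = \<tau>.
        (-1) ^ k * (LINT s:open_simplex (n - 1)|lborel_product {1..n-1}. X \<sigma> k s))" for \<tau>
  proof -
    have "form_integral (n - 1) \<psi> q \<tau> (twisted_boundary n c \<tau>) =
      (LINT s:open_simplex (n - 1)|lborel_product {1..n-1}.
        (\<Sum>\<sigma>\<in>chain_support c. \<Sum>k | k \<le> n \<and> singular_face n k \<sigma> = \<tau>. (-1) ^ k * X \<sigma> k s))"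
      unfolding form_integral_def
    proof (intro set_lebesgue_integral_cong open_simplex_sets allI impI)
      fix s assume s: "s \<in> open_simplex (n - 1)"
      let ?b = "barycentric (n - 1) s"
      have b: "?b \<in> standard_simplex (n - 1)" by (rule barycentric_open_simplex[OF s])
      have X: "c \<sigma> (simplical_face k ?b) * \<psi> (\<tau> ?b) * simplex_jacobian (n - 1) (\<lambda>u j. \<tau> u (q j)) s = X \<sigma> k s"
        if "singular_face n k \<sigma> = \<tau>" for \<sigma> k
      proof -
        have \<tau>: "\<tau> u = \<sigma> (simplical_face k u)" if "u \<in> standard_simplex (n - 1)" for u
          using that by (simp add: \<open>singular_face n k \<sigma> = \<tau>\<close>[symmetric] singular_face_def)
        have "simplex_jacobian (n - 1) (\<lambda>u j. \<tau> u (q j)) s = simplex_jacobian (n - 1) (\<lambda>u j. \<sigma> (simplical_face k u) (q j)) s"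
          by (rule simplex_jacobian_cong[OF _ s]) (simp add: \<tau>)
        then show ?thesis by (simp only: X_def \<tau>[OF b])
      qed
      have "twisted_boundary n c \<tau> ?b * \<psi> (\<tau> ?b) * simplex_jacobian (n - 1) (\<lambda>u j. \<tau> u (q j)) s =
        (\<Sum>\<sigma>\<in>chain_support c. \<Sum>k | k \<le> n \<and> singular_face n k \<sigma> = \<tau>.
          (-1) ^ k * (c \<sigma> (simplical_face k ?b) * \<psi> (\<tau> ?b) * simplex_jacobian (n - 1) (\<lambda>u j. \<tau> u (q j)) s))"
        using b by (simp add: twisted_boundary_def sum_distrib_right mult.assoc)
      also have "\<dots> = (\<Sum>\<sigma>\<in>chain_support c. \<Sum>k | k \<le> n \<and> singular_face n k \<sigma> = \<tau>. (-1) ^ k * X \<sigma> k s)"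
        by (intro sum.cong refl) (simp only: X mem_Collect_eq)
      finally show "twisted_boundary n c \<tau> ?b * \<psi> (\<tau> ?b) * simplex_jacobian (n - 1) (\<lambda>u j. \<tau> u (q j)) s = \<dots>" .
    qed
    also have "\<dots> = (\<Sum>\<sigma>\<in>chain_support c. (LINT s:open_simplex (n - 1)|lborel_product {1..n-1}.
        (\<Sum>k | k \<le> n \<and> singular_face n k \<sigma> = \<tau>. (-1) ^ k * X \<sigma> k s)))"
      using int by (intro set_integral_sum) (auto intro!: set_integral_sum(1) set_integrable_mult_right)
    also have "\<dots> = (\<Sum>\<sigma>\<in>chain_support c. \<Sum>k | k \<le> n \<and> singular_face n k \<sigma> = \<tau>.
        (LINT s:open_simplex (n - 1)|lborel_product {1..n-1}. (-1) ^ k * X \<sigma> k s))"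
      using int by (intro sum.cong refl set_integral_sum(2)) (auto intro!: set_integrable_mult_right)
    finally show ?thesis by simp
  qed
  then have "(\<Sum>\<tau>\<in>G. form_integral (n - 1) \<psi> q \<tau> (twisted_boundary n c \<tau>)) =
    (\<Sum>\<tau>\<in>G. \<Sum>\<sigma>\<in>chain_support c. \<Sum>k | k \<le> n \<and> singular_face n k \<sigma> = \<tau>.
        (-1) ^ k * (LINT s:open_simplex (n - 1)|lborel_product {1..n-1}. X \<sigma> k s))"
    by simp
  also have "\<dots> = (\<Sum>\<sigma>\<in>chain_support c. \<Sum>\<tau>\<in>G. \<Sum>k\<in>{k\<in>{..n}. singular_face n k \<sigma> = \<tau>}.
        (-1) ^ k * (LINT s:open_simplex (n - 1)|lborel_product {1..n-1}. X \<sigma> k s))"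
    by (subst sum.swap) simp
  \<comment> \<open>For fixed \<open>\<sigma>\<close> every \<open>k\<close> belongs to exactly one
    \<open>\<tau>\<close> in \<open>G\<close>, so the grouping by faces dissolves.\<close>
  also have "\<dots> = (\<Sum>\<sigma>\<in>chain_support c. \<Sum>k\<le>n. (-1) ^ k * (LINT s:open_simplex (n - 1)|lborel_product {1..n-1}. X \<sigma> k s))"
    by (intro sum.cong refl sum.group) (use G in auto)
  finally show ?thesis by (simp add: X_def)
qed

lemma stokes_chain:
  assumes n: "1 \<le> n" and fin: "finite (chain_support c)"
    and smooth: "\<And>\<sigma> k. \<sigma> \<in> chain_support c \<Longrightarrow> smooth_on_simplex n (\<lambda>s. \<sigma> s k)"
    and cc: "\<And>\<sigma>. \<sigma> \<in> chain_support c \<Longrightarrow> continuous_on (standard_simplex n) (c \<sigma>)"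
    and c\<psi>: "\<And>\<sigma>. \<sigma> \<in> chain_support c \<Longrightarrow> continuous_on (standard_simplex n) (\<lambda>s. \<psi> (\<sigma> s))"
    and d: "\<And>\<sigma> i. \<sigma> \<in> chain_support c \<Longrightarrow> i \<in> {1..n} \<Longrightarrow> \<exists>g'. simplex_deriv n i (\<lambda>s. c \<sigma> s * \<psi> (\<sigma> s)) g'"
    and G: "finite G" "(\<lambda>(\<sigma>, k). singular_face n k \<sigma>) ` (chain_support c \<times> {..n}) \<subseteq> G"
  shows "(\<Sum>\<tau>\<in>G. form_integral (n - 1) \<psi> q \<tau> (twisted_boundary n c \<tau>)) =
    (\<Sum>\<sigma>\<in>chain_support c.
      jacobian_integral n (\<lambda>u j. if j = 1 then c \<sigma> u * \<psi> (\<sigma> u) else \<sigma> u (q (j - 1))))"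
proof (rule trans[OF boundary_integral[where c=c and \<psi>=\<psi> and n=n and G=G and q=q] sum.cong[OF refl]])
  fix \<sigma> assume \<sigma>: "\<sigma> \<in> chain_support c"
  obtain g' where g': "\<forall>i\<in>{1..n}. simplex_deriv n i (\<lambda>s. c \<sigma> s * \<psi> (\<sigma> s)) (g' i)"
    using bchoice[of "{1..n}" "\<lambda>i g'. simplex_deriv n i (\<lambda>s. c \<sigma> s * \<psi> (\<sigma> s)) g'"] d[OF \<sigma>] by blast
  show "(\<Sum>k\<le>n. (-1) ^ k * pullback_integral (n - 1)
      (\<lambda>u. c \<sigma> (simplical_face k u) * \<psi> (\<sigma> (simplical_face k u))) (\<lambda>u j. \<sigma> (simplical_face k u) (q j))) =
    jacobian_integral n (\<lambda>u j. if j = 1 then c \<sigma> u * \<psi> (\<sigma> u) else \<sigma> u (q (j - 1)))"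
    by (rule stokes_simplex[where p=n and \<sigma>=\<sigma> and q=q and g="\<lambda>s. c \<sigma> s * \<psi> (\<sigma> s)" and g'=g', symmetric])
      (use n smooth[OF \<sigma>] g' in \<open>simp_all only:\<close>)
qed (use n fin smooth cc c\<psi> G in blast)+

lemma simplex_deriv_cong:
  assumes "simplex_deriv n i f f'" "i \<in> {1..n}" "\<And>s. s \<in> standard_simplex n \<Longrightarrow> f s = g s"
    "\<And>s. s \<in> standard_simplex n \<Longrightarrow> f' s = g' s"
  shows "simplex_deriv n i g g'"
  unfolding simplex_deriv_def
proof (intro conjI ballI)
  show "continuous_on (standard_simplex n) g" "continuous_on (standard_simplex n) g'"
    using assms by (auto simp: simplex_deriv_def cong: continuous_on_cong)
  fix s assume s: "s \<in> open_simplex n"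
  have "eventually (\<lambda>h. f (barycentric n (s(i := h))) = g (barycentric n (s(i := h)))) (nhds (s i))"
    using eventually_open_simplex_upd[OF s assms(2)]
    by eventually_elim (rule assms(3)[OF barycentric_open_simplex])
  moreover have "((\<lambda>h. f (barycentric n (s(i := h)))) has_vector_derivative g' (barycentric n s)) (at (s i))"
    using assms(1) s unfolding simplex_deriv_def assms(4)[OF barycentric_open_simplex[OF s], symmetric] by blast
  ultimately show "((\<lambda>h. g (barycentric n (s(i := h)))) has_vector_derivative g' (barycentric n s)) (at (s i))"
    by (rule has_vector_derivative_eventually_eq[rotated])
qed

lemma twisted_chain_section:
  assumes "c \<in> twisted_chains L \<alpha> \<gamma> \<beta> x n" "\<sigma> \<in> chain_support c" "2 \<le> L"
  shows "\<exists>\<kappa> A B C. branch_logs (L - 1) (standard_simplex n) (\<lambda>_. x) \<sigma> A B C \<and>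
    (\<forall>s\<in>standard_simplex n. c \<sigma> s =
       \<kappa> * U_log_branch (L - 1) \<alpha> \<gamma> \<beta> A B C s)"
proof -
  have "twisted_section L \<alpha> \<gamma> \<beta> x n \<sigma> (c \<sigma>)"
    using assms(1,2) unfolding twisted_chains_def by blast
  then obtain \<kappa> u where u: "U_branch L \<alpha> \<gamma> \<beta> (standard_simplex n) (\<lambda>_. x) \<sigma> u"
    and c: "c \<sigma> = (\<lambda>s. if s \<in> standard_simplex n then \<kappa> * u s else 0)"
    unfolding twisted_section_def by blast
  obtain A B C where logs: "branch_logs (L - 1) (standard_simplex n) (\<lambda>_. x) \<sigma> A B C"
    and us: "\<And>s. s \<in> standard_simplex n \<Longrightarrow> u s = U_log_branch (L - 1) \<alpha> \<gamma> \<beta> A B C s"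
    using U_branch_logs[OF u assms(3)] by blast
  show ?thesis
  proof (intro exI conjI ballI, rule logs)
    show "c \<sigma> s = \<kappa> * U_log_branch (L - 1) \<alpha> \<gamma> \<beta> A B C s"
      if "s \<in> standard_simplex n" for s
      using that by (simp only: c us if_True)
  qed
qed

lemma twisted_chainsD:
  assumes "c \<in> twisted_chains L \<alpha> \<gamma> \<beta> x n"
  shows "finite (chain_support c)"
    and "\<And>\<sigma> k. \<sigma> \<in> chain_support c \<Longrightarrow> smooth_on_simplex n (\<lambda>s. \<sigma> s k)"
    and "\<And>\<sigma> s. \<sigma> \<in> chain_support c \<Longrightarrow> s \<in> standard_simplex n \<Longrightarrow> \<sigma> s \<in> T_space L x"
    and "\<And>\<sigma>. \<sigma> \<in> chain_support c \<Longrightarrow> continuous_on (standard_simplex n) \<sigma>"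
proof -
  show "finite (chain_support c)" using assms by (simp add: twisted_chains_def)
  fix \<sigma> assume "\<sigma> \<in> chain_support c"
  then have s: "smooth_simplex n (T_space L x) \<sigma>" using assms by (simp add: twisted_chains_def)
  then show "\<And>k. smooth_on_simplex n (\<lambda>s. \<sigma> s k)" by (simp add: smooth_simplex_def)
  have "continuous_map (top_of_set (standard_simplex n)) (top_of_set (T_space L x)) \<sigma>"
    using s by (simp add: smooth_simplex_def singular_simplex_def euclidean_product_topology)
  then show "continuous_on (standard_simplex n) \<sigma>" "\<And>s. s \<in> standard_simplex n \<Longrightarrow> \<sigma> s \<in> T_space L x"
    by (auto simp: continuous_map_in_subtopology)
qed

text \<open>Up to a constant, a section times a monomial form is again a branch with the same
  logarithms and shifted exponents, so its derivative is read off from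
  \<open>simplex_deriv_log_branch\<close>.\<close>

lemma twisted_form_deriv:
  fixes x :: "complex ^ 'n::finite"
  assumes c: "c \<in> twisted_chains L \<alpha> \<gamma> \<beta> x n" and \<sigma>: "\<sigma> \<in> chain_support c" and L: "2 \<le> L"
    and i: "i \<in> {1..n}" and f: "\<And>m. m \<in> {1..L-1} \<Longrightarrow> simplex_deriv n i (\<lambda>s. \<sigma> s m) (f m)"
  shows "simplex_deriv n i (\<lambda>s. c \<sigma> s * monomial_form (L - 1) x a b d (\<sigma> s))
    (\<lambda>s. c \<sigma> s * monomial_form (L - 1) x a b d (\<sigma> s) *
      (\<Sum>m=1..L-1. U_dlog (L - 1) \<alpha> \<gamma> \<beta> x a b d m (\<sigma> s) * f m s))"
proof -
  obtain \<kappa> A B C where logs: "branch_logs (L - 1) (standard_simplex n) (\<lambda>_. x) \<sigma> A B C"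
    and cs: "\<And>s. s \<in> standard_simplex n \<Longrightarrow> c \<sigma> s =
       \<kappa> * U_log_branch (L - 1) \<alpha> \<gamma> \<beta> A B C s"
    using twisted_chain_section[OF c \<sigma> L] by blast
  have eq: "c \<sigma> s * monomial_form (L - 1) x a b d (\<sigma> s) = \<kappa> * log_branch (L - 1) (\<lambda>k. U_exponent (L - 1) \<alpha> \<gamma> k + of_int (a k))
     (\<lambda>k. \<gamma> k - \<alpha> k + of_int (b k)) (\<lambda>i. - \<beta> i + of_int (d i)) A B C s"
    if "s \<in> standard_simplex n" for s
    using monomial_form_log_branch[OF logs that, of a b d]
    by (simp add: cs[OF that] mult.assoc log_branch_mult)
  have \<sigma>0: "\<sigma> s 0 = 1" if "s \<in> standard_simplex n" for s
    using twisted_chainsD(3)[OF c \<sigma> that] by (simp add: T_space_def)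
  have L1: "1 \<le> L - 1" using L by simp
  show ?thesis
    by (rule simplex_deriv_cong[OF simplex_deriv_cmult[where a=\<kappa>, OF simplex_deriv_log_branch[where f=f
            and a="\<lambda>k. U_exponent (L - 1) \<alpha> \<gamma> k + of_int (a k)" and b="\<lambda>k. \<gamma> k - \<alpha> k + of_int (b k)"
            and c="\<lambda>i. - \<beta> i + of_int (d i)", OF L1 logs i f \<sigma>0]] i])
       (simp_all only: eq mult.assoc)
qed

lemma continuous_on_twisted_section:
  assumes c: "c \<in> twisted_chains L \<alpha> \<gamma> \<beta> x n" and \<sigma>: "\<sigma> \<in> chain_support c" and L: "2 \<le> L"
  shows "continuous_on (standard_simplex n) (c \<sigma>)"
proof -
  obtain \<kappa> A B C where logs: "branch_logs (L - 1) (standard_simplex n) (\<lambda>_. x) \<sigma> A B C"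
    and cs: "\<And>s. s \<in> standard_simplex n \<Longrightarrow> c \<sigma> s =
       \<kappa> * U_log_branch (L - 1) \<alpha> \<gamma> \<beta> A B C s"
    using twisted_chain_section[OF c \<sigma> L] by blast
  have "continuous_on (standard_simplex n) (\<lambda>s. \<kappa> * U_log_branch (L - 1) \<alpha> \<gamma> \<beta> A B C s)"
    by (intro continuous_on_mult continuous_on_const continuous_on_log_branch[OF logs])
  then show ?thesis by (simp add: cs cong: continuous_on_cong)
qed

lemma continuous_on_monomial_form:
  assumes c: "c \<in> twisted_chains L \<alpha> \<gamma> \<beta> x n" and \<sigma>: "\<sigma> \<in> chain_support c" and L: "2 \<le> L"
  shows "continuous_on (standard_simplex n) (\<lambda>s. monomial_form (L - 1) x a b d (\<sigma> s))"
proof -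
  obtain \<kappa> A B C where logs: "branch_logs (L - 1) (standard_simplex n) (\<lambda>_. x) \<sigma> A B C"
    using twisted_chain_section[OF c \<sigma> L] by blast
  have "continuous_on (standard_simplex n) (log_branch (L - 1) (\<lambda>k. of_int (a k)) (\<lambda>k. of_int (b k)) (\<lambda>i. of_int (d i)) A B C)"
    by (rule continuous_on_log_branch[OF logs])
  moreover note monomial_form_log_branch[OF logs, of _ a b d]
  ultimately show ?thesis by (simp cong: continuous_on_cong)
qed

text \<open>Stokes' theorem on a chain \<open>e\<close> bounding \<open>c - c'\<close>. The form has
  top holomorphic degree and is therefore closed: the derivative of its coefficient is a combination
  of dt_1, ..., dt_p, all of which are already present.\<close>

lemma twisted_integral_homologous:
  fixes x :: "complex ^ 'n::finite"
  assumes L: "2 \<le> L" and hom: "(c, c') \<in> twisted_homologous L \<alpha> \<gamma> \<beta> x (L - 1)"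
  shows "twisted_integral (L - 1) (monomial_form (L - 1) x a b d) c =
    twisted_integral (L - 1) (monomial_form (L - 1) x a b d) c'"
proof -
  let ?p = "L - 1"
  let ?n = "Suc ?p"
  let ?\<psi> = "monomial_form ?p x a b d"
  have c: "c \<in> twisted_chains L \<alpha> \<gamma> \<beta> x ?p" and c': "c' \<in> twisted_chains L \<alpha> \<gamma> \<beta> x ?p"
    using hom by (auto simp: twisted_homologous_def twisted_cycles_def)
  obtain e where e: "e \<in> twisted_chains L \<alpha> \<gamma> \<beta> x ?n"
    and de: "twisted_boundary ?n e = (\<lambda>\<sigma> s. c \<sigma> s - c' \<sigma> s)"
    using hom by (auto simp: twisted_homologous_def)
  note eD = twisted_chainsD[OF e]
  define G where "G = (\<lambda>(\<sigma>, k). singular_face ?n k \<sigma>) ` (chain_support e \<times> {..?n}) \<union> chain_support c \<union> chain_support c'"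
  have finG: "finite G"
    unfolding G_def using eD(1) twisted_chainsD(1)[OF c] twisted_chainsD(1)[OF c'] by auto
  have sup: "chain_support c \<subseteq> G" "chain_support c' \<subseteq> G" unfolding G_def by auto
  have int: "set_integrable (lborel_product {1..?p}) (open_simplex ?p)
      (\<lambda>s. c \<tau> (barycentric ?p s) * ?\<psi> (\<tau> (barycentric ?p s)) * simplex_jacobian ?p (\<lambda>u j. \<tau> u j) s)"
    if c: "c \<in> twisted_chains L \<alpha> \<gamma> \<beta> x ?p" for c \<tau>
  proof (cases "\<tau> \<in> chain_support c")
    case True
    show ?thesis
      by (rule set_integrable_jacobian[OF C1_simplex_smooth[OF twisted_chainsD(2)[OF c True]], of "\<lambda>b. c \<tau> b * ?\<psi> (\<tau> b)"])
         (intro continuous_on_mult continuous_on_twisted_section[OF c True L] continuous_on_monomial_form[OF c True L])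
  next
    case False
    then show ?thesis by (simp add: chain_support_def set_integrable_def)
  qed
  \<comment> \<open>The Jacobian has \<open>p + 1\<close> columns but only \<open>p\<close>
    coordinates: expanding column 1 by the chain rule produces, for each \<open>m\<close>, a
    determinant in which the column of t_m occurs twice.\<close>
  have zero: "simplex_jacobian ?n (\<lambda>u j. if j = 1 then e \<sigma> u * ?\<psi> (\<sigma> u) else \<sigma> u (j - 1)) s = 0"
    if \<sigma>: "\<sigma> \<in> chain_support e" and s: "s \<in> open_simplex ?n" for \<sigma> s
  proof -
    define f where "f m i = (SOME f. simplex_deriv ?n i (\<lambda>u. \<sigma> u m) f)" for m i
    have f: "simplex_deriv ?n i (\<lambda>u. \<sigma> u m) (f m i)" if "i \<in> {1..?n}" for m i
      unfolding f_def using smooth_on_simplex_C1[OF eD(2)[OF \<sigma>] that] by (rule someI_ex)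
    define R where "R m t = U_dlog ?p \<alpha> \<gamma> \<beta> x a b d m t" for m t
    define g where "g = (\<lambda>u. e \<sigma> u * ?\<psi> (\<sigma> u))"
    define F where "F j i = (if j = 1 then (\<lambda>s. g s * (\<Sum>m=1..?p. R m (\<sigma> s) * f m i s)) else f (j - 1) i)" for j i
    have g: "simplex_deriv ?n i g (F 1 i)" if "i \<in> {1..?n}" for i
      unfolding g_def F_def R_def
      using twisted_form_deriv[OF e \<sigma> L that f[OF that], of a b d] by simp
    have "simplex_jacobian ?n (\<lambda>u j. if j = 1 then g u else \<sigma> u (j - 1)) s =
      leibniz_det ?n (\<lambda>i j. F j i (barycentric ?n s))"
    proof (rule simplex_jacobian_eq[OF _ s])
      fix i j assume "i \<in> {1..?n}" "j \<in> {1..?n}"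
      then show "simplex_deriv ?n i (\<lambda>u. if j = 1 then g u else \<sigma> u (j - 1)) (F j i)"
        using f[of i "j - 1"] g[of i] by (cases "j = 1") (simp_all add: F_def)
    qed
    also have "\<dots> = (\<Sum>m\<in>{1..?p}. (g (barycentric ?n s) * R m (\<sigma> (barycentric ?n s))) *
        leibniz_det ?n (\<lambda>i j. if j = 1 then f m i (barycentric ?n s) else F j i (barycentric ?n s)))"
      by (rule leibniz_det_linear_first_column) (simp_all add: F_def sum_distrib_left mult.assoc)
    also have "\<dots> = 0"
    proof (intro sum.neutral ballI)
      fix m assume m: "m \<in> {1..?p}"
      have "leibniz_det ?n (\<lambda>i j. if j = 1 then f m i (barycentric ?n s) else F j i (barycentric ?n s)) = 0"
        by (rule leibniz_det_equal_columns[of 1 _ "Suc m"]) (use m in \<open>auto simp: F_def\<close>)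
      then show "(g (barycentric ?n s) * R m (\<sigma> (barycentric ?n s))) *
        leibniz_det ?n (\<lambda>i j. if j = 1 then f m i (barycentric ?n s) else F j i (barycentric ?n s)) = 0"
        by simp
    qed
    finally show ?thesis by (simp only: g_def)
  qed
  have "twisted_integral ?p ?\<psi> c - twisted_integral ?p ?\<psi> c' =
    (\<Sum>\<tau>\<in>G. form_integral ?p ?\<psi> (\<lambda>j. j) \<tau> (c \<tau>) - form_integral ?p ?\<psi> (\<lambda>j. j) \<tau> (c' \<tau>))"
    by (simp only: twisted_integral_superset[OF finG sup(1)] twisted_integral_superset[OF finG sup(2)] sum_subtractf)
  also have "\<dots> = (\<Sum>\<tau>\<in>G. form_integral (?n - 1) ?\<psi> (\<lambda>j. j) \<tau> (twisted_boundary ?n e \<tau>))"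
  proof (intro sum.cong refl)
    fix \<tau>
    show "form_integral ?p ?\<psi> (\<lambda>j. j) \<tau> (c \<tau>) - form_integral ?p ?\<psi> (\<lambda>j. j) \<tau> (c' \<tau>) =
      form_integral (?n - 1) ?\<psi> (\<lambda>j. j) \<tau> (twisted_boundary ?n e \<tau>)"
      unfolding form_integral_def de diff_Suc_1
      by (subst set_integral_diff(2)[symmetric, OF int[OF c] int[OF c']]) (simp add: algebra_simps)
  qed
  also have "\<dots> = (\<Sum>\<sigma>\<in>chain_support e.
      jacobian_integral ?n (\<lambda>u j. if j = 1 then e \<sigma> u * ?\<psi> (\<sigma> u) else \<sigma> u (j - 1)))"
  proof (rule stokes_chain[where q="\<lambda>j. j"])
    show "finite (chain_support e)" by (rule eD(1))
    show "smooth_on_simplex ?n (\<lambda>s. \<sigma> s k)" if "\<sigma> \<in> chain_support e" for \<sigma> k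
      by (rule eD(2)[OF that])
    fix \<sigma> i assume \<sigma>: "\<sigma> \<in> chain_support e" and i: "i \<in> {1..?n}"
    define f where "f m = (SOME f. simplex_deriv ?n i (\<lambda>u. \<sigma> u m) f)" for m
    have "simplex_deriv ?n i (\<lambda>u. \<sigma> u m) (f m)" for m
      unfolding f_def using smooth_on_simplex_C1[OF eD(2)[OF \<sigma>] i] by (rule someI_ex)
    from twisted_form_deriv[OF e \<sigma> L i this, of a b d]
    show "\<exists>g'. simplex_deriv ?n i (\<lambda>s. e \<sigma> s * ?\<psi> (\<sigma> s)) g'" by blast
  next
    show "continuous_on (standard_simplex ?n) (e \<sigma>)" if "\<sigma> \<in> chain_support e" for \<sigma>
      by (rule continuous_on_twisted_section[OF e that L])
    show "continuous_on (standard_simplex ?n) (\<lambda>s. ?\<psi> (\<sigma> s))" if "\<sigma> \<in> chain_support e" for \<sigma>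
      by (rule continuous_on_monomial_form[OF e that L])
    show "(\<lambda>(\<sigma>, k). singular_face ?n k \<sigma>) ` (chain_support e \<times> {..?n}) \<subseteq> G"
      unfolding G_def by blast
  qed (use finG in simp_all)
  also have "\<dots> = (\<Sum>\<sigma>\<in>chain_support e. LINT s:open_simplex ?n|lborel_product {1..?n}. 0)"
    by (intro sum.cong refl set_lebesgue_integral_cong open_simplex_sets allI impI zero)
  finally show ?thesis by simp
qed

text \<open>Stokes' theorem for the cycle \<open>c\<close> and the form with coefficient
  \<open>U * \<psi> * t r\<close> and all differentials except dt_r, where \<open>\<psi>\<close> is
  the monomial form. Of its exterior derivative only the dt_r part survives, and the derivative of
  \<open>U * \<psi> * t r\<close> in t_r is \<open>U * \<psi>\<close> times the stated
  bracket.\<close>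

lemma twisted_integral_exact:
  fixes x :: "complex ^ 'n::finite"
  assumes L: "2 \<le> L" and cyc: "c \<in> twisted_cycles L \<alpha> \<gamma> \<beta> x (L - 1)" and r: "r \<in> {1..L-1}"
  shows "twisted_integral (L - 1) (\<lambda>t. monomial_form (L - 1) x a b d t * (1 + t r *
      U_dlog (L - 1) \<alpha> \<gamma> \<beta> x a b d r t)) c = 0"
proof -
  let ?p = "L - 1"
  let ?\<psi> = "monomial_form ?p x a b d"
  let ?\<psi>r = "\<lambda>t. ?\<psi> t * t r"
  let ?q = "skip r"
  have c: "c \<in> twisted_chains L \<alpha> \<gamma> \<beta> x ?p" and dc: "twisted_boundary ?p c = (\<lambda>_ _. 0)"
    using cyc by (auto simp: twisted_cycles_def)
  note cD = twisted_chainsD[OF c]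
  define R where "R m t = U_dlog ?p \<alpha> \<gamma> \<beta> x a b d m t" for m t
  have p: "1 \<le> ?p" using L by simp
  define G where "G = (\<lambda>(\<sigma>, k). singular_face ?p k \<sigma>) ` (chain_support c \<times> {..?p})"
  \<comment> \<open>The term that is 1 at \<open>m = r\<close> comes from the factor
    \<open>t r\<close>; the rest is the logarithmic derivative of the branch.\<close>
  have deriv: "simplex_deriv ?p i (\<lambda>s. c \<sigma> s * ?\<psi>r (\<sigma> s))
      (\<lambda>s. c \<sigma> s * ?\<psi> (\<sigma> s) * (\<Sum>m=1..?p. (\<sigma> s r * R m (\<sigma> s) + (if m = r then 1 else 0)) * f m s))"
    if \<sigma>: "\<sigma> \<in> chain_support c" and i: "i \<in> {1..?p}" and f: "\<And>m. simplex_deriv ?p i (\<lambda>u. \<sigma> u m) (f m)" for \<sigma> i f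
  proof -
    have "(\<Sum>m=1..?p. (\<sigma> s r * R m (\<sigma> s) + (if m = r then 1 else 0)) * f m s) =
      \<sigma> s r * (\<Sum>m=1..?p. R m (\<sigma> s) * f m s) + f r s" for s
    proof -
      have "(\<Sum>m=1..?p. (\<sigma> s r * R m (\<sigma> s) + (if m = r then 1 else 0)) * f m s) =
        (\<Sum>m=1..?p. \<sigma> s r * (R m (\<sigma> s) * f m s) + (if m = r then f m s else 0))"
        by (intro sum.cong refl) (simp add: algebra_simps)
      then show ?thesis using r by (simp add: sum.distrib sum_distrib_left)
    qed
    then show ?thesis
      using simplex_deriv_mult[OF twisted_form_deriv[OF c \<sigma> L i f, of a b d] f[of r]]
      by (simp add: R_def algebra_simps)
  qed
  \<comment> \<open>The sign picked up by moving dt_r from the front to its place among dt_1, ...,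
    dt_p; being non-zero, it drops out of the final equation.\<close>
  define \<epsilon> where "\<epsilon> = (of_int (sign (first_cycle r)) :: complex)"
  have \<epsilon>: "\<epsilon> \<noteq> 0" by (simp add: \<epsilon>_def sign_def)
  have jac: "simplex_jacobian ?p (\<lambda>u j. if j = 1 then c \<sigma> u * ?\<psi>r (\<sigma> u) else \<sigma> u (?q (j - 1))) s =
      \<epsilon> * (c \<sigma> (barycentric ?p s) * (?\<psi> (\<sigma> (barycentric ?p s)) * (1 + \<sigma> (barycentric ?p s) r * R r (\<sigma> (barycentric ?p s))))
        * simplex_jacobian ?p \<sigma> s)"
    if \<sigma>: "\<sigma> \<in> chain_support c" and s: "s \<in> open_simplex ?p" for \<sigma> s
  proof -
    define f where "f m i = (SOME f. simplex_deriv ?p i (\<lambda>u. \<sigma> u m) f)" for m i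
    have f: "simplex_deriv ?p i (\<lambda>u. \<sigma> u m) (f m i)" if "i \<in> {1..?p}" for m i
      unfolding f_def using smooth_on_simplex_C1[OF cD(2)[OF \<sigma>] that] by (rule someI_ex)
    define h where "h = (\<lambda>u. c \<sigma> u * ?\<psi> (\<sigma> u))"
    let ?b = "barycentric ?p s"
    define F where "F j i = (if j = 1 then
        (\<lambda>s. h s * (\<Sum>m=1..?p. (\<sigma> s r * R m (\<sigma> s) + (if m = r then 1 else 0)) * f m i s)) else f (?q (j - 1)) i)" for j i
    have "simplex_jacobian ?p (\<lambda>u j. if j = 1 then c \<sigma> u * ?\<psi>r (\<sigma> u) else \<sigma> u (?q (j - 1))) s =
      leibniz_det ?p (\<lambda>i j. F j i ?b)"
    proof (rule simplex_jacobian_eq[OF _ s])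
      fix i j assume i: "i \<in> {1..?p}" and "j \<in> {1..?p}"
      then show "simplex_deriv ?p i (\<lambda>u. if j = 1 then c \<sigma> u * ?\<psi>r (\<sigma> u) else \<sigma> u (?q (j - 1))) (F j i)"
        using f[OF i, of "?q (j - 1)"] deriv[OF \<sigma> i f[OF i]]
        by (cases "j = 1") (simp_all add: F_def h_def)
    qed
    also have "\<dots> = (\<Sum>m\<in>{1..?p}. (h ?b * (\<sigma> ?b r * R m (\<sigma> ?b) + (if m = r then 1 else 0))) *
        leibniz_det ?p (\<lambda>i j. if j = 1 then f m i ?b else F j i ?b))"
      by (rule leibniz_det_linear_first_column[OF p]) (simp add: F_def sum_distrib_left mult.assoc)
    also have "\<dots> = (\<Sum>m\<in>{1..?p}. if m = r then
        h ?b * (1 + \<sigma> ?b r * R r (\<sigma> ?b)) * (\<epsilon> * simplex_jacobian ?p \<sigma> s) else 0)"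
    proof (intro sum.cong refl)
      fix m assume m: "m \<in> {1..?p}"
      show "(h ?b * (\<sigma> ?b r * R m (\<sigma> ?b) + (if m = r then 1 else 0))) *
          leibniz_det ?p (\<lambda>i j. if j = 1 then f m i ?b else F j i ?b) =
        (if m = r then h ?b * (1 + \<sigma> ?b r * R r (\<sigma> ?b)) * (\<epsilon> * simplex_jacobian ?p \<sigma> s) else 0)"
      proof (cases "m = r")
        case True
        have perm: "first_cycle r permutes {1..?p}"
          using first_cycle[of r] r by (auto intro: permutes_subset)
        have "leibniz_det ?p (\<lambda>i j. if j = 1 then f m i ?b else F j i ?b) =
          leibniz_det ?p (\<lambda>i j. (\<lambda>i j. f j i ?b) i (first_cycle r j))"
        proof (rule leibniz_det_cong)
          fix i j assume "j \<in> {1..?p}"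
          then show "(if j = 1 then f m i ?b else F j i ?b) = f (first_cycle r j) i ?b"
            using first_cycle_skip[of "j - 1" r] r True
            by (cases "j = 1") (auto simp: F_def first_cycle_def)
        qed
        also have "\<dots> = \<epsilon> * leibniz_det ?p (\<lambda>i j. f j i ?b)"
          unfolding \<epsilon>_def by (rule leibniz_det_permute_columns[OF perm])
        also have "leibniz_det ?p (\<lambda>i j. f j i ?b) = simplex_jacobian ?p \<sigma> s"
          by (rule simplex_jacobian_eq[OF _ s, symmetric]) (rule f)
        finally show ?thesis using True by (simp add: add.commute)
      next
        case False
        \<comment> \<open>For \<open>m\<close> different from \<open>r\<close> the differential dt_m
          is among those kept by \<open>skip r\<close>, so two columns coincide.\<close>
        have "m \<in> skip r ` {1..?p-1}"
          unfolding bij_betw_imp_surj_on[OF bij_betw_skip[OF r]] using m False by blast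
        then obtain l where l: "l \<in> {1..?p-1}" "skip r l = m" by blast
        have "leibniz_det ?p (\<lambda>i j. if j = 1 then f m i ?b else F j i ?b) = 0"
          by (rule leibniz_det_equal_columns[of 1 _ "Suc l"]) (use l in \<open>auto simp: F_def\<close>)
        then show ?thesis using False by simp
      qed
    qed
    also have "\<dots> = h ?b * (1 + \<sigma> ?b r * R r (\<sigma> ?b)) * (\<epsilon> * simplex_jacobian ?p \<sigma> s)"
      using r by simp
    finally show ?thesis by (simp add: h_def algebra_simps)
  qed
  have "0 = (\<Sum>\<tau>\<in>G. form_integral (?p - 1) ?\<psi>r ?q \<tau> (twisted_boundary ?p c \<tau>))"
    by (simp only: dc form_integral_0 sum.neutral_const)
  also have "\<dots> = (\<Sum>\<sigma>\<in>chain_support c.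
      jacobian_integral ?p (\<lambda>u j. if j = 1 then c \<sigma> u * ?\<psi>r (\<sigma> u) else \<sigma> u (?q (j - 1))))"
  proof (rule stokes_chain)
    show "1 \<le> ?p" by (rule p)
    show "finite (chain_support c)" by (rule cD(1))
    show "smooth_on_simplex ?p (\<lambda>s. \<sigma> s k)" if "\<sigma> \<in> chain_support c" for \<sigma> k
      by (rule cD(2)[OF that])
    fix \<sigma> assume \<sigma>: "\<sigma> \<in> chain_support c"
    show "continuous_on (standard_simplex ?p) (c \<sigma>)" by (rule continuous_on_twisted_section[OF c \<sigma> L])
    show "continuous_on (standard_simplex ?p) (\<lambda>s. ?\<psi>r (\<sigma> s))"
      by (rule continuous_on_mult[OF continuous_on_monomial_form[OF c \<sigma> L]
          continuous_on_product_then_coordinatewise[OF cD(4)[OF \<sigma>]]])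
    fix i assume i: "i \<in> {1..?p}"
    define f where "f m = (SOME f. simplex_deriv ?p i (\<lambda>u. \<sigma> u m) f)" for m
    have "simplex_deriv ?p i (\<lambda>u. \<sigma> u m) (f m)" for m
      unfolding f_def using smooth_on_simplex_C1[OF cD(2)[OF \<sigma>] i] by (rule someI_ex)
    from deriv[OF \<sigma> i this]
    show "\<exists>g'. simplex_deriv ?p i (\<lambda>s. c \<sigma> s * ?\<psi>r (\<sigma> s)) g'" by blast
  next
    show "finite G" unfolding G_def using cD(1) by simp
    show "(\<lambda>(\<sigma>, k). singular_face ?p k \<sigma>) ` (chain_support c \<times> {..?p}) \<subseteq> G"
      unfolding G_def by (rule order_refl)
  qed
  also have "\<dots> = (\<Sum>\<sigma>\<in>chain_support c. LINT s:open_simplex ?p|lborel_product {1..?p}.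
      \<epsilon> * (c \<sigma> (barycentric ?p s) * (?\<psi> (\<sigma> (barycentric ?p s)) * (1 + \<sigma> (barycentric ?p s) r * R r (\<sigma> (barycentric ?p s))))
        * simplex_jacobian ?p \<sigma> s))"
  proof (rule sum.cong[OF refl], rule set_lebesgue_integral_cong[OF open_simplex_sets], intro allI impI)
    fix \<sigma> s assume "\<sigma> \<in> chain_support c" "s \<in> open_simplex ?p"
    then show "simplex_jacobian ?p (\<lambda>u j. if j = 1 then c \<sigma> u * ?\<psi>r (\<sigma> u) else \<sigma> u (?q (j - 1))) s =
      \<epsilon> * (c \<sigma> (barycentric ?p s) * (?\<psi> (\<sigma> (barycentric ?p s)) * (1 + \<sigma> (barycentric ?p s) r * R r (\<sigma> (barycentric ?p s))))
        * simplex_jacobian ?p \<sigma> s)"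
      by (rule jac)
  qed
  also have "\<dots> = \<epsilon> * twisted_integral ?p (\<lambda>t. ?\<psi> t * (1 + t r * R r t)) c"
    unfolding twisted_integral_def sum_distrib_left set_integral_mult_right ..
  finally have "twisted_integral ?p (\<lambda>t. ?\<psi> t * (1 + t r * R r t)) c = 0"
    using \<epsilon> by simp
  then show ?thesis unfolding R_def .
qed

subsection \<open>Differentiation under the integral\<close>

text \<open>On the compact product of disc and simplex \<open>G'\<close> is bounded by some
  \<open>K\<close>; convexity of the disc turns this into a bound on the difference quotients, and
  dominated convergence applies along every sequence tending to \<open>z0\<close>.\<close>

lemma simplex_integral_has_field_derivative:
  assumes r: "0 < r"
    and G: "\<And>z s. z \<in> cball z0 r \<Longrightarrow> s \<in> standard_simplex p \<Longrightarrow> ((\<lambda>z. G z s) has_field_derivative G' z s) (at z)"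
    and cG: "\<And>z. z \<in> cball z0 r \<Longrightarrow> continuous_on (standard_simplex p) (G z)"
    and cG': "continuous_on (cball z0 r \<times> standard_simplex p) (\<lambda>(z, s). G' z s)"
  shows "((\<lambda>z. simplex_integral p (G z)) has_field_derivative simplex_integral p (G' z0)) (at z0)"
proof -
  have "compact (cball z0 r \<times> standard_simplex p)"
    by (intro compact_Times compact_cball compact_standard_simplex)
  then have "bounded ((\<lambda>(z, s). G' z s) ` (cball z0 r \<times> standard_simplex p))"
    by (intro compact_imp_bounded compact_continuous_image cG')
  then obtain K where K: "\<And>z s. z \<in> cball z0 r \<Longrightarrow> s \<in> standard_simplex p \<Longrightarrow> norm (G' z s) \<le> K"
    unfolding bounded_iff by fastforce
  have z0: "z0 \<in> cball z0 r" using r by simp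
  let ?M = "lborel_product {1..p}"
  let ?S = "open_simplex p"
  let ?b = "barycentric p"
  have Q: "((\<lambda>z. (simplex_integral p (G z) - simplex_integral p (G z0)) / (z - z0)) \<longlongrightarrow> simplex_integral p (G' z0)) (at z0 within ball z0 r)"
    unfolding tendsto_at_iff_sequentially
  proof (intro allI impI)
    fix X :: "nat \<Rightarrow> complex"
    assume X: "\<forall>i. X i \<in> ball z0 r - {z0}" and lim: "X \<longlonglongrightarrow> z0"
    have Xc: "X n \<in> cball z0 r" and Xz: "X n \<noteq> z0" for n using X by (auto simp: less_imp_le)
    define q where "q n s = (G (X n) s - G z0 s) / (X n - z0)" for n s
    have cq: "continuous_on (standard_simplex p) (q n)" for n
      unfolding q_def using Xz by (intro continuous_on_divide continuous_on_diff cG Xc z0 continuous_on_const) auto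
    have eq: "(simplex_integral p (G (X n)) - simplex_integral p (G z0)) / (X n - z0) =
        (LINT s|?M. indicator ?S s *\<^sub>R q n (?b s))" for n
    proof -
      have "(\<lambda>s. q n s) = (\<lambda>s. (1 / (X n - z0)) * (G (X n) s - G z0 s))" by (auto simp: q_def)
      then have "simplex_integral p (\<lambda>s. q n s) = (1 / (X n - z0)) * simplex_integral p (\<lambda>s. G (X n) s - G z0 s)"
        by (simp only: simplex_integral_cmult)
      also have "\<dots> = (simplex_integral p (G (X n)) - simplex_integral p (G z0)) / (X n - z0)"
        by (simp add: simplex_integral_diff[OF cG[OF Xc] cG[OF z0]])
      finally show ?thesis by (simp add: simplex_integral_def set_lebesgue_integral_def)
    qed
    have cG0: "continuous_on (standard_simplex p) (G' z0)"
    proof -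
      have "continuous_on (standard_simplex p) (\<lambda>s. (z0, s))"
        by (intro continuous_on_Pair continuous_on_const continuous_on_id)
      moreover have "(\<lambda>s. (z0, s)) ` standard_simplex p \<subseteq> cball z0 r \<times> standard_simplex p"
        using z0 by blast
      ultimately have "continuous_on (standard_simplex p) (\<lambda>s. (\<lambda>(z, s). G' z s) (z0, s))"
        by (rule continuous_on_compose2[OF cG'])
      then show ?thesis by simp
    qed
    have "(\<lambda>n. LINT s|?M. indicator ?S s *\<^sub>R q n (?b s)) \<longlonglongrightarrow> (LINT s|?M. indicator ?S s *\<^sub>R G' z0 (?b s))"
    proof (rule integral_dominated_convergence)
      show "(\<lambda>s. indicator ?S s *\<^sub>R G' z0 (?b s)) \<in> borel_measurable ?M"
        using set_integrable_barycentric[OF cG0] by (auto simp: set_integrable_def)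
      show "(\<lambda>s. indicator ?S s *\<^sub>R q n (?b s)) \<in> borel_measurable ?M" for n
        using set_integrable_barycentric[OF cq] by (auto simp: set_integrable_def)
      show "integrable ?M (\<lambda>s. indicator ?S s *\<^sub>R K)"
        using emeasure_corner_simplex[of "{1..p}"] open_simplex_sets[of p] by (auto simp: open_simplex_corner)
      show "AE s in ?M. (\<lambda>n. indicator ?S s *\<^sub>R q n (?b s)) \<longlonglongrightarrow> indicator ?S s *\<^sub>R G' z0 (?b s)"
      proof (intro AE_I2)
        fix s
        show "(\<lambda>n. indicator ?S s *\<^sub>R q n (?b s)) \<longlonglongrightarrow> indicator ?S s *\<^sub>R G' z0 (?b s)"
        proof (cases "s \<in> ?S")
          case True
          then have "((\<lambda>z. G z (?b s)) has_field_derivative G' z0 (?b s)) (at z0)"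
            by (intro G z0 barycentric_open_simplex)
          then have "((\<lambda>z. (G z (?b s) - G z0 (?b s)) / (z - z0)) \<longlongrightarrow> G' z0 (?b s)) (at z0)"
            by (simp add: has_field_derivative_iff)
          then have "((\<lambda>z. (G z (?b s) - G z0 (?b s)) / (z - z0)) \<circ> X) \<longlonglongrightarrow> G' z0 (?b s)"
            using lim Xz unfolding tendsto_at_iff_sequentially by blast
          then show ?thesis using True by (simp add: q_def o_def)
        qed simp
      qed
      show "AE s in ?M. norm (indicator ?S s *\<^sub>R q n (?b s)) \<le> indicator ?S s *\<^sub>R K" for n
      proof (intro AE_I2)
        fix s
        show "norm (indicator ?S s *\<^sub>R q n (?b s)) \<le> indicator ?S s *\<^sub>R K"
        proof (cases "s \<in> ?S")
          case True
          then have b: "?b s \<in> standard_simplex p" by (rule barycentric_open_simplex)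
          have "norm (G (X n) (?b s) - G z0 (?b s)) \<le> K * norm (X n - z0)"
            by (rule field_differentiable_bound[OF convex_cball[of z0 r] has_field_derivative_at_within[OF G[OF _ b]] K[OF _ b] Xc z0])
          then show ?thesis using True Xz[of n] by (simp add: q_def norm_divide field_simps)
        qed simp
      qed
    qed
    then show "((\<lambda>z. (simplex_integral p (G z) - simplex_integral p (G z0)) / (z - z0)) \<circ> X) \<longlonglongrightarrow> simplex_integral p (G' z0)"
      by (simp add: o_def eq simplex_integral_def[of p "G' z0"] set_lebesgue_integral_def)
  qed
  have "at z0 within ball z0 r = at z0" using r by (intro at_within_open) auto
  then show ?thesis using Q by (simp add: has_field_derivative_iff)
qed

section \<open>Non-vanishing on \<open>T_space\<close> and linearity of twisted integrals\<close>

lemma T_spaceD: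
  assumes "t \<in> T_space L x"
  shows "t 0 = 1" "\<And>k. k \<in> {1..L-1} \<Longrightarrow> t k \<noteq> 0" "\<And>k. k \<in> {1..L-1} \<Longrightarrow> t (k - 1) - t k \<noteq> 0"
    "\<And>i. 1 - x $ i * t (L - 1) \<noteq> 0"
proof -
  show "1 - x $ i * t (L - 1) \<noteq> 0" for i
  proof
    assume "1 - x $ i * t (L - 1) = 0"
    then have 1: "x $ i * t (L - 1) = 1" by simp
    then have "x $ i \<noteq> 0" by auto
    with 1 have "t (L - 1) = 1 / x $ i" by (simp add: field_simps)
    moreover have "t (L - 1) \<noteq> 1 / x $ i" using assms unfolding T_space_def by blast
    ultimately show False by contradiction
  qed
  show "t (k - 1) - t k \<noteq> 0" if "k \<in> {1..L-1}" for k
  proof -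
    have "t k \<noteq> t (k - 1)" using assms that unfolding T_space_def by blast
    then show ?thesis by simp
  qed
qed (use assms in \<open>auto simp: T_space_def\<close>)

lemma twisted_integral_cong:
  assumes "c \<in> twisted_chains L \<alpha> \<gamma> \<beta> x p" "\<And>t. t \<in> T_space L x \<Longrightarrow> \<psi> t = \<psi>' t"
  shows "twisted_integral p \<psi> c = twisted_integral p \<psi>' c"
  unfolding twisted_integral_def
  using twisted_chainsD(3)[OF assms(1) _ barycentric_open_simplex] assms(2)
  by (intro sum.cong refl set_lebesgue_integral_cong open_simplex_sets) simp

lemma twisted_integral_cmult: "twisted_integral p (\<lambda>t. a * \<psi> t) c = a * twisted_integral p \<psi> c"
proof -
  have "(\<lambda>s. c \<sigma> (barycentric p s) * (a * \<psi> (\<sigma> (barycentric p s))) * simplex_jacobian p \<sigma> s) =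
    (\<lambda>s. a * (c \<sigma> (barycentric p s) * \<psi> (\<sigma> (barycentric p s)) * simplex_jacobian p \<sigma> s))" for \<sigma>
    by (simp add: fun_eq_iff)
  then show ?thesis by (simp add: twisted_integral_def sum_distrib_left)
qed

lemma twisted_integral_sum:
  assumes L: "2 \<le> L" and c: "c \<in> twisted_chains L \<alpha> \<gamma> \<beta> x p"
    and \<psi>: "\<And>i. i \<in> I \<Longrightarrow> continuous_on (T_space L x) (\<psi> i)"
  shows "twisted_integral p (\<lambda>t. \<Sum>i\<in>I. \<psi> i t) c = (\<Sum>i\<in>I. twisted_integral p (\<psi> i) c)"
proof -
  have "twisted_integral p (\<lambda>t. \<Sum>i\<in>I. \<psi> i t) c =
    (\<Sum>\<sigma>\<in>chain_support c. \<Sum>i\<in>I. LINT s:open_simplex p|lborel_product {1..p}.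
      c \<sigma> (barycentric p s) * \<psi> i (\<sigma> (barycentric p s)) * simplex_jacobian p \<sigma> s)"
    unfolding twisted_integral_def sum_distrib_left sum_distrib_right
  proof (intro sum.cong refl set_integral_sum(2))
    fix \<sigma> i assume \<sigma>: "\<sigma> \<in> chain_support c" and i: "i \<in> I"
    have "continuous_on (standard_simplex p) (\<lambda>b. \<psi> i (\<sigma> b))"
      by (rule continuous_on_compose2[OF \<psi>[OF i] twisted_chainsD(4)[OF c \<sigma>]])
         (use twisted_chainsD(3)[OF c \<sigma>] in blast)
    then have "continuous_on (standard_simplex p) (\<lambda>b. c \<sigma> b * \<psi> i (\<sigma> b))"
      by (intro continuous_on_mult continuous_on_twisted_section[OF c \<sigma> L])
    from set_integrable_jacobian[OF C1_simplex_smooth[where q="\<lambda>j. j", OF twisted_chainsD(2)[OF c \<sigma>]] this]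
    show "set_integrable (lborel_product {1..p}) (open_simplex p)
      (\<lambda>s. c \<sigma> (barycentric p s) * \<psi> i (\<sigma> (barycentric p s)) * simplex_jacobian p \<sigma> s)" .
  qed
  also have "\<dots> = (\<Sum>i\<in>I. twisted_integral p (\<psi> i) c)"
    unfolding twisted_integral_def by (rule sum.swap)
  finally show ?thesis .
qed

lemma twisted_integral_add:
  assumes "2 \<le> L" "c \<in> twisted_chains L \<alpha> \<gamma> \<beta> x p"
    "continuous_on (T_space L x) \<psi>" "continuous_on (T_space L x) \<psi>'"
  shows "twisted_integral p (\<lambda>t. \<psi> t + \<psi>' t) c = twisted_integral p \<psi> c + twisted_integral p \<psi>' c"
  using twisted_integral_sum[OF assms(1,2), of "{True, False}" "\<lambda>b. if b then \<psi> else \<psi>'"] assms(3,4)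
  by auto

section \<open>The rational forms and the scaling field\<close>

lemma phi0_monomial_form:
  assumes "2 \<le> L"
  shows "phi0 L = monomial_form (L - 1) x (\<lambda>k. if k = L - 1 then -1 else 0) (\<lambda>_. -1) (\<lambda>_. 0)"
proof
  fix t :: "nat \<Rightarrow> complex"
  have "(\<Prod>k=1..L-1. t k powi (if k = L - 1 then -1 else 0)) = (\<Prod>k=1..L-1. if k = L - 1 then inverse (t k) else 1)"
    by (intro prod.cong refl) (simp add: power_int_minus)
  also have "\<dots> = inverse (t (L - 1))" using assms by (subst prod.delta) auto
  finally show "phi0 L t = monomial_form (L - 1) x (\<lambda>k. if k = L - 1 then -1 else 0) (\<lambda>_. -1) (\<lambda>_. 0) t"
    by (simp add: phi0_def monomial_form_def power_int_minus divide_inverse prod_inversef[symmetric])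
qed

lemma phi_monomial_form:
  assumes "2 \<le> L" "n \<in> {1..L-1}"
  shows "phi L x n i = monomial_form (L - 1) x (\<lambda>k. if k = L - 1 then -1 else 0)
    (\<lambda>k. if k = n then 0 else -1) (\<lambda>j. if j = i then -1 else 0)"
proof
  fix t :: "nat \<Rightarrow> complex"
  have "(\<Prod>k=1..L-1. t k powi (if k = L - 1 then -1 else 0)) = (\<Prod>k=1..L-1. if k = L - 1 then inverse (t k) else 1)"
    by (intro prod.cong refl) (simp add: power_int_minus)
  also have "\<dots> = inverse (t (L - 1))" using assms by (subst prod.delta) auto
  finally have 1: "(\<Prod>k=1..L-1. t k powi (if k = L - 1 then -1 else 0)) = inverse (t (L - 1))" .
  have "(\<Prod>j\<in>UNIV. (1 - x $ j * t (L - 1)) powi (if j = i then -1 else 0)) =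
    (\<Prod>j\<in>UNIV. if j = i then inverse (1 - x $ j * t (L - 1)) else 1)"
    by (intro prod.cong refl) (simp add: power_int_minus)
  also have "\<dots> = inverse (1 - x $ i * t (L - 1))" by (subst prod.delta) auto
  finally have 2: "(\<Prod>j\<in>UNIV. (1 - x $ j * t (L - 1)) powi (if j = i then -1 else 0)) = inverse (1 - x $ i * t (L - 1))" .
  have 3: "(\<Prod>k=1..L-1. (t (k - 1) - t k) powi (if k = n then 0 else -1)) =
    inverse (\<Prod>k\<in>{1..L-1} - {n}. t (k - 1) - t k)"
    using assms(2) unfolding prod_inversef[symmetric]
    by (subst prod.remove[of _ n]) (auto simp: power_int_minus intro!: prod.cong)
  show "phi L x n i t = monomial_form (L - 1) x (\<lambda>k. if k = L - 1 then -1 else 0)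
      (\<lambda>k. if k = n then 0 else -1) (\<lambda>j. if j = i then -1 else 0) t"
    unfolding monomial_form_def 1 2 3 phi_def by (simp add: divide_inverse)
qed

text \<open>Expressing every form through \<open>phi0\<close> turns relations between the forms into
  identities of rational functions of t.\<close>

lemma phi_phi0:
  assumes "t \<in> T_space L x" "n \<in> {1..L-1}"
  shows "phi L x n i t = (t (n - 1) - t n) / (1 - x $ i * t (L - 1)) * phi0 L t"
proof -
  have "(\<Prod>k=1..L-1. t (k - 1) - t k) = (t (n - 1) - t n) * (\<Prod>k\<in>{1..L-1} - {n}. t (k - 1) - t k)"
    using assms(2) by (intro prod.remove) auto
  then show ?thesis
    using T_spaceD(3)[OF assms] T_spaceD(4)[OF assms(1)] by (simp add: phi_def phi0_def)
qed

lemma sum_telescope_down: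
  fixes t :: "nat \<Rightarrow> complex"
  assumes "n \<le> p"
  shows "(\<Sum>m=n+1..p. t (m - 1) - t m) = t n - t p"
  using assms by (induction p rule: dec_induct) (simp_all add: sum.atLeast_Suc_atMost)

text \<open>The action of the dilation field on exponents. The factor t_r - t_(r+1) contributes t_r
  and -t_(r+1) over t_r - t_(r+1) in consecutive summands, together the constant
  \<open>b (r + 1)\<close>; only t_(n-1) - t_n, whose first entry is not scaled, keeps a fraction.
  The summands 1 come from the differentials dt_r.\<close>

lemma sum_dlog:
  assumes "n \<in> {1..p}" and t: "\<And>k. k \<in> {1..p} \<Longrightarrow> t k \<noteq> 0" "\<And>k. k \<in> {1..p} \<Longrightarrow> t (k - 1) - t k \<noteq> 0"
  shows "(\<Sum>r=n..p. 1 + t r * dlog p x a b c r t) =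
    (\<Sum>r=n..p. 1 + a r) + (\<Sum>r=n+1..p. b r) - b n * t n / (t (n - 1) - t n)
      - (\<Sum>j\<in>UNIV. c j * x $ j * t p / (1 - x $ j * t p))"
proof -
  have "n \<le> p" "1 \<le> n" using assms(1) by auto
  then show ?thesis
  proof (induction n rule: inc_induct)
    case base
    have "t p * (a p / t p) = a p" using t(1)[of p] base by simp
    then show ?case
      by (simp add: dlog_def right_diff_distrib distrib_left sum_distrib_left sum_distrib_right mult_ac)
  next
    case (step n)
    have peel: "(\<Sum>r=n..p. f r) = f n + (\<Sum>r=Suc n..p. f r)" for f :: "nat \<Rightarrow> complex"
      using step.hyps by (intro sum.atLeast_Suc_atMost) simp
    have b: "(\<Sum>r=n+1..p. b r) = b (Suc n) + (\<Sum>r=Suc n+1..p. b r)"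
      using sum.atLeast_Suc_atMost[of "Suc n" p b] step.hyps by simp
    have t0: "t n \<noteq> 0" "t n - t (Suc n) \<noteq> 0"
      using t(1)[of n] t(2)[of "Suc n"] step by auto
    then have "b (Suc n) * (t n - t (Suc n)) / (t n - t (Suc n)) = b (Suc n)" by simp
    then have v: "b (Suc n) * t n / (t n - t (Suc n)) = b (Suc n) + b (Suc n) * t (Suc n) / (t n - t (Suc n))"
      by (simp add: right_diff_distrib diff_divide_distrib algebra_simps)
    have "t n * dlog p x a b c n t = a n - b n * t n / (t (n - 1) - t n) + b (Suc n) * t n / (t n - t (Suc n))"
      using step.hyps t0 by (simp add: dlog_def algebra_simps)
    then have d: "t n * dlog p x a b c n t = a n - b n * t n / (t (n - 1) - t n) +
        (b (Suc n) + b (Suc n) * t (Suc n) / (t n - t (Suc n)))"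
      unfolding v .
    have IH: "(\<Sum>r=Suc n..p. 1 + t r * dlog p x a b c r t) =
      (\<Sum>r=Suc n..p. 1 + a r) + (\<Sum>r=Suc n+1..p. b r) - b (Suc n) * t (Suc n) / (t n - t (Suc n))
        - (\<Sum>j\<in>UNIV. c j * x $ j * t p / (1 - x $ j * t p))"
      using step.IH by simp
    show ?case
      unfolding peel b d IH by simp
  qed
qed

text \<open>The constant part of the weight of \<open>U\<close> times a form
  \<open>phi L x n i\<close> under scaling t_n, ..., t_p. The p-n+1 differentials cancel against the
  poles along t_p and the p-n differences after the n-th, and the exponents of \<open>U\<close>
  telescope.\<close>

lemma sum_exponents:
  assumes "n \<le> p"
  shows "(\<Sum>r=n..p. 1 + (U_exponent p \<alpha> \<gamma> r + of_int (if r = p then -1 else 0))) +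
    (\<Sum>r=n+1..p. \<gamma> r - \<alpha> r - 1) = \<alpha> n"
  using assms
proof (induction n rule: inc_induct)
  case base
  then show ?case by (simp add: U_exponent_def)
next
  case (step n)
  let ?f = "\<lambda>r. 1 + (U_exponent p \<alpha> \<gamma> r + of_int (if r = p then -1 else 0))"
  have "?f n = 1 + (\<alpha> n - \<gamma> (Suc n))" using step.hyps by (simp add: U_exponent_def)
  moreover have "(\<Sum>r=n..p. ?f r) = ?f n + (\<Sum>r=Suc n..p. ?f r)"
    using step.hyps by (intro sum.atLeast_Suc_atMost) simp
  ultimately have 1: "(\<Sum>r=n..p. ?f r) = (1 + (\<alpha> n - \<gamma> (Suc n))) + (\<Sum>r=Suc n..p. ?f r)" by simp
  have 2: "(\<Sum>r=n+1..p. \<gamma> r - \<alpha> r - 1) = (\<gamma> (Suc n) - \<alpha> (Suc n) - 1) + (\<Sum>r=Suc n+1..p. \<gamma> r - \<alpha> r - 1)"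
    using sum.atLeast_Suc_atMost[of "Suc n" p "\<lambda>r. \<gamma> r - \<alpha> r - 1"] step.hyps by simp
  show ?case
    unfolding 1 2 step.IH[symmetric] by simp
qed

section \<open>Derivatives of twisted integrals in \<open>x\<close>\<close>

definition coord_update :: "complex ^ 'n \<Rightarrow> 'n \<Rightarrow> complex \<Rightarrow> complex ^ 'n" where
  "coord_update x i z = (\<chi> j. if j = i then z else x $ j)"

lemma coord_update_same [simp]: "coord_update x i (x $ i) = x"
  by (simp add: coord_update_def vec_eq_iff)

lemma coord_update_nth: "coord_update x i z $ j = (if j = i then z else x $ j)"
  by (simp add: coord_update_def)

lemma continuous_on_coord_update: "continuous_on S (coord_update x i)"
  unfolding coord_update_def
proof (intro continuous_on_vec_lambda)
  fix j show "continuous_on S (\<lambda>z. if j = i then z else x $ j)"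
    by (cases "j = i") (auto intro: continuous_intros)
qed

text \<open>The simplices in \<open>F\<close> are fixed, so \<open>x $ i\<close> enters only through
  the factor 1 - x_i t_p, whose exponent is \<open>d i - \<beta> i\<close>. Joint continuity of the
  branch on \<open>V\<close> times the simplex supplies the continuity needed under the integral
  sign.\<close>

lemma twisted_integral_has_field_derivative:
  fixes x :: "complex ^ 'n::finite" and \<kappa> :: "((nat \<Rightarrow> real) \<Rightarrow> nat \<Rightarrow> complex) \<Rightarrow> complex"
  assumes L: "2 \<le> L" and V: "open V" "x \<in> V" and F: "finite F"
    and smooth: "\<And>\<sigma> x. \<sigma> \<in> F \<Longrightarrow> x \<in> V \<Longrightarrow> smooth_simplex (L - 1) (T_space L x) \<sigma>"
    and u: "\<And>\<sigma>. \<sigma> \<in> F \<Longrightarrow> U_branch L \<alpha> \<gamma> \<beta> (V \<times> standard_simplex (L - 1)) fst (\<lambda>(x, s). \<sigma> s) (u \<sigma>)"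
  defines "c \<equiv> \<lambda>x \<sigma> s. if \<sigma> \<in> F \<and> s \<in> standard_simplex (L - 1) then \<kappa> \<sigma> * u \<sigma> (x, s) else 0"
  shows "((\<lambda>z. twisted_integral (L - 1) (monomial_form (L - 1) (coord_update x i z) a b d) (c (coord_update x i z)))
    has_field_derivative twisted_integral (L - 1)
      (\<lambda>t. (\<beta> i - of_int (d i)) * (monomial_form (L - 1) x a b d t * (t (L - 1) / (1 - x $ i * t (L - 1))))) (c x)) (at (x $ i))"
proof -
  let ?p = "L - 1"
  let ?K = "standard_simplex ?p"
  have supp: "chain_support (c x) \<subseteq> F" for x by (auto simp: chain_support_def c_def)
  have "open (coord_update x i -` V)"
    by (rule open_vimage[OF V(1) continuous_on_coord_update])
  moreover have "x $ i \<in> coord_update x i -` V" using V(2) by simp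
  \<comment> \<open>A closed disc is taken so that, together with the simplex, it forms a compact
    parameter set.\<close>
  ultimately obtain \<rho> where \<rho>: "0 < \<rho>" "cball (x $ i) \<rho> \<subseteq> coord_update x i -` V"
    using open_contains_cball by blast
  have "((\<lambda>z. form_integral ?p (monomial_form ?p (coord_update x i z) a b d) (\<lambda>j. j) \<sigma> (c (coord_update x i z) \<sigma>))
    has_field_derivative form_integral ?p
      (\<lambda>t. (\<beta> i - of_int (d i)) * (monomial_form ?p x a b d t * (t ?p / (1 - x $ i * t ?p)))) (\<lambda>j. j) \<sigma> (c x \<sigma>)) (at (x $ i))"
    if \<sigma>: "\<sigma> \<in> F" for \<sigma>
  proof -
    obtain A B C where logs: "branch_logs ?p (V \<times> ?K) fst (\<lambda>(x, s). \<sigma> s) A B C"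
      and us: "\<forall>s\<in>V \<times> ?K. u \<sigma> s = U_log_branch ?p \<alpha> \<gamma> \<beta> A B C s"
      using U_branch_logs[OF u[OF \<sigma>] L] by blast
    define ea where "ea k = U_exponent ?p \<alpha> \<gamma> k + of_int (a k)" for k
    define eb where "eb k = \<gamma> k - \<alpha> k + of_int (b k)" for k
    define ed where "ed j = - \<beta> j + of_int (d j)" for j
    define Q where "Q = log_branch ?p ea eb ed A B C"
    have Q: "u \<sigma> (y, s) * monomial_form ?p y a b d (\<sigma> s) = Q (y, s)" if "y \<in> V" "s \<in> ?K" for y s
    proof -
      have ys: "(y, s) \<in> V \<times> ?K" using that by simp
      show ?thesis
        using monomial_form_log_branch[OF logs ys, of a b d] bspec[OF us ys]
        by (simp add: Q_def ea_def[abs_def] eb_def[abs_def] ed_def[abs_def] log_branch_mult)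
    qed
    have \<sigma>c: "C1_simplex ?p (\<lambda>u j. \<sigma> u j)"
      using smooth[OF \<sigma> V(2)] by (intro C1_simplex_smooth) (simp add: smooth_simplex_def)
    obtain J where J: "continuous_on ?K J"
      "\<And>s. s \<in> open_simplex ?p \<Longrightarrow> simplex_jacobian ?p \<sigma> s = J (barycentric ?p s)"
      using simplex_jacobian_continuous[OF \<sigma>c] by blast
    have cont_\<sigma>: "continuous_on ?K (\<lambda>s. \<sigma> s k)" for k
    proof -
      have "\<exists>f1 f2. simplex_derivs ?p (\<lambda>s. \<sigma> s k) f1 f2"
        using smooth[OF \<sigma> V(2)] by (intro smooth_on_simplex_derivs) (simp add: smooth_simplex_def)
      moreover have "1 \<in> {1..?p}" using L by simp
      ultimately show ?thesis unfolding simplex_derivs_def simplex_deriv_def by blast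
    qed
    have z_in: "coord_update x i z \<in> V" if "z \<in> cball (x $ i) \<rho>" for z using \<rho>(2) that by blast
    have ex: "exp (A k (y, s)) = \<sigma> s k" "exp (B k (y, s)) = \<sigma> s (k - 1) - \<sigma> s k"
      if "k \<in> {1..?p}" "y \<in> V" "s \<in> ?K" for k y s
      using logs that unfolding branch_logs_def by auto
    have exC: "exp (C j (y, s)) = 1 - y $ j * \<sigma> s ?p" if "y \<in> V" "s \<in> ?K" for j y s
      using logs that unfolding branch_logs_def by auto
    define G where "G z s = \<kappa> \<sigma> * Q (coord_update x i z, s) * J s" for z s
    define G' where "G' z s = \<kappa> \<sigma> * (Q (coord_update x i z, s) * (ed i * (- \<sigma> s ?p / (1 - z * \<sigma> s ?p)))) * J s" for z s
    have nz: "1 - z * \<sigma> s ?p \<noteq> 0" if "z \<in> cball (x $ i) \<rho>" "s \<in> ?K" for z s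
      using exC[OF z_in[OF that(1)] that(2), of i] by (metis coord_update_nth exp_not_eq_zero)
    have contQ: "continuous_on (cball (x $ i) \<rho> \<times> ?K) (\<lambda>(z, s). Q (coord_update x i z, s))"
    proof -
      have "continuous_on (cball (x $ i) \<rho> \<times> ?K) (\<lambda>w. (coord_update x i (fst w), snd w))"
        by (intro continuous_on_Pair continuous_on_snd continuous_on_id
            continuous_on_compose2[OF continuous_on_coord_update[of UNIV] continuous_on_fst]) auto
      moreover have "(\<lambda>w. (coord_update x i (fst w), snd w)) ` (cball (x $ i) \<rho> \<times> ?K) \<subseteq> V \<times> ?K"
        using z_in by auto
      ultimately show ?thesis
        unfolding Q_def case_prod_unfold by (rule continuous_on_compose2[OF continuous_on_log_branch[OF logs]])
    qed
    have cb: "c y \<sigma> s = \<kappa> \<sigma> * u \<sigma> (y, s)" if "s \<in> ?K" for y s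
      using that \<sigma> by (simp only: c_def simp_thms if_True)
    have dQ: "((\<lambda>z. Q (coord_update x i z, s)) has_field_derivative
        Q (coord_update x i z, s) * (ed i * (- \<sigma> s ?p / (1 - z * \<sigma> s ?p)))) (at z)"
      if z: "z \<in> cball (x $ i) \<rho>" and s: "s \<in> ?K" for z s
    proof -
      have lim: "((\<lambda>w. (coord_update x i w, s)) \<longlongrightarrow> (coord_update x i z, s)) (at z)"
        using continuous_on_coord_update[of UNIV x i]
        by (intro tendsto_Pair tendsto_const) (simp add: continuous_on_def)
      have evV: "eventually (\<lambda>w. coord_update x i w \<in> V) (nhds z)"
        using eventually_nhds_in_open[OF open_vimage[OF V(1) continuous_on_coord_update], of z x i] z_in[OF z]
        by (simp add: vimage_def)
      have ev: "eventually (\<lambda>w. (coord_update x i w, s) \<in> V \<times> ?K) (at z)"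
        using evV s by (auto simp: eventually_at_filter elim: eventually_mono)
      have cont: "isCont (\<lambda>w. H (coord_update x i w, s)) z" if "continuous_on (V \<times> ?K) H" for H :: "(complex ^ 'n) \<times> (nat \<Rightarrow> real) \<Rightarrow> complex"
        unfolding isCont_def
        by (rule continuous_on_tendsto_compose[OF that lim _ ev]) (use z_in[OF z] s in simp)
      have contA: "continuous_on (V \<times> ?K) (A k)" "continuous_on (V \<times> ?K) (B k)" if "k \<in> {1..?p}" for k
        using logs that unfolding branch_logs_def by blast+
      have contC: "continuous_on (V \<times> ?K) (C k)" for k
        using logs unfolding branch_logs_def by blast
      \<comment> \<open>\<open>A k\<close> and \<open>B k\<close> are continuous logarithms of
        quantities independent of \<open>w\<close>, so they have derivative 0, although nothing in
        the definition says that they are constant in \<open>x\<close>.\<close>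
      have dA: "((\<lambda>w. A k (coord_update x i w, s)) has_field_derivative 0) (at z)"
        "((\<lambda>w. B k (coord_update x i w, s)) has_field_derivative 0) (at z)" if k: "k \<in> {1..?p}" for k
      proof -
        have "eventually (\<lambda>w. exp (A k (coord_update x i w, s)) = \<sigma> s k) (nhds z)"
          using evV by eventually_elim (rule ex(1)[OF k _ s])
        from has_field_derivative_continuous_log[OF DERIV_const cont[OF contA(1)[OF k]] this]
        show "((\<lambda>w. A k (coord_update x i w, s)) has_field_derivative 0) (at z)" by simp
        have "eventually (\<lambda>w. exp (B k (coord_update x i w, s)) = \<sigma> s (k - 1) - \<sigma> s k) (nhds z)"
          using evV by eventually_elim (rule ex(2)[OF k _ s])
        from has_field_derivative_continuous_log[OF DERIV_const cont[OF contA(2)[OF k]] this]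
        show "((\<lambda>w. B k (coord_update x i w, s)) has_field_derivative 0) (at z)" by simp
      qed
      have dC: "((\<lambda>w. C j (coord_update x i w, s)) has_field_derivative
          (if j = i then - \<sigma> s ?p / (1 - z * \<sigma> s ?p) else 0)) (at z)" for j
      proof -
        have "eventually (\<lambda>w. exp (C j (coord_update x i w, s)) = 1 - coord_update x i w $ j * \<sigma> s ?p) (nhds z)"
          using evV by eventually_elim (rule exC[OF _ s])
        moreover have "((\<lambda>w. 1 - coord_update x i w $ j * \<sigma> s ?p) has_field_derivative (if j = i then - \<sigma> s ?p else 0)) (at z)"
          by (cases "j = i") (auto simp: coord_update_nth intro!: derivative_eq_intros)
        ultimately show ?thesis
          using has_field_derivative_continuous_log[OF _ cont[OF contC[of j]]]
          by (cases "j = i") (fastforce simp: coord_update_nth)+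
      qed
      have "((\<lambda>w. (\<Sum>k=1..?p. ea k * A k (coord_update x i w, s)) + (\<Sum>k=1..?p. eb k * B k (coord_update x i w, s)) +
          (\<Sum>j\<in>UNIV. ed j * C j (coord_update x i w, s))) has_field_derivative
          (\<Sum>k=1..?p. ea k * 0) + (\<Sum>k=1..?p. eb k * 0) +
          (\<Sum>j\<in>UNIV. ed j * (if j = i then - \<sigma> s ?p / (1 - z * \<sigma> s ?p) else 0))) (at z)"
        by (intro DERIV_add DERIV_sum DERIV_cmult dA dC)
      also have "(\<Sum>k=1..?p. ea k * 0) + (\<Sum>k=1..?p. eb k * 0) +
          (\<Sum>j\<in>UNIV. ed j * (if j = i then - \<sigma> s ?p / (1 - z * \<sigma> s ?p) else 0)) = ed i * (- \<sigma> s ?p / (1 - z * \<sigma> s ?p))"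
        by (simp add: if_distrib[of "\<lambda>y. _ * y"] cong: if_cong)
      finally show ?thesis
        unfolding Q_def log_branch_def by (rule DERIV_chain2[OF DERIV_exp])
    qed
    have dG: "((\<lambda>z. simplex_integral ?p (G z)) has_field_derivative simplex_integral ?p (G' (x $ i))) (at (x $ i))"
    proof (rule simplex_integral_has_field_derivative[OF \<rho>(1)])
      fix z assume z: "z \<in> cball (x $ i) \<rho>"
      show "((\<lambda>z. G z s) has_field_derivative G' z s) (at z)" if "s \<in> ?K" for s
        unfolding G_def G'_def by (intro DERIV_cmult DERIV_cmult_right dQ z that)
      have "continuous_on ?K (\<lambda>s. (z, s))"
        by (intro continuous_on_Pair continuous_on_const continuous_on_id)
      moreover have "(\<lambda>s. (z, s)) ` ?K \<subseteq> cball (x $ i) \<rho> \<times> ?K" using z by blast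
      ultimately have "continuous_on ?K (\<lambda>s. (\<lambda>(z, s). Q (coord_update x i z, s)) (z, s))"
        by (rule continuous_on_compose2[OF contQ])
      then show "continuous_on ?K (G z)"
        unfolding G_def by (intro continuous_on_mult continuous_on_const J) simp
    next
      have s: "continuous_on (cball (x $ i) \<rho> \<times> ?K) (\<lambda>w. \<sigma> (snd w) ?p)" "continuous_on (cball (x $ i) \<rho> \<times> ?K) (\<lambda>w. J (snd w))"
        by (rule continuous_on_compose2[OF cont_\<sigma> continuous_on_snd[OF continuous_on_id]], force)
           (rule continuous_on_compose2[OF J(1) continuous_on_snd[OF continuous_on_id]], force)
      have "1 - fst w * \<sigma> (snd w) ?p \<noteq> 0" if "w \<in> cball (x $ i) \<rho> \<times> ?K" for w
        using nz[of "fst w" "snd w"] that by (auto simp: mem_Times_iff)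
      then show "continuous_on (cball (x $ i) \<rho> \<times> ?K) (\<lambda>(z, s). G' z s)"
        unfolding G'_def case_prod_unfold
        by (intro continuous_on_mult continuous_on_divide continuous_on_minus continuous_on_diff continuous_on_const
            continuous_on_fst continuous_on_id s contQ[unfolded case_prod_unfold] ballI)
    qed
    have G_eq: "simplex_integral ?p (G z) = form_integral ?p (monomial_form ?p (coord_update x i z) a b d) (\<lambda>j. j) \<sigma> (c (coord_update x i z) \<sigma>)"
      if "z \<in> cball (x $ i) \<rho>" for z
      unfolding simplex_integral_def form_integral_def
    proof (intro set_lebesgue_integral_cong open_simplex_sets allI impI)
      fix s assume s: "s \<in> open_simplex ?p"
      note b = barycentric_open_simplex[OF s]
      show "G z (barycentric ?p s) = c (coord_update x i z) \<sigma> (barycentric ?p s) *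
          monomial_form ?p (coord_update x i z) a b d (\<sigma> (barycentric ?p s)) * simplex_jacobian ?p (\<lambda>u j. \<sigma> u j) s"
        unfolding G_def cb[OF b] J(2)[OF s] Q[OF z_in[OF that] b, symmetric] by (simp only: mult_ac)
    qed
    have G'_eq: "simplex_integral ?p (G' (x $ i)) = form_integral ?p
      (\<lambda>t. (\<beta> i - of_int (d i)) * (monomial_form ?p x a b d t * (t ?p / (1 - x $ i * t ?p)))) (\<lambda>j. j) \<sigma> (c x \<sigma>)"
      unfolding simplex_integral_def form_integral_def
    proof (intro set_lebesgue_integral_cong open_simplex_sets allI impI)
      fix s assume s: "s \<in> open_simplex ?p"
      note b = barycentric_open_simplex[OF s]
      have "ed i * (- y / w) = (\<beta> i - of_int (d i)) * (y / w)" for y w by (simp add: ed_def algebra_simps)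
      then show "G' (x $ i) (barycentric ?p s) = c x \<sigma> (barycentric ?p s) *
          ((\<beta> i - of_int (d i)) * (monomial_form ?p x a b d (\<sigma> (barycentric ?p s)) *
            (\<sigma> (barycentric ?p s) ?p / (1 - x $ i * \<sigma> (barycentric ?p s) ?p)))) * simplex_jacobian ?p (\<lambda>u j. \<sigma> u j) s"
        unfolding G'_def cb[OF b] J(2)[OF s] coord_update_same Q[OF V(2) b, symmetric] by (simp only: mult_ac)
    qed
    have "eventually (\<lambda>z. z \<in> cball (x $ i) \<rho>) (nhds (x $ i))"
      using eventually_nhds_in_open[OF open_ball, of "x $ i" "x $ i" \<rho>] \<rho>(1)
      by (auto elim!: eventually_mono)
    then have "eventually (\<lambda>z. simplex_integral ?p (G z) =
        form_integral ?p (monomial_form ?p (coord_update x i z) a b d) (\<lambda>j. j) \<sigma> (c (coord_update x i z) \<sigma>)) (nhds (x $ i))"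
      by eventually_elim (rule G_eq)
    from DERIV_cong_ev[OF refl this refl] dG show ?thesis
      unfolding G'_eq by blast
  qed
  then have "((\<lambda>z. \<Sum>\<sigma>\<in>F. form_integral ?p (monomial_form ?p (coord_update x i z) a b d) (\<lambda>j. j) \<sigma> (c (coord_update x i z) \<sigma>))
    has_field_derivative (\<Sum>\<sigma>\<in>F. form_integral ?p
      (\<lambda>t. (\<beta> i - of_int (d i)) * (monomial_form ?p x a b d t * (t ?p / (1 - x $ i * t ?p)))) (\<lambda>j. j) \<sigma> (c x \<sigma>))) (at (x $ i))"
    by (rule DERIV_sum)
  then show ?thesis by (simp only: twisted_integral_superset[OF F supp])
qed

subsection \<open>The Pfaffian system\<close>

lemma continuous_on_T_coord: "continuous_on S (\<lambda>t :: nat \<Rightarrow> complex. t k)"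
  by (rule continuous_on_subset[OF continuous_on_product_coordinates]) simp

lemma continuous_on_phi0:
  assumes "2 \<le> L"
  shows "continuous_on (T_space L x) (phi0 L)"
  unfolding phi0_def
  using T_spaceD(2,3)[of _ L x] assms
  by (intro continuous_on_divide continuous_on_mult continuous_on_prod continuous_on_diff continuous_on_const
      continuous_on_T_coord) (auto simp: prod_zero_iff)

lemma continuous_on_phi:
  assumes "2 \<le> L"
  shows "continuous_on (T_space L x) (phi L x n i)"
  unfolding phi_def
  using T_spaceD(2,3,4)[of _ L x] assms
  by (intro continuous_on_divide continuous_on_mult continuous_on_prod continuous_on_diff continuous_on_const
      continuous_on_T_coord) (auto simp: prod_zero_iff)

lemma continuous_on_dlog:
  assumes "r \<in> {1..L-1}"
  shows "continuous_on (T_space L x) (dlog (L - 1) x a b c r)"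
proof -
  have 1: "continuous_on (T_space L x) (\<lambda>t. a r / t r - b r / (t (r - 1) - t r))"
    using T_spaceD(2,3)[OF _ assms]
    by (intro continuous_on_diff continuous_on_divide continuous_on_const continuous_on_T_coord) auto
  have 2: "continuous_on (T_space L x) (\<lambda>t. b (r + 1) / (t r - t (r + 1)))" if "r < L - 1"
    using T_spaceD(3)[of _ L x "r + 1"] that
    by (intro continuous_on_diff continuous_on_divide continuous_on_const continuous_on_T_coord) auto
  have 3: "continuous_on (T_space L x) (\<lambda>t. - (\<Sum>i\<in>UNIV. c i * x $ i / (1 - x $ i * t (L - 1))))"
    using T_spaceD(4)[of _ L x]
    by (intro continuous_on_minus continuous_on_sum continuous_on_diff continuous_on_divide continuous_on_mult
        continuous_on_const continuous_on_T_coord) auto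
  show ?thesis
    unfolding dlog_def using 1 2 3
    by (cases "r < L - 1") (simp_all only: if_True if_False continuous_on_add)
qed

text \<open>In terms of \<open>phi0\<close> the summands differ only in the factor t_(m-1) - t_m,
  and these factors telescope.\<close>

lemma sum_phi:
  assumes t: "t \<in> T_space L x" and n: "n \<le> L - 1"
  shows "(\<Sum>m=n+1..L-1. phi L x m i t) = (t n - t (L - 1)) / (1 - x $ i * t (L - 1)) * phi0 L t"
proof -
  have "(\<Sum>m=n+1..L-1. phi L x m i t) = (\<Sum>m=n+1..L-1. (t (m - 1) - t m) * (phi0 L t / (1 - x $ i * t (L - 1))))"
    by (intro sum.cong refl) (simp add: phi_phi0[OF t])
  also have "\<dots> = (t n - t (L - 1)) * (phi0 L t / (1 - x $ i * t (L - 1)))"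
    unfolding sum_distrib_right[symmetric] sum_telescope_down[OF n] ..
  finally show ?thesis by simp
qed

text \<open>The telescoped sum from t_0 = 1 has numerator 1 - t_(L-1); subtracting the denominator 1
  - x_i t_(L-1) leaves (x_i - 1) t_(L-1). This is the first equation before integration, without the
  factor beta_i.\<close>

lemma phi0_deriv_relation:
  assumes t: "t \<in> T_space L x"
  shows "(x $ i - 1) * (phi0 L t * (t (L - 1) / (1 - x $ i * t (L - 1)))) = (\<Sum>m=1..L-1. phi L x m i t) - phi0 L t"
proof -
  let ?q = "1 - x $ i * t (L - 1)"
  have q: "?q \<noteq> 0" by (rule T_spaceD(4)[OF t])
  have "(\<Sum>m=1..L-1. phi L x m i t) - phi0 L t = ((1 - t (L - 1)) / ?q - 1) * phi0 L t"
    using sum_phi[OF t, of 0 i] T_spaceD(1)[OF t] by (simp add: algebra_simps)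
  also have "(1 - t (L - 1)) / ?q - 1 = (x $ i - 1) * (t (L - 1) / ?q)"
    using q by (simp add: divide_simps) (simp add: algebra_simps)
  finally show ?thesis by simp
qed

text \<open>The partial fraction identity for the reciprocals of 1 - x_i t_(L-1) and 1 - x_j
  t_(L-1). It is the second equation before integration, and it also converts the sum over
  \<open>j\<close> in the third.\<close>

lemma phi_deriv_relation:
  assumes t: "t \<in> T_space L x" and n: "n \<in> {1..L-1}"
  shows "(x $ i - x $ j) * (phi L x n j t * (t (L - 1) / (1 - x $ i * t (L - 1)))) = phi L x n i t - phi L x n j t"
proof -
  let ?q = "\<lambda>i. 1 - x $ i * t (L - 1)"
  have q: "?q i \<noteq> 0" "?q j \<noteq> 0" by (rule T_spaceD(4)[OF t])+
  show ?thesis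
    unfolding phi_phi0[OF t n] using q by (simp add: divide_simps) (simp add: algebra_simps)
qed

text \<open>The third equation before integration: the last sum is the exact part and disappears
  over a cycle. On the left the 1 in \<open>\<beta> i + 1\<close> comes from the factor of
  \<open>phi L x n i\<close> that itself depends on x_i.\<close>

lemma phi_exact_relation:
  fixes x :: "complex ^ 'n::finite"
  assumes x: "x \<in> X_space" and t: "t \<in> T_space L x" and n: "n \<in> {1..L-1}"
  shows "x $ i * ((\<beta> i + 1) * (phi L x n i t * (t (L - 1) / (1 - x $ i * t (L - 1))))) =
    - \<alpha> n * phi L x n i t + (\<gamma> n - \<alpha> n) * (\<Sum>m=n+1..L-1. phi L x m i t)
    + (\<gamma> n - \<alpha> n) / (x $ i - 1) * (- phi0 L t + (\<Sum>m=1..L-1. phi L x m i t))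
    + (\<Sum>j\<in>UNIV - {i}. \<beta> j * x $ j / (x $ i - x $ j) * (phi L x n j t - phi L x n i t))
    + (\<Sum>r=n..L-1. phi L x n i t * (1 + t r * U_dlog (L - 1) \<alpha> \<gamma> \<beta> x
         (\<lambda>k. if k = L - 1 then -1 else 0) (\<lambda>k. if k = n then 0 else -1) (\<lambda>j. if j = i then -1 else 0) r t))"
proof -
  let ?p = "L - 1"
  let ?q = "\<lambda>j. 1 - x $ j * t ?p"
  let ?\<phi> = "phi L x n i t"
  let ?w = "t n / (t (n - 1) - t n)"
  have q: "?q j \<noteq> 0" for j by (rule T_spaceD(4)[OF t])
  have xij: "x $ i - x $ j \<noteq> 0" if "j \<noteq> i" for j
    using x that by (auto simp: X_space_def)
  have x1: "x $ i - 1 \<noteq> 0" using x by (simp add: X_space_def)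
  have dn: "t (n - 1) - t n \<noteq> 0" by (rule T_spaceD(3)[OF t n])
  have \<phi>: "?\<phi> = (t (n - 1) - t n) / ?q i * phi0 L t" by (rule phi_phi0[OF t n])
  \<comment> \<open>The sum over m > n telescopes to t_n - t_(L-1), and the second term supplies the
    missing t_(L-1). What remains is the fraction t_n / (t_(n-1) - t_n) produced by the dilation
    field.\<close>
  have 1: "(\<Sum>m=n+1..?p. phi L x m i t) + 1 / (x $ i - 1) * (- phi0 L t + (\<Sum>m=1..?p. phi L x m i t)) = ?\<phi> * ?w"
  proof -
    have "1 / (x $ i - 1) * (- phi0 L t + (\<Sum>m=1..?p. phi L x m i t)) = phi0 L t * (t ?p / ?q i)"
      using phi0_deriv_relation[OF t, of i] x1 by (simp add: field_simps)
    moreover have "(\<Sum>m=n+1..?p. phi L x m i t) = (t n - t ?p) / ?q i * phi0 L t"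
      using n by (intro sum_phi[OF t]) auto
    moreover have "?\<phi> * ?w = t n / ?q i * phi0 L t"
      using dn by (simp add: \<phi>)
    ultimately show ?thesis by (simp add: algebra_simps diff_divide_distrib)
  qed
  have 2: "\<beta> j * x $ j / (x $ i - x $ j) * (phi L x n j t - ?\<phi>) = - (?\<phi> * (\<beta> j * x $ j * t ?p / ?q j))" if "j \<noteq> i" for j
  proof -
    have "phi L x n j t - ?\<phi> = (x $ j - x $ i) * (?\<phi> * (t ?p / ?q j))"
      using phi_deriv_relation[OF t n, of j i] by simp
    also have "\<dots> = - ((x $ i - x $ j) * (?\<phi> * (t ?p / ?q j)))"
      by (metis minus_diff_eq mult_minus_left)
    finally have D: "phi L x n j t - ?\<phi> = \<dots>" .
    have "b / w * - (w * v) = - (b * v)" if "w \<noteq> 0" for b v w :: complex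
      using that by simp
    from this[OF xij[OF that]] show ?thesis unfolding D by (simp add: mult_ac)
  qed
  \<comment> \<open>The weight of the whole integrand under E_n. Since \<open>phi L x n i\<close>
    omits the n-th difference, that factor keeps the exponent
    \<open>\<gamma> n - \<alpha> n\<close>, while its pole at 1 - x_i t_(L-1) raises
    \<open>\<beta> i\<close> by 1.\<close>
  have S: "(\<Sum>r=n..?p. 1 + t r * U_dlog ?p \<alpha> \<gamma> \<beta> x
         (\<lambda>k. if k = ?p then -1 else 0) (\<lambda>k. if k = n then 0 else -1) (\<lambda>j. if j = i then -1 else 0) r t) =
     \<alpha> n - (\<gamma> n - \<alpha> n) * ?w + (\<Sum>j\<in>UNIV-{i}. \<beta> j * x $ j * t ?p / ?q j) + (\<beta> i + 1) * (x $ i * t ?p / ?q i)"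
  proof -
    have b: "(\<Sum>r=n+1..?p. \<gamma> r - \<alpha> r + of_int (if r = n then 0 else -1)) = (\<Sum>r=n+1..?p. \<gamma> r - \<alpha> r - 1)"
      by (intro sum.cong) auto
    have c: "- (\<Sum>j\<in>UNIV. (- \<beta> j + of_int (if j = i then -1 else 0)) * x $ j * t ?p / ?q j) =
      (\<Sum>j\<in>UNIV-{i}. \<beta> j * x $ j * t ?p / ?q j) + (\<beta> i + 1) * (x $ i * t ?p / ?q i)"
    proof -
      have "- (\<Sum>j\<in>UNIV. (- \<beta> j + of_int (if j = i then -1 else 0)) * x $ j * t ?p / ?q j) =
        (\<Sum>j\<in>UNIV. (\<beta> j + (if j = i then 1 else 0)) * x $ j * t ?p / ?q j)"
        unfolding sum_negf[symmetric] by (intro sum.cong refl) (simp add: algebra_simps minus_divide_left)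
      also have "\<dots> = (\<beta> i + 1) * x $ i * t ?p / ?q i +
          (\<Sum>j\<in>UNIV-{i}. (\<beta> j + (if j = i then 1 else 0)) * x $ j * t ?p / ?q j)"
        by (subst sum.remove[of _ i]) auto
      also have "(\<Sum>j\<in>UNIV-{i}. (\<beta> j + (if j = i then 1 else 0)) * x $ j * t ?p / ?q j) = (\<Sum>j\<in>UNIV-{i}. \<beta> j * x $ j * t ?p / ?q j)"
        by (intro sum.cong) auto
      finally show ?thesis by (simp add: algebra_simps)
    qed
    have np: "n \<le> ?p" using n by simp
    note D = sum_dlog[where n=n and p="?p" and t=t and x=x and a="\<lambda>k. U_exponent ?p \<alpha> \<gamma> k + of_int (if k = ?p then -1 else 0)"
         and b="\<lambda>k. \<gamma> k - \<alpha> k + of_int (if k = n then 0 else -1)" and c="\<lambda>j. - \<beta> j + of_int (if j = i then -1 else 0)",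
         OF n T_spaceD(2,3)[OF t]]
    have c': "(\<Sum>j\<in>UNIV. (- \<beta> j + of_int (if j = i then -1 else 0)) * x $ j * t ?p / ?q j) =
      - ((\<Sum>j\<in>UNIV-{i}. \<beta> j * x $ j * t ?p / ?q j) + (\<beta> i + 1) * (x $ i * t ?p / ?q i))"
      unfolding c[symmetric] minus_minus ..
    show ?thesis
      using D[unfolded b sum_exponents[OF np] c'] by (simp only: simp_thms if_True of_int_0 add_0_right
        diff_minus_eq_add times_divide_eq_right add.assoc)
  qed
  have 3: "(\<Sum>j\<in>UNIV - {i}. \<beta> j * x $ j / (x $ i - x $ j) * (phi L x n j t - ?\<phi>)) = - (?\<phi> * (\<Sum>j\<in>UNIV-{i}. \<beta> j * x $ j * t ?p / ?q j))"
    unfolding sum_distrib_left sum_negf[symmetric] by (intro sum.cong refl 2) simp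
  have 4: "(\<gamma> n - \<alpha> n) * (\<Sum>m=n+1..?p. phi L x m i t) + (\<gamma> n - \<alpha> n) / (x $ i - 1) * (- phi0 L t + (\<Sum>m=1..?p. phi L x m i t)) =
    (\<gamma> n - \<alpha> n) * (?\<phi> * ?w)"
    unfolding 1[symmetric] by (simp add: distrib_left)
  have "- \<alpha> n * ?\<phi> + (\<gamma> n - \<alpha> n) * (\<Sum>m=n+1..?p. phi L x m i t)
    + (\<gamma> n - \<alpha> n) / (x $ i - 1) * (- phi0 L t + (\<Sum>m=1..?p. phi L x m i t)) =
    - \<alpha> n * ?\<phi> + (\<gamma> n - \<alpha> n) * (?\<phi> * ?w)"
    using 4 by (simp add: add.assoc)
  then show ?thesis
    unfolding 3 sum_distrib_left[symmetric] S by (simp only:) (simp add: algebra_simps)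
qed

text \<open>The pointwise relation is integrated term by term. Continuity on \<open>T_space\<close>
  makes each term integrable over the chain, and \<open>twisted_integral_exact\<close> removes the
  exact ones.\<close>

lemma phi_cycle_relation:
  fixes x :: "complex ^ 'n::finite"
  assumes L: "2 \<le> L" and x: "x \<in> X_space" and cyc: "c \<in> twisted_cycles L \<alpha> \<gamma> \<beta> x (L - 1)" and n: "n \<in> {1..L-1}"
  defines "I \<equiv> \<lambda>\<psi>. twisted_integral (L - 1) \<psi> c"
  shows "x $ i * I (\<lambda>t. (\<beta> i + 1) * (phi L x n i t * (t (L - 1) / (1 - x $ i * t (L - 1))))) =
    - \<alpha> n * I (phi L x n i) + (\<gamma> n - \<alpha> n) * (\<Sum>m=n+1..L-1. I (phi L x m i))
    + (\<gamma> n - \<alpha> n) / (x $ i - 1) * (- I (phi0 L) + (\<Sum>m=1..L-1. I (phi L x m i)))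
    + (\<Sum>j\<in>UNIV - {i}. \<beta> j * x $ j / (x $ i - x $ j) * (I (phi L x n j) - I (phi L x n i)))"
proof -
  let ?T = "T_space L x"
  have c: "c \<in> twisted_chains L \<alpha> \<gamma> \<beta> x (L - 1)" using cyc by (simp add: twisted_cycles_def)
  define E where "E r t = phi L x n i t * (1 + t r * U_dlog (L - 1) \<alpha> \<gamma> \<beta> x
         (\<lambda>k. if k = L - 1 then -1 else 0) (\<lambda>k. if k = n then 0 else -1) (\<lambda>j. if j = i then -1 else 0) r t)" for r t
  have E: "I (E r) = 0" if "r \<in> {n..L-1}" for r
  proof -
    have r: "r \<in> {1..L-1}" using that n by auto
    show ?thesis
      unfolding I_def E_def[abs_def] phi_monomial_form[OF L n]
      by (rule twisted_integral_exact[OF L cyc r])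
  qed
  have cE: "continuous_on ?T (E r)" if "r \<in> {n..L-1}" for r
    unfolding E_def
    by (intro continuous_on_mult continuous_on_add continuous_on_const continuous_on_T_coord continuous_on_phi[OF L]
        continuous_on_dlog) (use that n in auto)
  note cphi = continuous_on_phi[OF L, of x] and cphi0 = continuous_on_phi0[OF L, of x]
  have I_cmult: "I (\<lambda>t. a * \<psi> t) = a * I \<psi>" for a \<psi> unfolding I_def by (rule twisted_integral_cmult)
  have I_sum: "I (\<lambda>t. \<Sum>i\<in>J. \<psi> i t) = (\<Sum>i\<in>J. I (\<psi> i))" if "\<And>i. i \<in> J \<Longrightarrow> continuous_on ?T (\<psi> i)"
    for J :: "'b set" and \<psi> unfolding I_def by (rule twisted_integral_sum[OF L c that])
  have I_add: "I (\<lambda>t. \<psi> t + \<psi>' t) = I \<psi> + I \<psi>'" if "continuous_on ?T \<psi>" "continuous_on ?T \<psi>'" for \<psi> \<psi>'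
    unfolding I_def by (rule twisted_integral_add[OF L c that])
  define f1 where "f1 t = - \<alpha> n * phi L x n i t" for t
  define f2 where "f2 t = (\<gamma> n - \<alpha> n) * (\<Sum>m=n+1..L-1. phi L x m i t)" for t
  \<comment> \<open>Differences are written as sums with a factor -1, so that \<open>I_add\<close>,
    \<open>I_sum\<close> and \<open>I_cmult\<close> are all the linearity required.\<close>
  define f3 where "f3 t = (\<gamma> n - \<alpha> n) / (x $ i - 1) * ((-1) * phi0 L t + (\<Sum>m=1..L-1. phi L x m i t))" for t
  define f4 where "f4 t = (\<Sum>j\<in>UNIV - {i}. \<beta> j * x $ j / (x $ i - x $ j) * (phi L x n j t + (-1) * phi L x n i t))" for t
  define f5 where "f5 t = (\<Sum>r=n..L-1. E r t)" for t
  have c1: "continuous_on ?T f1"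
    unfolding f1_def by (intro continuous_on_mult continuous_on_const cphi)
  have c2: "continuous_on ?T f2"
    unfolding f2_def by (intro continuous_on_mult continuous_on_sum continuous_on_const cphi)
  have c3: "continuous_on ?T f3"
    unfolding f3_def by (intro continuous_on_mult continuous_on_add continuous_on_sum continuous_on_const cphi cphi0)
  have c4: "continuous_on ?T f4"
    unfolding f4_def by (intro continuous_on_mult continuous_on_add continuous_on_sum continuous_on_const cphi)
  have c5: "continuous_on ?T f5"
    unfolding f5_def by (intro continuous_on_sum cE)
  have I1: "I f1 = - \<alpha> n * I (phi L x n i)"
    unfolding f1_def[abs_def] by (rule I_cmult)
  have I2: "I f2 = (\<gamma> n - \<alpha> n) * (\<Sum>m=n+1..L-1. I (phi L x m i))"
    unfolding f2_def[abs_def] I_cmult by (subst I_sum) (rule cphi, rule refl)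
  have I3: "I f3 = (\<gamma> n - \<alpha> n) / (x $ i - 1) * (- I (phi0 L) + (\<Sum>m=1..L-1. I (phi L x m i)))"
  proof -
    have "I (\<lambda>t. (-1) * phi0 L t + (\<Sum>m=1..L-1. phi L x m i t)) =
        I (\<lambda>t. (-1) * phi0 L t) + I (\<lambda>t. \<Sum>m=1..L-1. phi L x m i t)"
      by (intro I_add continuous_on_mult continuous_on_sum continuous_on_const cphi cphi0)
    also have "I (\<lambda>t. (-1) * phi0 L t) = - I (phi0 L)" unfolding I_cmult by simp
    also have "I (\<lambda>t. \<Sum>m=1..L-1. phi L x m i t) = (\<Sum>m=1..L-1. I (phi L x m i))"
      by (rule I_sum) (rule cphi)
    finally show ?thesis unfolding f3_def[abs_def] I_cmult by simp
  qed
  have I4: "I f4 = (\<Sum>j\<in>UNIV - {i}. \<beta> j * x $ j / (x $ i - x $ j) * (I (phi L x n j) - I (phi L x n i)))"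
  proof -
    have "I f4 = (\<Sum>j\<in>UNIV - {i}. I (\<lambda>t. \<beta> j * x $ j / (x $ i - x $ j) * (phi L x n j t + (-1) * phi L x n i t)))"
      unfolding f4_def[abs_def]
      by (rule I_sum) (intro continuous_on_mult continuous_on_add continuous_on_const cphi)
    moreover have "I (\<lambda>t. phi L x n j t + (-1) * phi L x n i t) = I (phi L x n j) - I (phi L x n i)" for j
    proof -
      have "I (\<lambda>t. phi L x n j t + (-1) * phi L x n i t) = I (phi L x n j) + I (\<lambda>t. (-1) * phi L x n i t)"
        by (intro I_add continuous_on_mult continuous_on_const cphi)
      then show ?thesis unfolding I_cmult by simp
    qed
    ultimately show ?thesis unfolding I_cmult by simp
  qed
  have I5: "I f5 = 0"
  proof -
    have "I f5 = (\<Sum>r=n..L-1. I (E r))"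
      unfolding f5_def[abs_def] by (rule I_sum) (rule cE)
    then show ?thesis using E by simp
  qed
  have "x $ i * I (\<lambda>t. (\<beta> i + 1) * (phi L x n i t * (t (L - 1) / (1 - x $ i * t (L - 1))))) =
    I (\<lambda>t. x $ i * ((\<beta> i + 1) * (phi L x n i t * (t (L - 1) / (1 - x $ i * t (L - 1))))))"
    by (rule I_cmult[symmetric])
  also have "\<dots> = I (\<lambda>t. f1 t + f2 t + f3 t + f4 t + f5 t)"
    unfolding I_def
  proof (rule twisted_integral_cong[OF c])
    fix t assume t: "t \<in> ?T"
    show "x $ i * ((\<beta> i + 1) * (phi L x n i t * (t (L - 1) / (1 - x $ i * t (L - 1))))) = f1 t + f2 t + f3 t + f4 t + f5 t"
      unfolding phi_exact_relation[where \<beta>=\<beta> and \<alpha>=\<alpha> and \<gamma>=\<gamma>, OF x t n] f1_def f2_def f3_def f4_def f5_def E_def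
      by simp
  qed
  also have "\<dots> = I f1 + I f2 + I f3 + I f4 + I f5"
    by (simp only: I_add c1 c2 c3 c4 c5 continuous_on_add)
  finally show ?thesis unfolding I1 I2 I3 I4 I5 by simp
qed

theorem theorem2p2:
  fixes L :: nat
    and \<alpha> \<gamma> :: "nat \<Rightarrow> complex"
    and \<beta> :: "'n::finite \<Rightarrow> complex"
    and W :: "(complex ^ 'n) set"
    and \<Delta> :: "complex ^ 'n \<Rightarrow> twisted_chain set"
    and c :: "complex ^ 'n \<Rightarrow> twisted_chain"
    and y0 :: "complex ^ 'n \<Rightarrow> complex"
    and y :: "nat \<Rightarrow> 'n \<Rightarrow> complex ^ 'n \<Rightarrow> complex"
  assumes "L \<ge> 2"
    and "open W" and "W \<subseteq> X_space"
    and "locally_constant_family L \<alpha> \<gamma> \<beta> W \<Delta>"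
    and "\<And>x. x \<in> W \<Longrightarrow> c x \<in> \<Delta> x"
    and "\<And>x. x \<in> W \<Longrightarrow> y0 x = twisted_integral (L - 1) (phi0 L) (c x)"
    and "\<And>n i x. n \<in> {1..L-1} \<Longrightarrow> x \<in> W \<Longrightarrow>
           y n i x = twisted_integral (L - 1) (phi L x n i) (c x)"
  shows "\<forall>x\<in>W. \<forall>i. \<forall>n\<in>{1..L-1}.
     has_partial y0 i x \<and> (\<forall>j. has_partial (y n j) i x) \<and>
     (x $ i - 1) * partial i y0 x = \<beta> i * (- y0 x + (\<Sum>m=1..L-1. y m i x)) \<and>
     (\<forall>j. j \<noteq> i \<longrightarrow>
        (x $ i - x $ j) * partial i (y n j) x = \<beta> i * (y n i x - y n j x)) \<and>
     x $ i * partial i (y n i) x =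
       - \<alpha> n * y n i x
       + (\<gamma> n - \<alpha> n) * (\<Sum>m=n+1..L-1. y m i x)
       + (\<gamma> n - \<alpha> n) / (x $ i - 1) * (- y0 x + (\<Sum>m=1..L-1. y m i x))
       + (\<Sum>j\<in>UNIV - {i}. \<beta> j * x $ j / (x $ i - x $ j) * (y n j x - y n i x))"
proof (intro ballI allI)
  fix x i n assume x: "x \<in> W" and n: "n \<in> {1..L-1}"
  note L = assms(1)
  let ?p = "L - 1"
  obtain V F \<kappa> u where V: "open V" "x \<in> V" "V \<subseteq> W" and F: "finite F"
    and \<sigma>F: "\<forall>\<sigma>\<in>F. (\<forall>x\<in>V. smooth_simplex (L - 1) (T_space L x) \<sigma>) \<and>
          U_branch L \<alpha> \<gamma> \<beta> (V \<times> standard_simplex (L - 1)) fst (\<lambda>(x, s). \<sigma> s) (u \<sigma>)"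
    and rep: "\<forall>x\<in>V. (\<lambda>\<sigma> s. if \<sigma> \<in> F \<and> s \<in> standard_simplex (L - 1) then \<kappa> \<sigma> * u \<sigma> (x, s) else 0) \<in> \<Delta> x"
    using assms(4) x unfolding locally_constant_family_def by blast
  have smooth: "smooth_simplex ?p (T_space L x) \<sigma>" if "\<sigma> \<in> F" "x \<in> V" for \<sigma> x
    using \<sigma>F that by blast
  have ub: "U_branch L \<alpha> \<gamma> \<beta> (V \<times> standard_simplex ?p) fst (\<lambda>(x, s). \<sigma> s) (u \<sigma>)" if "\<sigma> \<in> F" for \<sigma>
    using \<sigma>F that by blast
  \<comment> \<open>The locally constant representative: its simplices do not move with
    \<open>x\<close>, so its integrals can be differentiated, unlike those over the arbitrary choice
    \<open>c x\<close>.\<close>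
  define R where "R = (\<lambda>x \<sigma> s. if \<sigma> \<in> F \<and> s \<in> standard_simplex ?p then \<kappa> \<sigma> * u \<sigma> (x, s) else 0)"
  \<comment> \<open>A class in the quotient is the image of one cycle \<open>c0\<close>, so both
    \<open>c x\<close> and \<open>R x\<close> are homologous to \<open>c0\<close> and their
    integrals agree.\<close>
  have hom: "\<exists>c0. (c0, c x) \<in> twisted_homologous L \<alpha> \<gamma> \<beta> x ?p \<and> (c0, R x) \<in> twisted_homologous L \<alpha> \<gamma> \<beta> x ?p"
    if "x \<in> V" for x
  proof -
    have "\<Delta> x \<in> twisted_homology L \<alpha> \<gamma> \<beta> x ?p"
      using assms(4) that V(3) unfolding locally_constant_family_def by blast
    then obtain c0 where "\<Delta> x = twisted_homologous L \<alpha> \<gamma> \<beta> x ?p `` {c0}"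
      unfolding twisted_homology_def by (rule quotientE)
    moreover have "c x \<in> \<Delta> x" using assms(5) that V(3) by blast
    moreover have "R x \<in> \<Delta> x" using rep that unfolding R_def by blast
    ultimately show ?thesis by blast
  qed
  have int: "twisted_integral ?p (monomial_form ?p x a b d) (c x) = twisted_integral ?p (monomial_form ?p x a b d) (R x)"
    if "x \<in> V" for x a b d
    using hom[OF that] twisted_integral_homologous[OF L] by metis
  have cyc: "R x \<in> twisted_cycles L \<alpha> \<gamma> \<beta> x ?p"
    using hom[OF V(2)] by (auto simp: twisted_homologous_def)
  then have ch: "R x \<in> twisted_chains L \<alpha> \<gamma> \<beta> x ?p" by (simp add: twisted_cycles_def)
  have xX: "x \<in> X_space" using x assms(3) by blast
  \<comment> \<open>The agreement is needed on all of \<open>V\<close> and not only at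
    \<open>x\<close>, because it is about to be differentiated.\<close>
  have y0: "y0 z = twisted_integral ?p (phi0 L) (R z)" if "z \<in> V" for z
    using assms(6)[of z] V(3) that int[OF that] phi0_monomial_form[OF L, of z] by auto
  have y: "y m j z = twisted_integral ?p (phi L z m j) (R z)" if "z \<in> V" "m \<in> {1..?p}" for z m j
    using assms(7)[OF that(2), of z j] V(3) that(1) int[OF that(1)] phi_monomial_form[OF L that(2), of z j] by auto
  have ev: "eventually (\<lambda>z. coord_update x i z \<in> V) (nhds (x $ i))"
    using eventually_nhds_in_open[OF open_vimage[OF V(1) continuous_on_coord_update], of "x $ i" x i] V(2)
    by (simp add: vimage_def)
  define q where "q t = t ?p / (1 - x $ i * t ?p)" for t :: "nat \<Rightarrow> complex"
  have deriv: "((\<lambda>z. twisted_integral ?p (monomial_form ?p (coord_update x i z) a b d) (R (coord_update x i z)))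
    has_field_derivative twisted_integral ?p (\<lambda>t. (\<beta> i - of_int (d i)) * (monomial_form ?p x a b d t * q t)) (R x)) (at (x $ i))"
    for a b d
    unfolding R_def q_def
    by (rule twisted_integral_has_field_derivative[OF L V(1,2) F smooth ub])
  have d0: "(coord_line y0 i x has_field_derivative
      twisted_integral ?p (\<lambda>t. \<beta> i * (phi0 L t * q t)) (R x)) (at (x $ i))"
  proof -
    have 1: "eventually (\<lambda>z. twisted_integral ?p (phi0 L) (R (coord_update x i z)) = coord_line y0 i x z) (nhds (x $ i))"
      using ev by eventually_elim (simp add: y0 coord_line_def coord_update_def)
    have 2: "((\<lambda>z. twisted_integral ?p (phi0 L) (R (coord_update x i z))) has_field_derivative
      twisted_integral ?p (\<lambda>t. \<beta> i * (phi0 L t * q t)) (R x)) (at (x $ i))"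
      using deriv[of "\<lambda>k. if k = ?p then -1 else 0" "\<lambda>_. -1" "\<lambda>_. 0"]
      unfolding phi0_monomial_form[OF L, symmetric] by simp
    show ?thesis
      by (rule iffD1[OF DERIV_cong_ev[OF refl 1 refl] 2])
  qed
  have d: "(coord_line (y n j) i x has_field_derivative
      twisted_integral ?p (\<lambda>t. (\<beta> i + (if i = j then 1 else 0)) * (phi L x n j t * q t)) (R x)) (at (x $ i))" for j
  proof -
    have 1: "eventually (\<lambda>z. twisted_integral ?p (phi L (coord_update x i z) n j) (R (coord_update x i z)) = coord_line (y n j) i x z) (nhds (x $ i))"
      using ev by eventually_elim (simp add: y[OF _ n] coord_line_def coord_update_def)
    have 2: "((\<lambda>z. twisted_integral ?p (phi L (coord_update x i z) n j) (R (coord_update x i z))) has_field_derivative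
      twisted_integral ?p (\<lambda>t. (\<beta> i + (if i = j then 1 else 0)) * (phi L x n j t * q t)) (R x)) (at (x $ i))"
    proof -
      \<comment> \<open>The exponent -1 of 1 - x_j t_(L-1) in \<open>phi L x n j\<close> counts only
        when the differentiated variable is x_j itself.\<close>
      have e: "\<beta> i - of_int (if i = j then -1 else 0) = \<beta> i + (if i = j then 1 else 0)" by simp
      show ?thesis
        using deriv[of "\<lambda>k. if k = ?p then -1 else 0" "\<lambda>k. if k = n then 0 else -1" "\<lambda>k. if k = j then -1 else 0"]
        unfolding phi_monomial_form[OF L n, symmetric] e .
    qed
    show ?thesis
      by (rule iffD1[OF DERIV_cong_ev[OF refl 1 refl] 2])
  qed
  have p0: "partial i y0 x = twisted_integral ?p (\<lambda>t. \<beta> i * (phi0 L t * q t)) (R x)"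
    unfolding partial_def by (rule DERIV_imp_deriv[OF d0])
  have pn: "partial i (y n j) x = twisted_integral ?p (\<lambda>t. (\<beta> i + (if i = j then 1 else 0)) * (phi L x n j t * q t)) (R x)" for j
    unfolding partial_def by (rule DERIV_imp_deriv[OF d])
  note yx = y[OF V(2)] and y0x = y0[OF V(2)]
  have e1: "(x $ i - 1) * partial i y0 x = \<beta> i * (- y0 x + (\<Sum>m=1..L-1. y m i x))"
  proof -
    have "(x $ i - 1) * partial i y0 x = twisted_integral ?p (\<lambda>t. ((x $ i - 1) * \<beta> i) * (phi0 L t * q t)) (R x)"
      unfolding p0 twisted_integral_cmult by simp
    also have "\<dots> = twisted_integral ?p (\<lambda>t. \<beta> i * ((-1) * phi0 L t + (\<Sum>m=1..?p. phi L x m i t))) (R x)"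
    proof (rule twisted_integral_cong[OF ch])
      fix t assume "t \<in> T_space L x"
      from phi0_deriv_relation[OF this, of i]
      have "(x $ i - 1) * (phi0 L t * q t) = (-1) * phi0 L t + (\<Sum>m=1..?p. phi L x m i t)"
        by (simp only: q_def) simp
      then show "((x $ i - 1) * \<beta> i) * (phi0 L t * q t) = \<beta> i * ((-1) * phi0 L t + (\<Sum>m=1..?p. phi L x m i t))"
        by (metis mult.assoc mult.commute)
    qed
    also have "\<dots> = \<beta> i * (twisted_integral ?p (\<lambda>t. (-1) * phi0 L t) (R x) + twisted_integral ?p (\<lambda>t. \<Sum>m=1..?p. phi L x m i t) (R x))"
      unfolding twisted_integral_cmult[of ?p "\<beta> i"]
      by (subst twisted_integral_add[OF L ch])
         (intro continuous_on_mult continuous_on_sum continuous_on_const continuous_on_phi[OF L] continuous_on_phi0[OF L] refl)+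
    also have "twisted_integral ?p (\<lambda>t. (-1) * phi0 L t) (R x) = - y0 x"
      unfolding twisted_integral_cmult y0x by simp
    also have "twisted_integral ?p (\<lambda>t. \<Sum>m=1..?p. phi L x m i t) (R x) = (\<Sum>m=1..?p. y m i x)"
      by (subst twisted_integral_sum[OF L ch continuous_on_phi[OF L]]) (intro sum.cong refl, simp only: yx)
    finally show ?thesis .
  qed
  have e2: "(x $ i - x $ j) * partial i (y n j) x = \<beta> i * (y n i x - y n j x)" if j: "j \<noteq> i" for j
  proof -
    have "(x $ i - x $ j) * partial i (y n j) x = twisted_integral ?p (\<lambda>t. ((x $ i - x $ j) * \<beta> i) * (phi L x n j t * q t)) (R x)"
      unfolding pn twisted_integral_cmult using j by simp
    also have "\<dots> = twisted_integral ?p (\<lambda>t. \<beta> i * (phi L x n i t + (-1) * phi L x n j t)) (R x)"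
    proof (rule twisted_integral_cong[OF ch])
      fix t assume "t \<in> T_space L x"
      from phi_deriv_relation[OF this n, of i j]
      have "(x $ i - x $ j) * (phi L x n j t * q t) = phi L x n i t + (-1) * phi L x n j t"
        by (simp only: q_def) simp
      then show "((x $ i - x $ j) * \<beta> i) * (phi L x n j t * q t) = \<beta> i * (phi L x n i t + (-1) * phi L x n j t)"
        by (metis mult.assoc mult.commute)
    qed
    also have "\<dots> = \<beta> i * (twisted_integral ?p (phi L x n i) (R x) + twisted_integral ?p (\<lambda>t. (-1) * phi L x n j t) (R x))"
      unfolding twisted_integral_cmult[of ?p "\<beta> i"]
      by (subst twisted_integral_add[OF L ch])
         (intro continuous_on_mult continuous_on_const continuous_on_phi[OF L] refl)+
    also have "\<dots> = \<beta> i * (y n i x - y n j x)"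
      unfolding twisted_integral_cmult yx[OF n] by simp
    finally show ?thesis .
  qed
  have e3: "x $ i * partial i (y n i) x =
       - \<alpha> n * y n i x
       + (\<gamma> n - \<alpha> n) * (\<Sum>m=n+1..L-1. y m i x)
       + (\<gamma> n - \<alpha> n) / (x $ i - 1) * (- y0 x + (\<Sum>m=1..L-1. y m i x))
       + (\<Sum>j\<in>UNIV - {i}. \<beta> j * x $ j / (x $ i - x $ j) * (y n j x - y n i x))"
  proof -
    have s: "(\<Sum>m=n+1..L-1. y m i x) = (\<Sum>m=n+1..L-1. twisted_integral ?p (phi L x m i) (R x))"
      "(\<Sum>m=1..L-1. y m i x) = (\<Sum>m=1..L-1. twisted_integral ?p (phi L x m i) (R x))"
      by (intro sum.cong refl yx, use n in simp)+
    show ?thesis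
      unfolding s y0x yx[OF n] pn q_def
      \<comment> \<open>The derivative formula at \<open>j = i\<close> carries the factor
        \<open>\<beta> i + 1\<close>, which is exactly the left side of the integrated
        relation.\<close>
      using phi_cycle_relation[OF L xX cyc n, of i] by simp
  qed
  have "has_partial y0 i x" "has_partial (y n j) i x" for j
    unfolding has_partial_def using d0 d[of j] field_differentiable_def by blast+
  with e1 e2 e3 show "has_partial y0 i x \<and> (\<forall>j. has_partial (y n j) i x) \<and>
     (x $ i - 1) * partial i y0 x = \<beta> i * (- y0 x + (\<Sum>m=1..L-1. y m i x)) \<and>
     (\<forall>j. j \<noteq> i \<longrightarrow>
        (x $ i - x $ j) * partial i (y n j) x = \<beta> i * (y n i x - y n j x)) \<and>
     x $ i * partial i (y n i) x =
       - \<alpha> n * y n i x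
       + (\<gamma> n - \<alpha> n) * (\<Sum>m=n+1..L-1. y m i x)
       + (\<gamma> n - \<alpha> n) / (x $ i - 1) * (- y0 x + (\<Sum>m=1..L-1. y m i x))
       + (\<Sum>j\<in>UNIV - {i}. \<beta> j * x $ j / (x $ i - x $ j) * (y n j x - y n i x))"
    by blast
qed

end
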